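(* Let $1\le m<n$ be integers, $\Omega\subset\mathbb{C}^n$ an open set, and $T$ an $m$-negative $m$-subharmonic current of bidimension $(p,p)$ on $\Omega$, where $m+p-1\ge n$. Let $z_0\in\Omega$ and assume that the function $t\longmapsto t^{-\frac{2n}{m}+1}\,\nu_{dd^cT}(z_0,t)$ is integrable in a neighborhood of $0$ (in $]0,+\infty[$). Then the Lelong number $\nu_T(z_0)=\lim_{r\to0^+}\nu_T(z_0,r)$ of $T$ at $z_0$ exists.
   Context: Conventions: $d=\partial+\overline\partial$, $d^c=\frac{i}{4\pi}(\overline\partial-\partial)$, so $dd^c=\frac{i}{2\pi}\partial\overline\partial$; $\beta=dd^c|z|^2$; $\mathbb{B}(a,r)=\{z\in\mathbb{C}^n: |z-a|<r\}$. A $(1,1)$-form $\alpha$ on $\Omega$ is $m$-positive if $\alpha^j\wedge\beta^{n-j}\ge 0$ for every $1\le j\le m$. A $(q,q)$-form $\alpha$ is strongly $m$-positive if $\alpha=\sum_{k=1}^N a_k\,\alpha_{1,k}\wedge\dots\wedge\alpha_{q,k}$ with $N=\binom{n}{q}$, $a_k\ge0$ and all $\alpha_{j,k}$ $m$-positive $(1,1)$-forms. A current $S$ of bidimension $(q,q)$ on $\Omega$ with $m+q\ge n$ is $m$-positive if $\langle S\wedge\beta^{n-m},\alpha\rangle\ge0$ for every strongly $m$-positive $(m+q-n,m+q-n)$-test form $\alpha$ on $\Omega$; it is $m$-negative if $-S$ is $m$-positive. A current $T$ of bidimension $(p,p)$ is $m$-subharmonic if the current $dd^cT$ (of bidimension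 $(p-1,p-1)$) is $m$-positive. For a current $S$ of bidimension $(q,q)$ with $S$ or $-S$ $m$-positive, $a\in\Omega$ and $0<r<d(a,\partial\Omega)$, $$\nu_S(a,r)=\frac{1}{r^{\frac{2n}{m}(m+q-n)}}\int_{\mathbb{B}(a,r)}S\wedge\beta^{q}.$$ In particular $\nu_{dd^cT}(a,r)=r^{-\frac{2n}{m}(m+p-1-n)}\int_{\mathbb{B}(a,r)}dd^cT\wedge\beta^{p-1}$. *)

theory Defs
  imports "HOL-Analysis.Analysis"
begin

text \<open>
  Differential forms on an open subset of \<open>\<complex>\<^sup>n\<close>, where \<open>n = CARD('n)\<close>.  The coordinates are
  indexed by a finite type \<open>'n\<close>; its linear order only serves to fix the signs in the basis
  \<open>dz\<^sub>I \<and> dzbar\<^sub>J\<close>, with the factors of \<open>dz\<^sub>I\<close> and of \<open>dzbar\<^sub>J\<close> written in increasing order.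
  The value \<open>\<omega> x I J\<close> is the coefficient of \<open>dz\<^sub>I \<and> dzbar\<^sub>J\<close> at the point \<open>x\<close>; forms of mixed
  degree are allowed, and bidegree is a separate predicate.
\<close>

type_synonym 'n cspace = "(complex, 'n) vec"

type_synonym 'n dform = "'n cspace \<Rightarrow> 'n set \<Rightarrow> 'n set \<Rightarrow> complex"

definition bideg_on :: "'n cspace set \<Rightarrow> nat \<Rightarrow> nat \<Rightarrow> 'n::{finite,linorder} dform \<Rightarrow> bool" where
  "bideg_on \<Omega> p q \<omega> \<longleftrightarrow> (\<forall>x\<in>\<Omega>. \<forall>I J. \<omega> x I J \<noteq> 0 \<longrightarrow> card I = p \<and> card J = q)"

definition form0 :: "('n cspace \<Rightarrow> complex) \<Rightarrow> 'n::{finite,linorder} dform" where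
  "form0 f = (\<lambda>x I J. if I = {} \<and> J = {} then f x else 0)"

definition dz :: "'n \<Rightarrow> 'n::{finite,linorder} dform" where
  "dz j = (\<lambda>x I J. if I = {j} \<and> J = {} then 1 else 0)"

definition dzbar :: "'n \<Rightarrow> 'n::{finite,linorder} dform" where
  "dzbar j = (\<lambda>x I J. if I = {} \<and> J = {j} then 1 else 0)"

text \<open>For disjoint \<open>A\<close>, \<open>B\<close> one has \<open>dz\<^sub>A \<and> dz\<^sub>B = shuffle_sign A B dz\<^bsub>A \<union> B\<^esub>\<close>.\<close>

definition shuffle_sign :: "'n::{finite,linorder} set \<Rightarrow> 'n set \<Rightarrow> complex" where
  "shuffle_sign A B = (-1) ^ card {(a, b). a \<in> A \<and> b \<in> B \<and> b < a}"

text \<open>The factor \<open>(-1) ^ (card B * card (I - A))\<close> comes from moving \<open>dzbar\<^sub>B\<close> past \<open>dz\<^bsub>I - A\<^esub>\<close>.\<close>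

definition wedge :: "'n::{finite,linorder} dform \<Rightarrow> 'n dform \<Rightarrow> 'n dform" where
  "wedge \<omega> \<eta> = (\<lambda>x I J. \<Sum>A\<in>Pow I. \<Sum>B\<in>Pow J.
     (-1) ^ (card B * card (I - A)) * shuffle_sign A (I - A) * shuffle_sign B (J - B)
       * \<omega> x A B * \<eta> x (I - A) (J - B))"

definition wedge_list :: "'n::{finite,linorder} dform list \<Rightarrow> 'n dform" where
  "wedge_list \<omega>s = foldr wedge \<omega>s (form0 (\<lambda>_. 1))"

definition wedge_power :: "'n::{finite,linorder} dform \<Rightarrow> nat \<Rightarrow> 'n dform" where
  "wedge_power \<omega> k = wedge_list (replicate k \<omega>)"

text \<open>The sign comes from \<open>dzbar\<^sub>J \<and> dz\<^sub>I = (-1) ^ (card I * card J) dz\<^sub>I \<and> dzbar\<^sub>J\<close>.\<close>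

definition cnj_form :: "'n::{finite,linorder} dform \<Rightarrow> 'n dform" where
  "cnj_form \<omega> = (\<lambda>x I J. (-1) ^ (card I * card J) * cnj (\<omega> x J I))"


definition dir_deriv :: "'a::euclidean_space \<Rightarrow> ('a \<Rightarrow> 'b::real_normed_vector) \<Rightarrow> 'a \<Rightarrow> 'b" where
  "dir_deriv v f = (\<lambda>x. frechet_derivative f (at x) v)"

text \<open>\<open>C\<^sup>\<infinity>\<close> on an open set: all iterated partial derivatives exist and are (real) differentiable.\<close>

definition smooth_on :: "'a::euclidean_space set \<Rightarrow> ('a \<Rightarrow> 'b::real_normed_vector) \<Rightarrow> bool" where
  "smooth_on \<Omega> f \<longleftrightarrow>
     (\<forall>vs x. set vs \<subseteq> Basis \<and> x \<in> \<Omega> \<longrightarrow> foldr dir_deriv vs f differentiable (at x))"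

definition smooth_form_on :: "'n cspace set \<Rightarrow> 'n::{finite,linorder} dform \<Rightarrow> bool" where
  "smooth_form_on \<Omega> \<omega> \<longleftrightarrow> (\<forall>I J. smooth_on \<Omega> (\<lambda>x. \<omega> x I J))"

definition wirtinger :: "'n::{finite,linorder} \<Rightarrow> ('n cspace \<Rightarrow> complex) \<Rightarrow> 'n cspace \<Rightarrow> complex" where
  "wirtinger j f x = (dir_deriv (axis j 1) f x - \<i> * dir_deriv (axis j \<i>) f x) / 2"

definition wirtinger_bar :: "'n::{finite,linorder} \<Rightarrow> ('n cspace \<Rightarrow> complex) \<Rightarrow> 'n cspace \<Rightarrow> complex" where
  "wirtinger_bar j f x = (dir_deriv (axis j 1) f x + \<i> * dir_deriv (axis j \<i>) f x) / 2"

definition del :: "'n::{finite,linorder} dform \<Rightarrow> 'n dform" where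
  "del \<omega> = (\<lambda>x I J. \<Sum>j\<in>UNIV. wedge (dz j) (\<lambda>y K L. wirtinger j (\<lambda>u. \<omega> u K L) y) x I J)"

definition delbar :: "'n::{finite,linorder} dform \<Rightarrow> 'n dform" where
  "delbar \<omega> = (\<lambda>x I J. \<Sum>j\<in>UNIV. wedge (dzbar j) (\<lambda>y K L. wirtinger_bar j (\<lambda>u. \<omega> u K L) y) x I J)"

definition ext_d :: "'n::{finite,linorder} dform \<Rightarrow> 'n dform" where
  "ext_d \<omega> = (\<lambda>x I J. del \<omega> x I J + delbar \<omega> x I J)"

definition ext_dc :: "'n::{finite,linorder} dform \<Rightarrow> 'n dform" where
  "ext_dc \<omega> = (\<lambda>x I J. \<i> / (4 * of_real pi) * (delbar \<omega> x I J - del \<omega> x I J))"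

definition ddc :: "'n::{finite,linorder} dform \<Rightarrow> 'n dform" where
  "ddc \<omega> = ext_d (ext_dc \<omega>)"

definition kaehler :: "'n::{finite,linorder} dform" where
  "kaehler = ddc (form0 (\<lambda>z. of_real ((norm z)\<^sup>2)))"


text \<open>An \<open>(n,n)\<close>-form is nonnegative at a point if it is a nonnegative multiple of the volume form
  \<open>\<beta>\<^sup>n\<close>, where \<open>\<beta>\<close> is \<^const>\<open>kaehler\<close>.\<close>

definition top_form_nonneg :: "'n::{finite,linorder} dform \<Rightarrow> 'n cspace \<Rightarrow> bool" where
  "top_form_nonneg \<omega> x \<longleftrightarrow>
     (\<exists>c\<ge>0. \<forall>I J. \<omega> x I J = of_real c * wedge_power kaehler CARD('n) x I J)"

text \<open>As usual, positivity of a \<open>(1,1)\<close>-form is only considered for real forms.\<close>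

definition m_positive_form ::
    "'n cspace set \<Rightarrow> nat \<Rightarrow> 'n::{finite,linorder} dform \<Rightarrow> bool" where
  "m_positive_form \<Omega> m \<alpha> \<longleftrightarrow>
     smooth_form_on \<Omega> \<alpha> \<and> bideg_on \<Omega> 1 1 \<alpha> \<and> (\<forall>x\<in>\<Omega>. cnj_form \<alpha> x = \<alpha> x) \<and>
     (\<forall>j\<in>{1..m}. \<forall>x\<in>\<Omega>.
        top_form_nonneg (wedge (wedge_power \<alpha> j) (wedge_power kaehler (CARD('n) - j))) x)"

text \<open>The coefficients \<open>a k\<close> are functions, so that for \<open>q = 0\<close> one obtains the nonnegative
  functions.\<close>

definition strongly_m_positive ::
    "'n cspace set \<Rightarrow> nat \<Rightarrow> nat \<Rightarrow> 'n::{finite,linorder} dform \<Rightarrow> bool" where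
  "strongly_m_positive \<Omega> m q \<omega> \<longleftrightarrow>
     (\<exists>(a :: nat \<Rightarrow> 'n cspace \<Rightarrow> real) (\<alpha> :: nat \<Rightarrow> nat \<Rightarrow> 'n dform).
        (\<forall>k < CARD('n) choose q. smooth_on \<Omega> (a k) \<and> (\<forall>x\<in>\<Omega>. 0 \<le> a k x) \<and>
            (\<forall>j<q. m_positive_form \<Omega> m (\<alpha> j k))) \<and>
        (\<forall>x\<in>\<Omega>. \<forall>I J. \<omega> x I J =
            (\<Sum>k < CARD('n) choose q.
               of_real (a k x) * wedge_list (map (\<lambda>j. \<alpha> j k) [0..<q]) x I J)))"


definition test_form_in :: "'n cspace set \<Rightarrow> nat \<Rightarrow> 'n::{finite,linorder} dform \<Rightarrow> bool" where
  "test_form_in K q \<phi> \<longleftrightarrow> smooth_form_on UNIV \<phi> \<and> bideg_on UNIV q q \<phi> \<and>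
     (\<forall>x I J. x \<notin> K \<longrightarrow> \<phi> x I J = 0)"

definition test_form :: "'n cspace set \<Rightarrow> nat \<Rightarrow> 'n::{finite,linorder} dform \<Rightarrow> bool" where
  "test_form \<Omega> q \<phi> \<longleftrightarrow> (\<exists>K. compact K \<and> K \<subseteq> \<Omega> \<and> test_form_in K q \<phi>)"

definition form_C_norm :: "nat \<Rightarrow> 'n::{finite,linorder} dform \<Rightarrow> real" where
  "form_C_norm k \<phi> =
     (SUP (vs, I, J, x) \<in> {(vs, I, J, x). set vs \<subseteq> Basis \<and> length vs \<le> k}.
        cmod (foldr dir_deriv vs (\<lambda>u. \<phi> u I J) x))"

text \<open>A current of bidimension \<open>(q,q)\<close> on \<open>\<Omega>\<close> is a continuous linear functional on the test forms of
  bidegree \<open>(q,q)\<close>; its values on other arguments are irrelevant.\<close>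

type_synonym 'n current = "'n dform \<Rightarrow> complex"

definition is_current :: "'n cspace set \<Rightarrow> nat \<Rightarrow> 'n::{finite,linorder} current \<Rightarrow> bool" where
  "is_current \<Omega> q T \<longleftrightarrow>
     (\<forall>\<phi> \<psi>. test_form \<Omega> q \<phi> \<and> test_form \<Omega> q \<psi> \<longrightarrow> T (\<lambda>x I J. \<phi> x I J + \<psi> x I J) = T \<phi> + T \<psi>) \<and>
     (\<forall>c \<phi>. test_form \<Omega> q \<phi> \<longrightarrow> T (\<lambda>x I J. c * \<phi> x I J) = c * T \<phi>) \<and>
     (\<forall>K. compact K \<and> K \<subseteq> \<Omega> \<longrightarrow>
        (\<exists>C k. \<forall>\<phi>. test_form_in K q \<phi> \<longrightarrow> cmod (T \<phi>) \<le> C * form_C_norm k \<phi>))"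

definition current_wedge :: "'n::{finite,linorder} current \<Rightarrow> 'n dform \<Rightarrow> 'n current" where
  "current_wedge T \<eta> = (\<lambda>\<phi>. T (wedge \<eta> \<phi>))"

text \<open>For a current of even degree the signs in the definitions of \<open>d\<close> and \<open>d\<^sup>c\<close> on currents cancel, since
  \<open>d d\<^sup>c = - d\<^sup>c d\<close>.\<close>

definition current_ddc :: "'n::{finite,linorder} current \<Rightarrow> 'n current" where
  "current_ddc T = (\<lambda>\<phi>. T (ddc \<phi>))"

definition m_positive_current ::
    "'n cspace set \<Rightarrow> nat \<Rightarrow> nat \<Rightarrow> 'n::{finite,linorder} current \<Rightarrow> bool" where
  "m_positive_current \<Omega> m q S \<longleftrightarrow>
     (\<forall>\<alpha>. test_form \<Omega> (m + q - CARD('n)) \<alpha> \<and> strongly_m_positive \<Omega> m (m + q - CARD('n)) \<alpha> \<longrightarrow>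
        (\<exists>c\<ge>0. current_wedge S (wedge_power kaehler (CARD('n) - m)) \<alpha> = of_real c))"

definition m_negative_current ::
    "'n cspace set \<Rightarrow> nat \<Rightarrow> nat \<Rightarrow> 'n::{finite,linorder} current \<Rightarrow> bool" where
  "m_negative_current \<Omega> m q S \<longleftrightarrow> m_positive_current \<Omega> m q (\<lambda>\<phi>. - S \<phi>)"

definition m_subharmonic_current ::
    "'n cspace set \<Rightarrow> nat \<Rightarrow> nat \<Rightarrow> 'n::{finite,linorder} current \<Rightarrow> bool" where
  "m_subharmonic_current \<Omega> m p T \<longleftrightarrow> m_positive_current \<Omega> m (p - 1) (current_ddc T)"


text \<open>What a measure does outside \<open>\<Omega>\<close> plays no role below.\<close>

definition radon_on :: "'n cspace set \<Rightarrow> 'n::finite cspace measure \<Rightarrow> bool" where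
  "radon_on \<Omega> \<mu> \<longleftrightarrow> sets \<mu> = sets borel \<and> (\<forall>K. compact K \<and> K \<subseteq> \<Omega> \<longrightarrow> emeasure \<mu> K < \<infinity>)"

text \<open>The integral over a relatively compact Borel subset \<open>B\<close> of \<open>\<Omega>\<close> of a real current \<open>R\<close> of
  bidimension \<open>(0,0)\<close> and order \<open>0\<close>: such a current is a difference \<open>\<mu> - \<nu>\<close> of Radon measures, and
  \<open>\<mu> B - \<nu> B\<close> does not depend on the choice of \<open>\<mu>\<close>, \<open>\<nu>\<close>.  If \<open>R\<close> (or \<open>- R\<close>) is
  positive, one may take \<open>\<nu> = 0\<close> (or \<open>\<mu> = 0\<close>).\<close>

definition current_integral ::
    "'n cspace set \<Rightarrow> 'n::{finite,linorder} current \<Rightarrow> 'n cspace set \<Rightarrow> real" where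
  "current_integral \<Omega> R B =
     (THE c. \<exists>\<mu> \<nu>. radon_on \<Omega> \<mu> \<and> radon_on \<Omega> \<nu> \<and>
        (\<forall>\<phi>. test_form \<Omega> 0 \<phi> \<longrightarrow>
           R \<phi> = integral\<^sup>L \<mu> (\<lambda>x. \<phi> x {} {}) - integral\<^sup>L \<nu> (\<lambda>x. \<phi> x {} {})) \<and>
        c = measure \<mu> B - measure \<nu> B)"

definition lelong_ratio ::
    "'n cspace set \<Rightarrow> nat \<Rightarrow> nat \<Rightarrow> 'n::{finite,linorder} current \<Rightarrow> 'n cspace \<Rightarrow> real \<Rightarrow> real" where
  "lelong_ratio \<Omega> m q S a r =
     current_integral \<Omega> (current_wedge S (wedge_power kaehler q)) (ball a r)
       / r powr (2 * real CARD('n) / real m * (real m + real q - real CARD('n)))"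

end

theory Submission
  imports Defs
begin

text \<open>
  Let \<open>\<phi> = |z - z\<^sub>0|\<^sup>2\<close>, \<open>k = m + p - n\<close> and \<open>\<kappa> = nk/m > 1\<close>.  By Riesz representation \<open>- T \<and> \<beta>\<^sup>p\<close> and
  \<open>dd\<^sup>cT \<and> \<beta>\<^bsup>p-1\<^esup>\<close> are Radon measures \<open>\<mu>\<close> and \<open>\<nu>\<close>.  The form
  \<open>\<alpha> = (m/n) \<phi> \<beta> - d\<phi> \<and> d\<^sup>c\<phi>\<close> is \<open>m\<close>-positive, and since \<open>d\<phi> \<and> d\<^sup>c\<phi>\<close> has square zero,
  \<open>\<alpha>\<^sup>k\<close> is a positive multiple of \<open>\<phi>\<^bsup>k-1\<^esup> \<beta>\<^bsup>k-1\<^esup> \<and> ((\<phi>/\<kappa>) \<beta> - d\<phi> \<and> d\<^sup>c\<phi>)\<close>.  Testing \<open>T\<close> against multiples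
  of \<open>\<alpha>\<^sup>k\<close> and \<open>dd\<^sup>cT\<close> against \<open>g(\<phi>) \<beta>\<^bsup>p-1\<^esup>\<close> gives, for convex \<open>g\<close> vanishing far from \<open>0\<close>,
  \<open>\<integral> (\<kappa> g'(\<phi>) + \<phi> g''(\<phi>)) d\<mu> + \<kappa> \<integral> g(\<phi>) d\<nu> \<ge> 0\<close>.
  A suitable \<open>g\<close> turns the first integrand into
  \<open>s\<^bsup>-2\<kappa>\<^esup> 1\<^bsub>B(s)\<^esub> - r\<^bsup>-2\<kappa>\<^esup> 1\<^bsub>B(r)\<^esub>\<close>, and by Tonelli the second term is at most a constant times
  \<open>\<integral>\<^sub>0\<^sup>s t\<^bsup>1-2\<kappa>\<^esup> \<nu>(B(t)) dt\<close>, which tends to \<open>0\<close> with \<open>s\<close> by hypothesis.  So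
  \<open>r\<^bsup>-2\<kappa>\<^esup> \<mu>(B(r))\<close> is increasing up to an error that tends to \<open>0\<close>, and hence has a limit.
\<close>

section \<open>Smooth functions\<close>

text \<open>The constants come from the equation \<kappa> g' + t g'' = 0. Its solutions have g'
  proportional to t^(-\<kappa>), and for t = r^2 this is r to minus the exponent in the Lelong
  number of T; the factor n/m in that exponent thus corresponds to the coefficient m/n of the cone
  form. The obstacle is a sign: g is nonnegative, so for negative T the measure of dd^cT works
  against monotonicity, and only its smallness near the point helps. Integrating t^(-\<kappa>) once
  more bounds g by a multiple of t^(1-\<kappa>), which in terms of radii is an integral of
  \<tau>^(1-2\<kappa>); this is exactly the weight that remains in the hypothesis once the
  normalizations for bidimension p and p - 1 are compared. T is never regularized: all derivatives
  are put on test forms, where powers of \<beta> can be moved through dd^c because they have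
  constant coefficients. The price is that the step function has to be approached by smooth profiles
  with g'' = 0 near the origin; the sharp inequality is recovered when the width of the transition
  layers tends to 0.\<close>

lemma dir_deriv_eq: "(f has_derivative f') (at x) \<Longrightarrow> dir_deriv v f x = f' v"
  unfolding dir_deriv_def by (metis frechet_derivative_at)

lemma has_derivative_dir_deriv:
  "f differentiable at x \<Longrightarrow> (f has_derivative (\<lambda>v. dir_deriv v f x)) (at x)"
  unfolding dir_deriv_def by (simp add: frechet_derivative_works)

text \<open>True also at points where the functions are not differentiable:
  \<open>frechet_derivative\<close> is a choice from the predicate \<open>has_derivative\<close>,
  and near an interior point of equality that predicate is the same for both functions.\<close>

lemma dir_deriv_cong_open:
  assumes "open S" "x \<in> S" "\<And>y. y \<in> S \<Longrightarrow> f y = g y"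
  shows "dir_deriv v f x = dir_deriv v g x" "f differentiable at x \<longleftrightarrow> g differentiable at x"
proof -
  have "(f has_derivative f') (at x) \<longleftrightarrow> (g has_derivative f') (at x)" for f'
    using has_derivative_transform_within_open[OF _ assms(1,2), of f f' UNIV g]
      has_derivative_transform_within_open[OF _ assms(1,2), of g f' UNIV f] assms(3) by auto
  then show "dir_deriv v f x = dir_deriv v g x" "f differentiable at x \<longleftrightarrow> g differentiable at x"
    by (simp_all add: dir_deriv_def frechet_derivative_def differentiable_def)
qed

lemma smooth_on_differentiable: "smooth_on S f \<Longrightarrow> x \<in> S \<Longrightarrow> f differentiable at x"
  unfolding smooth_on_def by (metis empty_subsetI foldr_Nil id_apply list.set(1))

lemma smooth_on_continuous: "smooth_on S f \<Longrightarrow> continuous_on S f"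
  by (meson continuous_at_imp_continuous_on differentiable_imp_continuous_within
      smooth_on_differentiable)

lemma smooth_on_dir_deriv:
  fixes f :: "'a::euclidean_space \<Rightarrow> 'b::real_normed_vector"
  shows "smooth_on S f \<Longrightarrow> v \<in> Basis \<Longrightarrow> smooth_on S (dir_deriv v f)"
  unfolding smooth_on_def
proof (intro allI impI, elim conjE)
  fix vs :: "'a list" and x
  assume *: "\<forall>vs x. set vs \<subseteq> Basis \<and> x \<in> S \<longrightarrow> foldr dir_deriv vs f differentiable at x"
    "v \<in> Basis" "set vs \<subseteq> Basis" "x \<in> S"
  then have "foldr dir_deriv (vs @ [v]) f differentiable at x"
    by (intro *(1)[rule_format]) auto
  then show "foldr dir_deriv vs (dir_deriv v f) differentiable at x" by simp
qed

lemma smooth_on_subset: "smooth_on S f \<Longrightarrow> R \<subseteq> S \<Longrightarrow> smooth_on R f"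
  by (auto simp: smooth_on_def)

lemma smooth_on_Un: "smooth_on S f \<Longrightarrow> smooth_on R f \<Longrightarrow> smooth_on (S \<union> R) f"
  by (auto simp: smooth_on_def)

text \<open>\<open>smooth_on\<close> quantifies over all iterated derivatives, which rarely have a
  usable closed form. Instead \<open>f\<close> is placed in a family of differentiable functions
  closed under \<open>dir_deriv\<close>. As \<open>S\<close> is open and differentiation is local,
  closure up to equality on \<open>S\<close> is enough.\<close>

lemma smooth_on_coinduct:
  assumes "open S" "f \<in> F"
    and diff: "\<And>g x. g \<in> F \<Longrightarrow> x \<in> S \<Longrightarrow> g differentiable at x"
    and step: "\<And>g v. g \<in> F \<Longrightarrow> v \<in> Basis \<Longrightarrow> \<exists>h\<in>F. \<forall>x\<in>S. dir_deriv v g x = h x"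
  shows "smooth_on S f"
proof -
  have *: "\<exists>h\<in>F. \<forall>x\<in>S. foldr dir_deriv vs f x = h x" if "set vs \<subseteq> Basis" for vs
    using that
  proof (induction vs)
    case Nil
    then show ?case using assms(2) by auto
  next
    case (Cons v vs)
    then obtain h where h: "h \<in> F" "\<forall>x\<in>S. foldr dir_deriv vs f x = h x" by auto
    obtain h' where h': "h' \<in> F" "\<forall>x\<in>S. dir_deriv v h x = h' x"
      using step[OF h(1), of v] Cons.prems by auto
    have "dir_deriv v (foldr dir_deriv vs f) x = dir_deriv v h x" if "x \<in> S" for x
      by (rule dir_deriv_cong_open(1)[OF \<open>open S\<close> that]) (use h in auto)
    then show ?case using h' by auto
  qed
  show ?thesis
    unfolding smooth_on_def
  proof (intro allI impI, elim conjE)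
    fix vs x assume "set vs \<subseteq> (Basis :: 'a set)" "x \<in> S"
    with * obtain h where h: "h \<in> F" "\<forall>x\<in>S. foldr dir_deriv vs f x = h x" by meson
    show "foldr dir_deriv vs f differentiable at x"
      using dir_deriv_cong_open(2)[OF \<open>open S\<close> \<open>x \<in> S\<close>, of "foldr dir_deriv vs f" h] h
        diff[OF h(1) \<open>x \<in> S\<close>] by auto
  qed
qed

lemma smooth_on_cong:
  fixes f g :: "'a::euclidean_space \<Rightarrow> 'b::real_normed_vector"
  assumes "open S" "\<And>x. x \<in> S \<Longrightarrow> f x = g x" "smooth_on S g"
  shows "smooth_on S f"
proof -
  define F where "F = {h :: 'a \<Rightarrow> 'b. \<exists>u. smooth_on S u \<and> (\<forall>x\<in>S. h x = u x)}"
  have eq: "dir_deriv v h x = dir_deriv v u x" "h differentiable at x"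
    if "smooth_on S u" "\<forall>x\<in>S. h x = u x" "x \<in> S" for h u v x
    using dir_deriv_cong_open[OF \<open>open S\<close> \<open>x \<in> S\<close>, of h u] smooth_on_differentiable that by auto
  show ?thesis
  proof (rule smooth_on_coinduct[where F = F])
    show "f \<in> F" using assms by (auto simp: F_def)
    fix h assume "h \<in> F"
    then obtain u where u: "smooth_on S u" "\<forall>x\<in>S. h x = u x" by (auto simp: F_def)
    show "h differentiable at x" if "x \<in> S" for x using eq(2)[OF u that] .
    show "\<exists>k\<in>F. \<forall>x\<in>S. dir_deriv v h x = k x" if "v \<in> Basis" for v
      using eq(1)[OF u] smooth_on_dir_deriv[OF u(1) that] by (auto simp: F_def)
  qed fact
qed

section \<open>Closure of smoothness under algebraic operations and composition\<close>

lemma smooth_on_const [simp]: "open S \<Longrightarrow> smooth_on S (\<lambda>_. c)"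
proof (rule smooth_on_coinduct[where F = "range (\<lambda>c _. c)"])
  fix g :: "'a \<Rightarrow> 'b" and v :: 'a assume "g \<in> range (\<lambda>c _. c)"
  then obtain c where g: "g = (\<lambda>_. c)" by auto
  then have "dir_deriv v g x = 0" for x
    using dir_deriv_eq[OF has_derivative_const] by auto
  then show "\<exists>h\<in>range (\<lambda>c _. c). \<forall>x\<in>S. dir_deriv v g x = h x" by auto
qed auto

lemma smooth_on_bounded_linear:
  assumes "open S" "bounded_linear L"
  shows "smooth_on S L"
proof (rule smooth_on_coinduct[where F = "insert L {g. smooth_on S g}"])
  show "g differentiable at x" if "g \<in> insert L {g. smooth_on S g}" "x \<in> S" for g x
    using that smooth_on_differentiable assms(2)
    by (auto intro: bounded_linear_imp_differentiable)
  fix g v assume g: "g \<in> insert L {g. smooth_on S g}" and v: "v \<in> (Basis :: 'a set)"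
  have "dir_deriv v L x = L v" for x
    using dir_deriv_eq[OF bounded_linear_imp_has_derivative[OF assms(2)]] .
  then show "\<exists>h\<in>insert L {g. smooth_on S g}. \<forall>x\<in>S. dir_deriv v g x = h x"
    using g smooth_on_dir_deriv[of S g v] smooth_on_const[OF assms(1), of "L v"] v
    by (metis (no_types, lifting) insertCI insertE mem_Collect_eq)
qed (use assms in auto)

lemma dir_deriv_bounded_linear:
  assumes "bounded_linear L" "f differentiable at x"
  shows "dir_deriv v (\<lambda>x. L (f x)) x = L (dir_deriv v f x)"
  using dir_deriv_eq[OF bounded_linear.has_derivative[OF assms(1) has_derivative_dir_deriv[OF assms(2)]]]
  by auto

lemma dir_deriv_add:
  assumes "f differentiable at x" "g differentiable at x"
  shows "dir_deriv v (\<lambda>x. f x + g x) x = dir_deriv v f x + dir_deriv v g x"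
  by (rule dir_deriv_eq[OF has_derivative_add]) (intro has_derivative_dir_deriv assms)+

lemma dir_deriv_sum:
  assumes "\<And>i. i \<in> I \<Longrightarrow> f i differentiable at x"
  shows "dir_deriv v (\<lambda>x. \<Sum>i\<in>I. f i x) x = (\<Sum>i\<in>I. dir_deriv v (f i) x)"
  by (rule dir_deriv_eq[OF has_derivative_sum]) (intro has_derivative_dir_deriv assms)

lemma dir_deriv_mult:
  fixes f g :: "'a::euclidean_space \<Rightarrow> 'b::real_normed_field"
  assumes "f differentiable at x" "g differentiable at x"
  shows "dir_deriv v (\<lambda>x. f x * g x) x = f x * dir_deriv v g x + dir_deriv v f x * g x"
  by (rule dir_deriv_eq[OF has_derivative_mult]) (intro has_derivative_dir_deriv assms)+

lemma dir_deriv_cmult: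
  fixes f :: "'a::euclidean_space \<Rightarrow> 'b::real_normed_field"
  assumes "f differentiable at x"
  shows "dir_deriv v (\<lambda>x. c * f x) x = c * dir_deriv v f x"
  by (rule dir_deriv_bounded_linear[OF bounded_linear_mult_right assms])

lemma dir_deriv_const [simp]: "dir_deriv v (\<lambda>_. c) x = 0"
  by (rule dir_deriv_eq[OF has_derivative_const])

lemma smooth_on_compose_linear:
  assumes "open S" "bounded_linear L" "smooth_on S f"
  shows "smooth_on S (\<lambda>x. L (f x))"
proof (rule smooth_on_coinduct[where F = "{\<lambda>x. L (g x) | g. smooth_on S g}"])
  show "(\<lambda>x. L (f x)) \<in> {\<lambda>x. L (g x) | g. smooth_on S g}" using assms by auto
  show "g differentiable at x" if "g \<in> {\<lambda>x. L (g x) | g. smooth_on S g}" "x \<in> S" for g x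
    using that smooth_on_differentiable
    by (auto intro!: differentiable_compose[of L] bounded_linear_imp_differentiable[OF assms(2)])
  show "\<exists>h\<in>{\<lambda>x. L (g x) | g. smooth_on S g}. \<forall>x\<in>S. dir_deriv v g x = h x"
    if g: "g \<in> {\<lambda>x. L (g x) | g. smooth_on S g}" and "v \<in> Basis" for g v
  proof -
    from g obtain u where u: "g = (\<lambda>x. L (u x))" "smooth_on S u" by auto
    then show ?thesis
      using dir_deriv_bounded_linear[OF assms(2) smooth_on_differentiable[OF u(2)]]
        smooth_on_dir_deriv[OF u(2) that(2)] by auto
  qed
qed fact

lemma smooth_on_add:
  assumes "open S" "smooth_on S f" "smooth_on S g"
  shows "smooth_on S (\<lambda>x. f x + g x)"
proof (rule smooth_on_coinduct[where F = "{\<lambda>x. f x + g x | f g. smooth_on S f \<and> smooth_on S g}"])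
  show "\<exists>h\<in>{\<lambda>x. f x + g x | f g. smooth_on S f \<and> smooth_on S g}. \<forall>x\<in>S. dir_deriv v k x = h x"
    if k: "k \<in> {\<lambda>x. f x + g x | f g. smooth_on S f \<and> smooth_on S g}" and "v \<in> Basis" for k v
  proof -
    from k obtain f g where *: "k = (\<lambda>x. f x + g x)" "smooth_on S f" "smooth_on S g" by auto
    then have "\<forall>x\<in>S. dir_deriv v k x = dir_deriv v f x + dir_deriv v g x"
      by (auto intro!: dir_deriv_add smooth_on_differentiable)
    then show ?thesis using smooth_on_dir_deriv[OF *(2) that(2)] smooth_on_dir_deriv[OF *(3) that(2)]
      by auto
  qed
  show "(\<lambda>x. f x + g x) \<in> {\<lambda>x. f x + g x | f g. smooth_on S f \<and> smooth_on S g}"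
    using assms by blast
qed (use assms smooth_on_differentiable in \<open>auto intro!: differentiable_add\<close>)

lemma smooth_on_sum:
  assumes "open S" "\<And>i. i \<in> I \<Longrightarrow> smooth_on S (f i)"
  shows "smooth_on S (\<lambda>x. \<Sum>i\<in>I. f i x)"
  using assms(2)
  by (induction I rule: infinite_finite_induct) (auto intro!: smooth_on_add simp: assms(1))

text \<open>By Leibniz the derivative of a product is a sum of two products. Products alone are
  therefore not closed under differentiation, but with sums added they form a family to which
  \<open>smooth_on_coinduct\<close> applies.\<close>

inductive_set product_sums ::
    "'a::euclidean_space set \<Rightarrow> ('a \<Rightarrow> 'b::real_normed_field) set" for S where
  prod: "smooth_on S f \<Longrightarrow> smooth_on S g \<Longrightarrow> (\<lambda>x. f x * g x) \<in> product_sums S"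
| sum: "u \<in> product_sums S \<Longrightarrow> w \<in> product_sums S \<Longrightarrow> (\<lambda>x. u x + w x) \<in> product_sums S"

lemma smooth_on_mult:
  fixes f g :: "'a::euclidean_space \<Rightarrow> 'b::real_normed_field"
  assumes "open S" "smooth_on S f" "smooth_on S g"
  shows "smooth_on S (\<lambda>x. f x * g x)"
proof (rule smooth_on_coinduct[where F = "product_sums S"])
  show diff: "u differentiable at x" if "u \<in> product_sums S" "x \<in> S"
    for u :: "'a \<Rightarrow> 'b" and x
    using that
    by induction (simp_all add: differentiable_mult differentiable_add smooth_on_differentiable)
  show "\<exists>h\<in>product_sums S. \<forall>x\<in>S. dir_deriv v u x = h x"
    if u: "u \<in> product_sums S" and v: "v \<in> Basis" for u :: "'a \<Rightarrow> 'b" and v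
    using u
  proof induction
    case (prod f g)
    let ?h = "\<lambda>x. f x * dir_deriv v g x + dir_deriv v f x * g x"
    have "?h \<in> product_sums S"
      using prod v by (intro product_sums.intros) (auto intro: smooth_on_dir_deriv)
    moreover have "dir_deriv v (\<lambda>x. f x * g x) x = ?h x" if "x \<in> S" for x
      using prod that by (intro dir_deriv_mult) (auto intro: smooth_on_differentiable)
    ultimately show ?case by (auto intro: bexI[of _ ?h])
  next
    case (sum u w)
    then obtain h k where *: "h \<in> product_sums S" "\<forall>x\<in>S. dir_deriv v u x = h x"
      "k \<in> product_sums S" "\<forall>x\<in>S. dir_deriv v w x = k x" by blast
    have "\<forall>x\<in>S. dir_deriv v (\<lambda>x. u x + w x) x = h x + k x"
      using * diff[OF sum(1)] diff[OF sum(2)] by (simp add: dir_deriv_add)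
    then show ?case using product_sums.sum[OF *(1,3)] by (rule bexI)
  qed
  show "(\<lambda>x. f x * g x) \<in> product_sums S" using assms by (intro product_sums.prod)
qed fact

lemma smooth_on_diff:
  assumes "open S" "smooth_on S f" "smooth_on S g"
  shows "smooth_on S (\<lambda>x. f x - g x)"
  using smooth_on_add[OF assms(1,2) smooth_on_compose_linear[OF assms(1) _ assms(3), of uminus]]
  by (simp add: bounded_linear_minus[OF bounded_linear_ident])

text \<open>The family for the chain rule: differentiating a term either differentiates the smooth
  factor \<open>f\<close>, or raises the order \<open>n\<close> of the derivative of
  \<open>g\<close> and multiplies the smooth factor by a derivative of
  \<open>\<phi>\<close>.\<close>

inductive_set chain_sums :: "'a::euclidean_space set \<Rightarrow> ('a \<Rightarrow> real) \<Rightarrow> (real \<Rightarrow> real) \<Rightarrow> ('a \<Rightarrow> real) set"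
  for S \<phi> g where
  comp: "smooth_on S f \<Longrightarrow> (\<lambda>x. (dir_deriv 1 ^^ n) g (\<phi> x) * f x) \<in> chain_sums S \<phi> g"
| sum: "u \<in> chain_sums S \<phi> g \<Longrightarrow> w \<in> chain_sums S \<phi> g \<Longrightarrow> (\<lambda>x. u x + w x) \<in> chain_sums S \<phi> g"

lemma dir_deriv_compose:
  fixes g :: "real \<Rightarrow> real"
  assumes "\<phi> differentiable at x" "g differentiable at (\<phi> x)"
  shows "dir_deriv v (\<lambda>x. g (\<phi> x)) x = dir_deriv 1 g (\<phi> x) * dir_deriv v \<phi> x"
    "(\<lambda>x. g (\<phi> x)) differentiable at x"
proof -
  let ?D = "\<lambda>w. dir_deriv w g (\<phi> x)"
  have g: "(g has_derivative ?D) (at (\<phi> x))"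
    by (rule has_derivative_dir_deriv[OF assms(2)])
  have "?D t = ?D 1 * t" for t
    using linear_scale[OF has_derivative_linear[OF g], of t 1] by (simp add: mult.commute)
  then have "(\<lambda>w. ?D (dir_deriv w \<phi> x)) = (\<lambda>w. ?D 1 * dir_deriv w \<phi> x)"
    by (rule ext)
  moreover have "((\<lambda>x. g (\<phi> x)) has_derivative (\<lambda>w. ?D (dir_deriv w \<phi> x))) (at x)"
    using has_derivative_compose[OF has_derivative_dir_deriv[OF assms(1)] g] .
  ultimately have "((\<lambda>x. g (\<phi> x)) has_derivative (\<lambda>w. ?D 1 * dir_deriv w \<phi> x)) (at x)"
    by (simp only:)
  then show "dir_deriv v (\<lambda>x. g (\<phi> x)) x = ?D 1 * dir_deriv v \<phi> x"
    "(\<lambda>x. g (\<phi> x)) differentiable at x"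
    using dir_deriv_eq differentiableI by blast+
qed

lemma smooth_on_compose:
  fixes g :: "real \<Rightarrow> real"
  assumes "open S" "smooth_on R g" "smooth_on S \<phi>" "\<phi> ` S \<subseteq> R"
  shows "smooth_on S (\<lambda>x. g (\<phi> x))"
proof (rule smooth_on_coinduct[where F = "chain_sums S \<phi> g"])
  let ?D = "\<lambda>n. (dir_deriv 1 ^^ n) g"
  have "smooth_on R (?D n)" for n
    by (induction n) (auto intro: smooth_on_dir_deriv assms(2))
  then have D: "?D n differentiable at (\<phi> x)" if "x \<in> S" for n x
    using smooth_on_differentiable that assms(4) by blast
  note \<phi> = smooth_on_differentiable[OF assms(3)]
  note D' = dir_deriv_compose[OF \<phi> D]
  show "(\<lambda>x. g (\<phi> x)) \<in> chain_sums S \<phi> g"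
    using chain_sums.comp[OF smooth_on_const[OF assms(1), of 1], where n = 0 and \<phi> = \<phi> and g = g]
    by simp
  show diff: "u differentiable at x" if "u \<in> chain_sums S \<phi> g" "x \<in> S" for u x
    using that
    by induction (simp_all add: differentiable_mult differentiable_add D' smooth_on_differentiable)
  show "\<exists>h\<in>chain_sums S \<phi> g. \<forall>x\<in>S. dir_deriv v u x = h x"
    if u: "u \<in> chain_sums S \<phi> g" and v: "v \<in> Basis" for u v
    using u
  proof induction
    case (comp f n)
    let ?h = "\<lambda>x. ?D n (\<phi> x) * dir_deriv v f x + ?D (Suc n) (\<phi> x) * (dir_deriv v \<phi> x * f x)"
    have "?h \<in> chain_sums S \<phi> g"
      using comp v assms
      by (intro chain_sums.intros) (auto intro: smooth_on_dir_deriv smooth_on_mult)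
    moreover have "dir_deriv v (\<lambda>x. ?D n (\<phi> x) * f x) x = ?h x" if "x \<in> S" for x
      using comp that D'[OF that that] smooth_on_differentiable[OF comp that]
      by (simp add: dir_deriv_mult)
    ultimately show ?case by (auto intro: bexI[of _ ?h])
  next
    case (sum u w)
    then obtain h k where *: "h \<in> chain_sums S \<phi> g" "\<forall>x\<in>S. dir_deriv v u x = h x"
      "k \<in> chain_sums S \<phi> g" "\<forall>x\<in>S. dir_deriv v w x = k x" by blast
    have "\<forall>x\<in>S. dir_deriv v (\<lambda>x. u x + w x) x = h x + k x"
      using * diff[OF sum(1)] diff[OF sum(2)] by (simp add: dir_deriv_add)
    then show ?case using chain_sums.sum[OF *(1,3)] by (rule bexI)
  qed
qed fact

lemma dir_deriv_real: "(g has_real_derivative D) (at t) \<Longrightarrow> dir_deriv 1 g t = D"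
  using dir_deriv_eq[of g "\<lambda>h. D * h" t 1] by (simp add: has_field_derivative_def)

lemma smooth_on_realI:
  fixes g g' :: "real \<Rightarrow> real"
  assumes "open S" "\<And>t. t \<in> S \<Longrightarrow> (g has_real_derivative g' t) (at t)" "smooth_on S g'"
  shows "smooth_on S g"
proof (rule smooth_on_coinduct[where F = "insert g {h. smooth_on S h}"])
  show "u differentiable at x" if "u \<in> insert g {h. smooth_on S h}" "x \<in> S" for u x
    using that smooth_on_differentiable assms(2) real_differentiable_def by blast
  show "\<exists>h\<in>insert g {h. smooth_on S h}. \<forall>x\<in>S. dir_deriv v u x = h x"
    if "u \<in> insert g {h. smooth_on S h}" "v \<in> Basis" for u v
    using that smooth_on_dir_deriv assms(2,3) dir_deriv_real
    by (metis (no_types, lifting) Basis_real_def empty_iff insert_iff mem_Collect_eq)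
qed (use assms in auto)

text \<open>Young's argument: both mixed difference quotients of \<open>f\<close> over a small parallelogram are
  values of the mixed second derivatives nearby.\<close>

lemma mixed_difference:
  fixes f :: "'a::euclidean_space \<Rightarrow> real"
  assumes "smooth_on UNIV f" "u \<in> Basis" "v \<in> Basis" "0 < t"
  shows "\<exists>a b. 0 \<le> a \<and> a \<le> t \<and> 0 \<le> b \<and> b \<le> t \<and>
    f (x + t *\<^sub>R u + t *\<^sub>R v) - f (x + t *\<^sub>R u) - f (x + t *\<^sub>R v) + f x
      = t\<^sup>2 * dir_deriv v (dir_deriv u f) (x + a *\<^sub>R u + b *\<^sub>R v)"
proof -
  have line: "((\<lambda>s. h (y + s *\<^sub>R w)) has_real_derivative dir_deriv w h (y + s *\<^sub>R w)) (at s)"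
    if "smooth_on UNIV h" for h :: "'a \<Rightarrow> real" and y w s
  proof -
    have h: "(h has_derivative (\<lambda>w. dir_deriv w h (y + s *\<^sub>R w'))) (at (y + s *\<^sub>R w'))" for w'
      by (rule has_derivative_dir_deriv[OF smooth_on_differentiable[OF that UNIV_I]])
    have "((\<lambda>s. h (y + s *\<^sub>R w)) has_derivative (\<lambda>r. dir_deriv (r *\<^sub>R w) h (y + s *\<^sub>R w))) (at s)"
      by (rule has_derivative_compose[of "\<lambda>s. y + s *\<^sub>R w" "\<lambda>r. r *\<^sub>R w" s UNIV h, OF _ h])
        (auto intro!: derivative_eq_intros)
    moreover have "dir_deriv (r *\<^sub>R w) h (y + s *\<^sub>R w) = dir_deriv w h (y + s *\<^sub>R w) * r" for r
      using linear_scale[OF has_derivative_linear[OF h[of w]], of r w] by simp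
    ultimately show ?thesis by (simp add: has_field_derivative_def)
  qed
  define k where "k = (\<lambda>s. f (x + t *\<^sub>R v + s *\<^sub>R u) - f (x + s *\<^sub>R u))"
  have k: "(k has_real_derivative
      dir_deriv u f (x + t *\<^sub>R v + s *\<^sub>R u) - dir_deriv u f (x + s *\<^sub>R u)) (at s)" for s
    unfolding k_def by (intro derivative_intros line assms)
  obtain a where a: "0 < a" "a < t"
    "k t - k 0 = (t - 0) * (dir_deriv u f (x + t *\<^sub>R v + a *\<^sub>R u) - dir_deriv u f (x + a *\<^sub>R u))"
    using MVT2[OF assms(4), of k, OF k] by blast
  obtain b where b: "0 < b" "b < t" "dir_deriv u f (x + a *\<^sub>R u + t *\<^sub>R v)
      - dir_deriv u f (x + a *\<^sub>R u + 0 *\<^sub>R v)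
      = (t - 0) * dir_deriv v (dir_deriv u f) (x + a *\<^sub>R u + b *\<^sub>R v)"
    using MVT2[OF assms(4), of "\<lambda>s. dir_deriv u f (x + a *\<^sub>R u + s *\<^sub>R v)",
        OF line[OF smooth_on_dir_deriv[OF assms(1,2)]]] by blast
  show ?thesis
    using a b by (intro exI[of _ a] exI[of _ b]) (auto simp: k_def power2_eq_square algebra_simps)
qed

lemma dir_deriv_commute_real:
  fixes f :: "'a::euclidean_space \<Rightarrow> real"
  assumes "smooth_on UNIV f" "u \<in> Basis" "v \<in> Basis"
  shows "dir_deriv u (dir_deriv v f) x = dir_deriv v (dir_deriv u f) x"
proof (rule ccontr)
  let ?A = "dir_deriv v (dir_deriv u f)" and ?B = "dir_deriv u (dir_deriv v f)"
  assume "?B x \<noteq> ?A x"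
  then have e: "0 < \<bar>?A x - ?B x\<bar> / 2" (is "0 < ?e") by simp
  have cont: "isCont ?A x" "isCont ?B x"
    using smooth_on_differentiable differentiable_imp_continuous_within smooth_on_dir_deriv assms by blast+
  obtain d1 where "0 < d1" "\<And>y. dist y x < d1 \<Longrightarrow> dist (?A y) (?A x) < ?e"
    using cont(1)[unfolded continuous_at_eps_delta, rule_format, OF e] by blast
  moreover obtain d2 where "0 < d2" "\<And>y. dist y x < d2 \<Longrightarrow> dist (?B y) (?B x) < ?e"
    using cont(2)[unfolded continuous_at_eps_delta, rule_format, OF e] by blast
  ultimately   obtain d where d: "0 < d" "\<And>y. dist y x < d \<Longrightarrow> dist (?A y) (?A x) < ?e"
      "\<And>y. dist y x < d \<Longrightarrow> dist (?B y) (?B x) < ?e"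
    using that[of "min d1 d2"] by simp
  \<comment> \<open>Both intermediate points are then at distance at most \<open>2 * t < d\<close>
    from \<open>x\<close>.\<close>
  define t where "t = d / 3"
  have t: "0 < t" using d by (simp add: t_def)
  obtain a b where ab: "0 \<le> a" "a \<le> t" "0 \<le> b" "b \<le> t"
    "f (x + t *\<^sub>R u + t *\<^sub>R v) - f (x + t *\<^sub>R u) - f (x + t *\<^sub>R v) + f x
      = t\<^sup>2 * ?A (x + a *\<^sub>R u + b *\<^sub>R v)"
    using mixed_difference[OF assms t] by blast
  obtain a' b' where ab': "0 \<le> a'" "a' \<le> t" "0 \<le> b'" "b' \<le> t"
    "f (x + t *\<^sub>R v + t *\<^sub>R u) - f (x + t *\<^sub>R v) - f (x + t *\<^sub>R u) + f x
      = t\<^sup>2 * ?B (x + a' *\<^sub>R v + b' *\<^sub>R u)"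
    using mixed_difference[OF assms(1,3,2) t] by blast
  have near: "dist (x + a *\<^sub>R w + b *\<^sub>R w') x < d"
    if "0 \<le> a" "a \<le> t" "0 \<le> b" "b \<le> t" "w \<in> Basis" "w' \<in> Basis" for a b w w'
  proof -
    have "norm (a *\<^sub>R w + b *\<^sub>R w') \<le> a + b"
      using norm_triangle_ineq[of "a *\<^sub>R w" "b *\<^sub>R w'"] that by simp
    then show ?thesis using that d(1) by (simp add: dist_norm t_def add.assoc)
  qed
  have "t\<^sup>2 * ?A (x + a *\<^sub>R u + b *\<^sub>R v) = t\<^sup>2 * ?B (x + a' *\<^sub>R v + b' *\<^sub>R u)"
    using ab(5) ab'(5) by (simp add: algebra_simps)
  then have "?A (x + a *\<^sub>R u + b *\<^sub>R v) = ?B (x + a' *\<^sub>R v + b' *\<^sub>R u)" using t by simp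
  moreover have "dist (?A (x + a *\<^sub>R u + b *\<^sub>R v)) (?A x) < ?e"
    "dist (?B (x + a' *\<^sub>R v + b' *\<^sub>R u)) (?B x) < ?e"
    using near ab ab' assms by (blast intro: d)+
  ultimately show False by (simp add: dist_real_def) (smt (verit) field_sum_of_halves)
qed

lemma dir_deriv_commute:
  fixes f :: "'a::euclidean_space \<Rightarrow> complex"
  assumes "smooth_on UNIV f" "u \<in> Basis" "v \<in> Basis"
  shows "dir_deriv u (dir_deriv v f) x = dir_deriv v (dir_deriv u f) x"
proof -
  have L: "dir_deriv u (dir_deriv v (\<lambda>x. L (f x))) x = L (dir_deriv u (dir_deriv v f) x)"
    if "bounded_linear L" "u \<in> Basis" "v \<in> Basis" for u v and L :: "complex \<Rightarrow> real"
  proof -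
    have "dir_deriv v (\<lambda>x. L (f x)) = (\<lambda>x. L (dir_deriv v f x))"
      using dir_deriv_bounded_linear[OF that(1) smooth_on_differentiable[OF assms(1) UNIV_I]] by auto
    then show ?thesis
      using dir_deriv_bounded_linear[OF that(1)
          smooth_on_differentiable[OF smooth_on_dir_deriv[OF assms(1) that(3)] UNIV_I]] by simp
  qed
  have "L (dir_deriv u (dir_deriv v f) x) = L (dir_deriv v (dir_deriv u f) x)"
    if "bounded_linear L" for L :: "complex \<Rightarrow> real"
    using dir_deriv_commute_real[OF smooth_on_compose_linear[OF open_UNIV that assms(1)] assms(2,3)]
      L[OF that assms(2,3)] L[OF that assms(3,2)] by simp
  from this[OF bounded_linear_Re] this[OF bounded_linear_Im] show ?thesis
    by (rule complex_eqI)
qed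

section \<open>Cutoff functions\<close>

lemma smooth_on_powr: "smooth_on {0<..} (\<lambda>s::real. s powr a)"
proof -
  let ?F = "{\<lambda>s::real. c * s powr a | c a. True}"
  have D: "((\<lambda>s. c * s powr a) has_real_derivative c * a * s powr (a - 1)) (at s)"
    if "0 < s" for c a s :: real
    using that by (auto intro!: derivative_eq_intros)
  show ?thesis
  proof (rule smooth_on_coinduct[where F = ?F])
    show "(\<lambda>s. s powr a) \<in> ?F" by (intro CollectI exI[of _ 1] exI[of _ a]) simp
    show "g differentiable at x" if "g \<in> ?F" "x \<in> {0<..}" for g x
      using that D real_differentiable_def by fastforce
    show "\<exists>h\<in>?F. \<forall>x\<in>{0<..}. dir_deriv v g x = h x" if "g \<in> ?F" and v: "v \<in> Basis" for g v
    proof -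
      from that obtain c a where g: "g = (\<lambda>s. c * s powr a)" by auto
      have "v = 1" using v by simp
      show ?thesis
        by (rule bexI[of _ "\<lambda>s. (c * a) * s powr (a - 1)"])
          (use dir_deriv_real[OF D] in \<open>auto simp: g \<open>v = 1\<close>\<close>)
    qed
  qed simp
qed

lemma poly_times_exp_minus_tendsto: "((\<lambda>y::real. y ^ k * poly p y / exp y) \<longlongrightarrow> 0) at_top"
proof (induction p arbitrary: k)
  case 0
  then show ?case by simp
next
  case (pCons a p)
  have "((\<lambda>y. a * (y ^ k / exp y) + y ^ Suc k * poly p y / exp y) \<longlongrightarrow> a * 0 + 0) at_top"
    by (intro tendsto_intros tendsto_power_div_exp_0 pCons)
  then show ?case by (simp add: algebra_simps add_divide_distrib)
qed

text \<open>The classical functions p(1/x) exp(-1/x), extended by 0. The polynomial is a parameter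
  in order to have a family closed under differentiation: with y = 1/x, differentiation replaces
  p(y) by y^2 (p - p')(y).\<close>

definition flat :: "real poly \<Rightarrow> real \<Rightarrow> real" where
  "flat p x = (if 0 < x then poly p (1 / x) * exp (- 1 / x) else 0)"

lemma flat_has_derivative:
  "(flat p has_real_derivative flat ([:0, 0, 1:] * (p - pderiv p)) x) (at x)"
proof -
  consider "x < 0" | "x = 0" | "0 < x" by linarith
  then show ?thesis
  proof cases
    case 1
    have "((\<lambda>_. 0) has_real_derivative 0) (at x)" by simp
    then have "(flat p has_real_derivative 0) (at x)"
      by (rule has_field_derivative_transform_within_open[where S = "{..<0}"])
        (use 1 in \<open>auto simp: flat_def\<close>)
    then show ?thesis using 1 by (simp add: flat_def)
  next
    case 3
    have "((\<lambda>x. poly p (1 / x) * exp (- 1 / x)) has_real_derivative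
        flat ([:0, 0, 1:] * (p - pderiv p)) x) (at x)"
      using 3 by (auto intro!: derivative_eq_intros DERIV_chain2[OF poly_DERIV]
          simp: flat_def field_simps power2_eq_square)
    then show ?thesis
      by (rule has_field_derivative_transform_within_open[where S = "{0<..}"])
        (use 3 in \<open>auto simp: flat_def\<close>)
  next
    case 2
    \<comment> \<open>With Y = 1/y the difference quotient at 0 from the right is Y p(Y) exp(-Y), so
      the exponential decay wins.\<close>
    have "((\<lambda>y. flat p y / y) \<longlongrightarrow> 0) (at_right 0)"
    proof -
      have "((\<lambda>x::real. (inverse x) ^ 1 * poly p (inverse x) / exp (inverse x)) \<longlongrightarrow> 0) (at_right 0)"
        by (rule filterlim_compose[OF poly_times_exp_minus_tendsto filterlim_inverse_at_top_right])
      moreover have "\<forall>\<^sub>F y in at_right 0.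
          (inverse y) ^ 1 * poly p (inverse y) / exp (inverse y) = flat p y / y"
        by (auto simp: eventually_at_right_field flat_def exp_minus field_simps
            intro!: exI[of _ 1])
      ultimately show ?thesis by (rule Lim_transform_eventually)
    qed
    moreover have "((\<lambda>y. flat p y / y) \<longlongrightarrow> 0) (at_left 0)"
      by (rule Lim_transform_eventually[OF tendsto_const])
        (auto simp: eventually_at_left_field flat_def intro!: exI[of _ "-1"])
    ultimately have "((\<lambda>y. flat p y / y) \<longlongrightarrow> 0) (at 0)"
      by (simp add: filterlim_at_split)
    then show ?thesis by (simp add: 2 has_field_derivative_iff flat_def)
  qed
qed

lemma smooth_on_flat: "smooth_on UNIV (flat p)"
proof (rule smooth_on_coinduct[where F = "range flat"])
  show "g differentiable at x" if "g \<in> range flat" for g x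
    using that flat_has_derivative real_differentiable_def by blast
  show "\<exists>h\<in>range flat. \<forall>x\<in>UNIV. dir_deriv v g x = h x"
    if "g \<in> range flat" "v \<in> Basis" for g and v :: real
  proof -
    from that obtain q where q: "g = flat q" and "v = 1" by auto
    show ?thesis using dir_deriv_real[OF flat_has_derivative] by (auto simp: q \<open>v = 1\<close>)
  qed
qed auto

lemma flat_1_pos: "0 < x \<Longrightarrow> 0 < flat 1 x" and flat_1_zero: "x \<le> 0 \<Longrightarrow> flat 1 x = 0"
  and flat_1_nonneg: "0 \<le> flat 1 x"
  by (auto simp: flat_def)

lemma smooth_antiderivative:
  fixes h :: "real \<Rightarrow> real"
  assumes "smooth_on UNIV h"
  obtains H where "smooth_on UNIV H" "\<And>t. (H has_real_derivative h t) (at t)"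
proof -
  have "isCont h t" for t
    using smooth_on_continuous[OF assms] continuous_on_eq_continuous_at by blast
  then obtain H where H: "\<And>t. (H has_real_derivative h t) (at t)"
    using einterval_antiderivative[of "-\<infinity>" "\<infinity>" h]
    by (auto simp: has_real_derivative_iff_has_vector_derivative)
  then have "smooth_on UNIV H" using smooth_on_realI assms by blast
  with H that show ?thesis by blast
qed

text \<open>A primitive of the bump \<open>flat 1 t * flat 1 (1 - t)\<close>, which is nonnegative
  and vanishes outside (0, 1), normalized by its total increment.\<close>

lemma smooth_step_exists:
  "\<exists>\<theta>::real \<Rightarrow> real. smooth_on UNIV \<theta> \<and> mono \<theta> \<and> (\<forall>t\<le>0. \<theta> t = 0) \<and> (\<forall>t\<ge>1. \<theta> t = 1)"
proof -
  define b where "b = (\<lambda>t::real. flat 1 t * flat 1 (1 - t))"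
  have "smooth_on UNIV b"
    unfolding b_def
    by (intro smooth_on_mult smooth_on_flat smooth_on_compose[OF _ smooth_on_flat]
        smooth_on_diff smooth_on_const smooth_on_bounded_linear bounded_linear_ident) auto
  then obtain B where B: "smooth_on UNIV B" "\<And>t. (B has_real_derivative b t) (at t)"
    using smooth_antiderivative by blast
  have mono: "B x \<le> B y" if "x \<le> y" for x y
    using DERIV_nonneg_imp_nondecreasing[OF that, of B] B(2) flat_1_nonneg
    by (metis b_def mult_nonneg_nonneg)
  obtain z where z: "0 < z" "z < 1" "B 1 - B 0 = (1 - 0) * b z"
    using MVT2[of 0 1 B b] B(2) by auto
  then have pos: "0 < B 1 - B 0" by (simp add: b_def flat_1_pos)
  have left: "B t = B 0" if "t \<le> 0" for t
  proof (cases "t = 0")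
    case False
    then have "t < 0" using that by simp
    then obtain z where "t < z" "z < 0" "B 0 - B t = (0 - t) * b z"
      using MVT2[of t 0 B b] B(2) that by auto
    then show ?thesis by (simp add: b_def flat_1_zero)
  qed simp
  have right: "B t = B 1" if "1 \<le> t" for t
  proof (cases "t = 1")
    case False
    then have "1 < t" using that by simp
    then obtain z where "1 < z" "z < t" "B t - B 1 = (t - 1) * b z"
      using MVT2[of 1 t B b] B(2) that by auto
    then show ?thesis by (simp add: b_def flat_1_zero)
  qed simp
  let ?\<theta> = "\<lambda>t. (1 / (B 1 - B 0)) * (B t - B 0)"
  have "smooth_on UNIV ?\<theta>"
    by (intro smooth_on_mult smooth_on_diff smooth_on_const B) auto
  moreover have "mono ?\<theta>" using mono pos by (auto simp: mono_def divide_right_mono)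
  moreover have "?\<theta> t = 0" if "t \<le> 0" for t
    unfolding left[OF that] by simp
  moreover have "?\<theta> t = 1" if "1 \<le> t" for t
    unfolding right[OF that] using pos by simp
  ultimately show ?thesis by (intro exI[of _ ?\<theta>]) blast
qed

definition smooth_step :: "real \<Rightarrow> real" where
  "smooth_step = (SOME \<theta>. smooth_on UNIV \<theta> \<and> mono \<theta> \<and> (\<forall>t\<le>0. \<theta> t = 0) \<and> (\<forall>t\<ge>1. \<theta> t = 1))"

lemma
  shows smooth_smooth_step: "smooth_on UNIV smooth_step"
    and mono_smooth_step: "mono smooth_step"
    and smooth_step_eq_0: "t \<le> 0 \<Longrightarrow> smooth_step t = 0"
    and smooth_step_eq_1: "1 \<le> t \<Longrightarrow> smooth_step t = 1"
  using someI_ex[OF smooth_step_exists] unfolding smooth_step_def[symmetric] by auto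

lemma smooth_step_nonneg: "0 \<le> smooth_step t" and smooth_step_le_1: "smooth_step t \<le> 1"
  using monoD[OF mono_smooth_step, of "min t 0" t] monoD[OF mono_smooth_step, of t "max t 1"]
  by (simp_all add: smooth_step_eq_0 smooth_step_eq_1)

section \<open>Test functions: majorants, splitting into nonnegative functions, exhaustion of
  balls\<close>

lemma smooth_on_norm_square: "open S \<Longrightarrow> smooth_on S (\<lambda>x::'a::euclidean_space. (norm (x - a))\<^sup>2)"
proof -
  assume S: "open S"
  have "smooth_on S (\<lambda>x. \<Sum>b\<in>Basis. (x \<bullet> b - a \<bullet> b) * (x \<bullet> b - a \<bullet> b))"
    by (intro smooth_on_sum smooth_on_mult smooth_on_diff smooth_on_bounded_linear
        bounded_linear_inner_left smooth_on_const S)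
  moreover have "(\<lambda>x. \<Sum>b\<in>Basis. (x \<bullet> b - a \<bullet> b) * (x \<bullet> b - a \<bullet> b))
      = (\<lambda>x. (norm (x - a))\<^sup>2)"
    unfolding power2_norm_eq_inner by (subst euclidean_inner) (simp add: inner_diff_left)
  ultimately show ?thesis by simp
qed

text \<open>These are the real and imaginary parts of the test forms of bidegree (0, 0). Riesz
  representation is carried out for them on an arbitrary Euclidean space, before any forms
  enter.\<close>

definition test_fun :: "'a::euclidean_space set \<Rightarrow> ('a \<Rightarrow> real) \<Rightarrow> bool" where
  "test_fun S f \<longleftrightarrow> smooth_on UNIV f \<and> (\<exists>K. compact K \<and> K \<subseteq> S \<and> (\<forall>x. x \<notin> K \<longrightarrow> f x = 0))"

lemma test_funD: "test_fun S f \<Longrightarrow> smooth_on UNIV f"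
  by (simp add: test_fun_def)

lemma test_fun_mult: "test_fun S f \<Longrightarrow> smooth_on UNIV g \<Longrightarrow> test_fun S (\<lambda>x. g x * f x)"
  by (auto simp: test_fun_def intro!: smooth_on_mult)

lemma test_fun_cmult: "test_fun S f \<Longrightarrow> test_fun S (\<lambda>x. c * f x)"
  by (rule test_fun_mult) auto

lemma test_fun_add:
  assumes "test_fun S f" "test_fun S g"
  shows "test_fun S (\<lambda>x. f x + g x)"
proof -
  obtain K L where "compact K" "K \<subseteq> S" "\<forall>x. x \<notin> K \<longrightarrow> f x = 0"
    "compact L" "L \<subseteq> S" "\<forall>x. x \<notin> L \<longrightarrow> g x = 0"
    using assms by (auto simp: test_fun_def)
  then have "compact (K \<union> L)" "K \<union> L \<subseteq> S" "\<forall>x. x \<notin> K \<union> L \<longrightarrow> f x + g x = 0" by auto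
  moreover have "smooth_on UNIV (\<lambda>x. f x + g x)"
    using assms by (simp add: smooth_on_add test_funD)
  ultimately show ?thesis unfolding test_fun_def by blast
qed

lemma test_fun_diff: "test_fun S f \<Longrightarrow> test_fun S g \<Longrightarrow> test_fun S (\<lambda>x. f x - g x)"
  using test_fun_add[OF _ test_fun_cmult[of S g "-1"]] by simp

lemma test_fun_zero [simp]: "test_fun S (\<lambda>_. 0)"
  by (auto simp: test_fun_def intro!: exI[of _ "{}"])

lemma test_fun_sum: "(\<And>i. i \<in> I \<Longrightarrow> test_fun S (f i)) \<Longrightarrow> test_fun S (\<lambda>x. \<Sum>i\<in>I. f i x)"
  by (induction I rule: infinite_finite_induct) (auto intro!: test_fun_add)

lemma test_fun_flat_ball: "cball a r \<subseteq> S \<Longrightarrow> test_fun S (\<lambda>x. flat 1 (r\<^sup>2 - (norm (x - a))\<^sup>2))"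
  if "0 < r"
proof -
  assume "cball a r \<subseteq> S"
  moreover have "flat 1 (r\<^sup>2 - (norm (x - a))\<^sup>2) = 0" if "x \<notin> cball a r" for x
  proof -
    have "r\<^sup>2 \<le> (norm (x - a))\<^sup>2"
      using that \<open>0 < r\<close> by (intro power_mono) (auto simp: dist_norm norm_minus_commute)
    then show ?thesis by (simp add: flat_1_zero)
  qed
  moreover have "smooth_on UNIV (\<lambda>x. flat 1 (r\<^sup>2 - (norm (x - a))\<^sup>2))"
    by (intro smooth_on_compose[OF _ smooth_on_flat] smooth_on_diff smooth_on_norm_square) auto
  ultimately show ?thesis unfolding test_fun_def by (meson compact_cball)
qed

text \<open>Finitely many bumps on balls inside \<open>S\<close> cover \<open>K\<close>; their sum
  is positive on \<open>K\<close>, has a positive minimum there by compactness, and is rescaled by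
  it. Later error estimates only need a majorant of the indicator of \<open>K\<close>.\<close>

lemma test_fun_ge_1:
  assumes "open S" "compact K" "K \<subseteq> S"
  obtains f where "test_fun S f" "\<And>x. 0 \<le> f x" "\<And>x. x \<in> K \<Longrightarrow> 1 \<le> f x"
proof (cases "K = {}")
  case True
  with that[of "\<lambda>_. 0"] show ?thesis by simp
next
  case False
  have "\<exists>r>0. cball a r \<subseteq> S" if "a \<in> K" for a
    using assms that open_contains_cball by blast
  then obtain r where r: "\<And>a. a \<in> K \<Longrightarrow> 0 < r a" "\<And>a. a \<in> K \<Longrightarrow> cball a (r a) \<subseteq> S" by metis
  have "K \<subseteq> (\<Union>a\<in>K. ball a (r a))" using r by force
  then obtain F where F: "F \<subseteq> K" "finite F" "K \<subseteq> (\<Union>a\<in>F. ball a (r a))"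
    using compactE_image[OF assms(2), of K "\<lambda>a. ball a (r a)"] by (metis open_ball)
  define g where "g = (\<lambda>x. \<Sum>a\<in>F. flat 1 ((r a)\<^sup>2 - (norm (x - a))\<^sup>2))"
  have g: "test_fun S g"
    unfolding g_def using r F(1) by (intro test_fun_sum test_fun_flat_ball) auto
  have pos: "0 < g x" if x: "x \<in> K" for x
  proof -
    obtain a where a: "a \<in> F" "x \<in> ball a (r a)" using F(3) x by auto
    then have "(norm (x - a))\<^sup>2 < (r a)\<^sup>2"
      by (intro power_strict_mono) (auto simp: dist_norm norm_minus_commute)
    then show ?thesis
      unfolding g_def using a F(2) by (intro sum_pos2[of F a]) (auto simp: flat_1_pos flat_1_nonneg)
  qed
  have "continuous_on K g"
    using smooth_on_continuous[OF test_funD[OF g]] continuous_on_subset by blast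
  then obtain y where y: "y \<in> K" "\<And>x. x \<in> K \<Longrightarrow> g y \<le> g x"
    using continuous_attains_inf[OF assms(2) False] by blast
  show ?thesis
  proof (rule that[of "\<lambda>x. (1 / g y) * g x"])
    show "test_fun S (\<lambda>x. (1 / g y) * g x)" by (rule test_fun_cmult[OF g])
    show "0 \<le> (1 / g y) * g x" for x
    proof -
      have "0 \<le> g x" unfolding g_def by (intro sum_nonneg flat_1_nonneg)
      then show ?thesis using pos[OF y(1)] by simp
    qed
    show "1 \<le> (1 / g y) * g x" if "x \<in> K" for x
      using pos[OF y(1)] y(2)[OF that] by simp
  qed
qed

text \<open>The positive part of a smooth function is in general not smooth. Adding a large multiple
  of a majorant from \<open>test_fun_ge_1\<close> makes \<open>f\<close> nonnegative, so
  \<open>f\<close> is still a difference of nonnegative test functions.\<close>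

lemma test_fun_add_nonneg:
  assumes "open S" "test_fun S f"
  obtains g where "test_fun S g" "\<And>x. 0 \<le> g x" "\<And>x. 0 \<le> f x + g x"
proof -
  obtain K where K: "compact K" "K \<subseteq> S" "\<And>x. x \<notin> K \<Longrightarrow> f x = 0"
    using assms by (auto simp: test_fun_def)
  obtain \<eta> where \<eta>: "test_fun S \<eta>" "\<And>x. 0 \<le> \<eta> x" "\<And>x. x \<in> K \<Longrightarrow> 1 \<le> \<eta> x"
    using test_fun_ge_1[OF assms(1) K(1,2)] by blast
  have "bounded (f ` K)"
    using smooth_on_continuous[OF test_funD[OF assms(2)]] K(1)
    by (meson compact_continuous_image compact_imp_bounded continuous_on_subset subset_UNIV)
  then obtain B where B: "0 < B" "\<And>x. x \<in> K \<Longrightarrow> \<bar>f x\<bar> \<le> B"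
    using bounded_pos by (metis image_eqI real_norm_def)
  show ?thesis
  proof (rule that)
    show "test_fun S (\<lambda>x. B * \<eta> x)" by (rule test_fun_cmult[OF \<eta>(1)])
    show "0 \<le> B * \<eta> x" for x using B \<eta> by simp
    show "0 \<le> f x + B * \<eta> x" for x
    proof (cases "x \<in> K")
      case True
      have "B * 1 \<le> B * \<eta> x" using \<eta>(3)[OF True] B(1) by (intro mult_left_mono) auto
      then show ?thesis using B(2)[OF True] by simp
    qed (use K \<eta> B in simp)
  qed
qed

lemma smooth_cutoff_exists:
  fixes a b d :: real
  assumes "0 < d"
  shows "\<exists>f. smooth_on UNIV f \<and> (\<forall>t. 0 \<le> f t \<and> f t \<le> 1) \<and> (\<forall>t. t \<le> a \<or> b \<le> t \<longrightarrow> f t = 0) \<and>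
    (\<forall>t. a + d \<le> t \<and> t \<le> b - d \<longrightarrow> f t = (1::real))"
proof (intro exI conjI allI impI)
  let ?f = "\<lambda>t. smooth_step ((t - a) * (1 / d)) * smooth_step ((b - t) * (1 / d))"
  show "smooth_on UNIV ?f"
    by (intro smooth_on_mult smooth_on_compose[OF _ smooth_smooth_step] smooth_on_diff
        smooth_on_const smooth_on_bounded_linear bounded_linear_ident) auto
  fix t
  show "0 \<le> ?f t" by (intro mult_nonneg_nonneg smooth_step_nonneg)
  show "?f t \<le> 1" by (intro mult_le_one smooth_step_nonneg smooth_step_le_1)
  show "?f t = 0" if "t \<le> a \<or> b \<le> t"
    using that assms by (auto simp: smooth_step_eq_0 divide_nonpos_pos)
  show "?f t = 1" if "a + d \<le> t \<and> t \<le> b - d"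
    using that assms by (simp add: smooth_step_eq_1)
qed

text \<open>The functions \<open>smooth_step (j * (r^2 - |x - a|^2))\<close> vanish outside the open
  ball and are eventually 1 at each of its points. Through dominated convergence, masses of open
  balls become limits of integrals of test functions.\<close>

lemma smooth_exhaustion_ball:
  fixes a :: "'a::euclidean_space"
  assumes "cball a r \<subseteq> S"
  obtains f :: "nat \<Rightarrow> 'a \<Rightarrow> real" where "\<And>j. test_fun S (f j)"
    "\<And>j x. 0 \<le> f j x" "\<And>j x. f j x \<le> 1" "\<And>j x. x \<notin> ball a r \<Longrightarrow> f j x = 0"
    "\<And>x. (\<lambda>j. f j x) \<longlonglongrightarrow> indicator (ball a r) x"
proof (cases "0 < r")
  case False
  then have "x \<notin> ball a r" for x
    using zero_le_dist[of a x] by (simp del: zero_le_dist)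
  then show ?thesis by (intro that[of "\<lambda>_ _. 0"]) (simp_all add: indicator_def del: mem_ball)
next
  case True
  define f where "f = (\<lambda>(j::nat) x. smooth_step (real j * (r\<^sup>2 - (norm (x - a))\<^sup>2)))"
  have smooth: "smooth_on UNIV (f j)" for j
    unfolding f_def
  proof (rule smooth_on_compose[OF open_UNIV smooth_smooth_step])
    show "smooth_on UNIV (\<lambda>x. real j * (r\<^sup>2 - (norm (x - a))\<^sup>2))"
      by (intro smooth_on_mult smooth_on_diff smooth_on_const smooth_on_norm_square open_UNIV)
  qed simp
  have out: "f j x = 0" if "x \<notin> ball a r" for j x
  proof -
    have "r\<^sup>2 \<le> (norm (x - a))\<^sup>2"
      using that True by (intro power_mono) (auto simp: dist_norm norm_minus_commute)
    then show ?thesis by (simp add: f_def smooth_step_eq_0 mult_nonneg_nonpos)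
  qed
  have lim: "(\<lambda>j. f j x) \<longlonglongrightarrow> indicator (ball a r) x" for x
  proof (cases "x \<in> ball a r")
    case x: True
    then have "(norm (x - a))\<^sup>2 < r\<^sup>2"
      by (intro power_strict_mono) (auto simp: dist_norm norm_minus_commute)
    then have pos: "0 < r\<^sup>2 - (norm (x - a))\<^sup>2" (is "0 < ?u") by simp
    obtain J :: nat where J: "1 / ?u < real J" using reals_Archimedean2 by blast
    have "f j x = 1" if "J \<le> j" for j
    proof -
      have "1 / ?u \<le> real j" using J that by linarith
      then show ?thesis using pos by (simp add: f_def smooth_step_eq_1 field_simps)
    qed
    then have "\<forall>\<^sub>F j in sequentially. f j x = 1" using eventually_sequentially by blast
    then show ?thesis using x by (simp add: tendsto_eventually)
  qed (simp add: out)
  show ?thesis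
  proof (rule that[of f])
    show "test_fun S (f j)" for j
      unfolding test_fun_def using smooth assms out
      by (meson ball_subset_cball compact_cball subsetD)
  qed (use out lim in \<open>auto simp: f_def smooth_step_nonneg smooth_step_le_1\<close>)
qed

section \<open>Riesz representation of positive functionals\<close>

text \<open>The upper functional of \<open>\<Lambda>\<close> is countably subadditive on all \<open>[0,\<infinity>]\<close>-valued functions, so its
  restriction to the functions \<open>u \<cdot> 1\<^sub>A\<close> is an outer measure for every weight \<open>u\<close>.  Open half-spaces are
  increasing limits of smooth functions, which makes them measurable for all these outer measures.\<close>

locale positive_functional =
  fixes S :: "'a::euclidean_space set" and \<Lambda> :: "('a \<Rightarrow> real) \<Rightarrow> real"
  assumes open_S: "open S"
    and add: "test_fun S f \<Longrightarrow> test_fun S g \<Longrightarrow> \<Lambda> (\<lambda>x. f x + g x) = \<Lambda> f + \<Lambda> g"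
    and scale: "test_fun S f \<Longrightarrow> \<Lambda> (\<lambda>x. c * f x) = c * \<Lambda> f"
    and nonneg: "test_fun S f \<Longrightarrow> (\<And>x. 0 \<le> f x) \<Longrightarrow> 0 \<le> \<Lambda> f"
begin

definition pos_test :: "('a \<Rightarrow> real) \<Rightarrow> bool" where
  "pos_test f \<longleftrightarrow> test_fun S f \<and> (\<forall>x. 0 \<le> f x)"

text \<open>Covering by series rather than by single test functions builds countable subadditivity
  into \<open>upper\<close>. That \<open>upper\<close> nevertheless agrees with
  \<open>\<Lambda>\<close> on nonnegative test functions then becomes the main point, settled by
  \<open>test_le_suminf\<close>.\<close>

definition covers :: "(nat \<Rightarrow> 'a \<Rightarrow> real) \<Rightarrow> ('a \<Rightarrow> ennreal) \<Rightarrow> bool" where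
  "covers F u \<longleftrightarrow> (\<forall>i. pos_test (F i)) \<and> (\<forall>x. u x \<le> (\<Sum>i. ennreal (F i x)))"

definition upper :: "('a \<Rightarrow> ennreal) \<Rightarrow> ennreal" where
  "upper u = (INF F\<in>{F. covers F u}. \<Sum>i. ennreal (\<Lambda> (F i)))"

lemma zero [simp]: "\<Lambda> (\<lambda>_. 0) = 0"
  using scale[of "\<lambda>_. 0" 0] by simp

lemma diff: "test_fun S f \<Longrightarrow> test_fun S g \<Longrightarrow> \<Lambda> (\<lambda>x. f x - g x) = \<Lambda> f - \<Lambda> g"
  using add[of f "\<lambda>x. (-1) * g x"] scale[of g "-1"] test_fun_cmult[of S g "-1"] by simp

lemma mono: "test_fun S f \<Longrightarrow> test_fun S g \<Longrightarrow> (\<And>x. f x \<le> g x) \<Longrightarrow> \<Lambda> f \<le> \<Lambda> g"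
  using nonneg[of "\<lambda>x. g x - f x"] diff[of g f] test_fun_diff[of S g f] by simp

lemma sum: "(\<And>i. i \<in> I \<Longrightarrow> test_fun S (f i)) \<Longrightarrow> \<Lambda> (\<lambda>x. \<Sum>i\<in>I. f i x) = (\<Sum>i\<in>I. \<Lambda> (f i))"
proof (induction I rule: infinite_finite_induct)
  case (insert i I)
  then have "\<Lambda> (\<lambda>x. f i x + (\<Sum>i\<in>I. f i x)) = \<Lambda> (f i) + \<Lambda> (\<lambda>x. \<Sum>i\<in>I. f i x)"
    by (intro add test_fun_sum) auto
  with insert show ?case by simp
qed auto

lemma upper_le: "covers F u \<Longrightarrow> upper u \<le> (\<Sum>i. ennreal (\<Lambda> (F i)))"
  unfolding upper_def by (rule INF_lower) simp

lemma upper_mono: "(\<And>x. u x \<le> v x) \<Longrightarrow> upper u \<le> upper v"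
  unfolding upper_def by (rule INF_superset_mono) (auto simp: covers_def intro: order_trans)

lemma upper_countably_subadditive: "upper (\<lambda>x. \<Sum>i. u i x) \<le> (\<Sum>i. upper (u i))"
proof (rule ennreal_le_epsilon)
  fix e :: real assume fin: "(\<Sum>i. upper (u i)) < top" and e: "0 < e"
  have "\<exists>F. covers F (u i) \<and> (\<Sum>j. ennreal (\<Lambda> (F j))) \<le> upper (u i) + ennreal (e * (1/2) ^ Suc i)" for i
  proof -
    have "upper (u i) \<noteq> top" using ennreal_suminf_lessD[OF fin, of i] by simp
    then have "upper (u i) < upper (u i) + ennreal (e * (1/2) ^ Suc i)"
      using e by (simp add: ennreal_eq_0_iff less_top)
    then show ?thesis unfolding upper_def by (subst (asm) INF_less_iff) (auto intro: less_imp_le)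
  qed
  then obtain F where F: "\<And>i. covers (F i) (u i)"
    "\<And>i. (\<Sum>j. ennreal (\<Lambda> (F i j))) \<le> upper (u i) + ennreal (e * (1/2) ^ Suc i)"
    by metis
  define G where "G = (\<lambda>n. F (fst (prod_decode n)) (snd (prod_decode n)))"
  have G: "(\<Sum>n. \<phi> (G n)) = (\<Sum>i. \<Sum>j. \<phi> (F i j))" for \<phi> :: "('a \<Rightarrow> real) \<Rightarrow> ennreal"
    unfolding G_def using suminf_ennreal_2dimen[of _ "\<lambda>(i, j). \<phi> (F i j)"]
    by (simp add: case_prod_unfold)
  have "covers G (\<lambda>x. \<Sum>i. u i x)"
    unfolding covers_def
  proof (intro conjI allI)
    show "pos_test (G n)" for n using F(1) by (simp add: G_def covers_def)
    show "(\<Sum>i. u i x) \<le> (\<Sum>n. ennreal (G n x))" for x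
      unfolding G[of "\<lambda>f. ennreal (f x)"]
      using F(1) by (intro suminf_le) (auto simp: covers_def)
  qed
  then have "upper (\<lambda>x. \<Sum>i. u i x) \<le> (\<Sum>i. \<Sum>j. ennreal (\<Lambda> (F i j)))"
    using upper_le G[of "\<lambda>f. ennreal (\<Lambda> f)"] by metis
  also have "\<dots> \<le> (\<Sum>i. upper (u i) + ennreal (e * (1/2) ^ Suc i))"
    by (intro suminf_le F(2)) auto
  also have "\<dots> = (\<Sum>i. upper (u i)) + (\<Sum>i. ennreal (e * (1/2) ^ Suc i))"
    by (subst suminf_add[symmetric]) auto
  also have "(\<Sum>i. ennreal (e * (1/2) ^ Suc i)) = ennreal e"
    using sums_mult[OF power_half_series, of e] e by (intro suminf_ennreal_eq) auto
  finally show "upper (\<lambda>x. \<Sum>i. u i x) \<le> (\<Sum>i. upper (u i)) + ennreal e" .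
qed

text \<open>A Dini argument. On the compact set carrying \<open>f\<close>, a finite partial sum
  already exceeds \<open>f - d\<close>, by continuity and compactness. Positivity of
  \<open>\<Lambda>\<close> compares \<open>f\<close> with that finite sum, and
  \<open>d * \<Lambda> \<eta>\<close> pays for the error \<open>d\<close>.\<close>

lemma test_le_suminf:
  assumes f: "pos_test f" and "covers F (\<lambda>x. ennreal (f x))"
  shows "ennreal (\<Lambda> f) \<le> (\<Sum>i. ennreal (\<Lambda> (F i)))"
proof -
  have F: "\<And>i. test_fun S (F i)" "\<And>i x. 0 \<le> F i x" "\<And>x. ennreal (f x) \<le> (\<Sum>i. ennreal (F i x))"
    using assms by (auto simp: covers_def pos_test_def)
  obtain K where K: "compact K" "K \<subseteq> S" "\<And>x. x \<notin> K \<Longrightarrow> f x = 0"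
    using f by (auto simp: pos_test_def test_fun_def)
  obtain \<eta> where \<eta>: "test_fun S \<eta>" "\<And>x. 0 \<le> \<eta> x" "\<And>x. x \<in> K \<Longrightarrow> 1 \<le> \<eta> x"
    using test_fun_ge_1[OF open_S K(1,2)] by blast
  have cont: "continuous_on UNIV f" "\<And>i. continuous_on UNIV (F i)"
    using f F(1) by (auto simp: pos_test_def intro!: smooth_on_continuous test_funD)
  have approx: "ennreal (\<Lambda> f) \<le> (\<Sum>i. ennreal (\<Lambda> (F i))) + ennreal (d * \<Lambda> \<eta>)" if d: "0 < d" for d
  proof -
    define U where "U = (\<lambda>N. {x. f x - d < (\<Sum>i<N. F i x)})"
    have "open (U N)" for N
      unfolding U_def by (intro open_Collect_less continuous_intros cont)
    moreover have "K \<subseteq> (\<Union>N. U N)"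
    proof
      fix x assume "x \<in> K"
      have "\<exists>N. f x - d < (\<Sum>i<N. F i x)"
      proof (rule ccontr)
        assume "\<not> ?thesis"
        then have le: "(\<Sum>i<N. F i x) \<le> f x - d" for N by (simp add: not_less)
        \<comment> \<open>The empty partial sum supplies the sign; without it
          \<open>ennreal (f x - d)\<close> could be the truncation of a negative number.\<close>
        from le[of 0] have "0 \<le> f x - d" by simp
        have "(\<Sum>i. ennreal (F i x)) \<le> ennreal (f x - d)"
          using le F(2) by (intro suminf_le_const) (auto intro!: ennreal_leI)
        then have "ennreal (f x) \<le> ennreal (f x - d)" using F(3) order_trans by blast
        with \<open>0 \<le> f x - d\<close> d show False by (simp add: ennreal_le_iff)
      qed
      then show "x \<in> (\<Union>N. U N)" by (auto simp: U_def)
    qed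
    ultimately obtain J where J: "finite J" "K \<subseteq> (\<Union>N\<in>J. U N)"
      using compactE_image[OF K(1), of UNIV U] by auto
    \<comment> \<open>The sets \<open>U N\<close> increase with \<open>N\<close> because the
      \<open>F i\<close> are nonnegative, so the largest index suffices; \<open>insert 0\<close>
      keeps \<open>Max\<close> meaningful for empty \<open>J\<close>.\<close>
    define M where "M = Max (insert 0 J)"
    have "f x \<le> (\<Sum>i<M. F i x) + d * \<eta> x" for x
    proof (cases "x \<in> K")
      case True
      then obtain N where N: "N \<in> J" "x \<in> U N" using J by auto
      then have "N \<le> M" using J(1) by (simp add: M_def)
      then have "(\<Sum>i<N. F i x) \<le> (\<Sum>i<M. F i x)" using F(2) by (intro sum_mono2) auto
      moreover have "d \<le> d * \<eta> x" using \<eta>(3)[OF True] d by simp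
      ultimately show ?thesis using N by (auto simp: U_def)
    next
      case False
      then show ?thesis using K(3) F(2) \<eta>(2) d by (simp add: sum_nonneg add_nonneg_nonneg)
    qed
    then have "\<Lambda> f \<le> \<Lambda> (\<lambda>x. (\<Sum>i<M. F i x) + d * \<eta> x)"
      using f F(1) \<eta>(1) by (intro mono test_fun_add test_fun_sum test_fun_cmult) (auto simp: pos_test_def)
    also have "\<dots> = (\<Sum>i<M. \<Lambda> (F i)) + d * \<Lambda> \<eta>"
      using F(1) \<eta>(1) by (simp add: add sum scale test_fun_sum test_fun_cmult)
    finally have "ennreal (\<Lambda> f) \<le> ennreal (\<Sum>i<M. \<Lambda> (F i)) + ennreal (d * \<Lambda> \<eta>)"
      using F nonneg[OF \<eta>(1,2)] d
      by (subst ennreal_plus[symmetric]) (auto intro!: ennreal_leI sum_nonneg nonneg)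
    also have "ennreal (\<Sum>i<M. \<Lambda> (F i)) = (\<Sum>i<M. ennreal (\<Lambda> (F i)))"
      using F by (simp add: nonneg)
    also have "\<dots> \<le> (\<Sum>i. ennreal (\<Lambda> (F i)))" by (intro sum_le_suminf) auto
    finally show ?thesis by (simp add: add_right_mono)
  qed
  show ?thesis
  proof (rule ennreal_le_epsilon)
    fix e :: real assume "0 < e"
    \<comment> \<open>The summand 1 avoids a division by zero when
      \<open>\<Lambda> \<eta> = 0\<close>.\<close>
    have "(e / (\<Lambda> \<eta> + 1)) * \<Lambda> \<eta> \<le> e" and pos: "0 < e / (\<Lambda> \<eta> + 1)"
      using nonneg[OF \<eta>(1,2)] \<open>0 < e\<close> by (auto simp: field_simps)
    then show "ennreal (\<Lambda> f) \<le> (\<Sum>i. ennreal (\<Lambda> (F i))) + ennreal e"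
      using approx[OF pos] by (meson add_left_mono ennreal_leI order_trans)
  qed
qed

lemma suminf_first: "(\<Sum>i. if i = (0::nat) then c else 0) = (c :: ennreal)"
  using suminf_finite[of "{0}" "\<lambda>i. if i = (0::nat) then c else 0"] by simp

lemma upper_pos_test: "pos_test f \<Longrightarrow> upper (\<lambda>x. ennreal (f x)) = ennreal (\<Lambda> f)"
proof (rule antisym)
  assume f: "pos_test f"
  have "covers (\<lambda>i. if i = 0 then f else (\<lambda>_. 0)) (\<lambda>x. ennreal (f x))"
    unfolding covers_def
    using f suminf_first[of "ennreal (f x)" for x] by (auto simp: pos_test_def if_distrib if_distribR cong: if_cong)
  from upper_le[OF this] show "upper (\<lambda>x. ennreal (f x)) \<le> ennreal (\<Lambda> f)"
    using suminf_first[of "ennreal (\<Lambda> f)"] by (simp add: if_distrib cong: if_cong)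
  show "ennreal (\<Lambda> f) \<le> upper (\<lambda>x. ennreal (f x))"
    unfolding upper_def using test_le_suminf[OF f] by (auto intro!: INF_greatest)
qed

lemma upper_zero [simp]: "upper (\<lambda>_. 0) = 0"
  using upper_pos_test[of "\<lambda>_. 0"] by (simp add: pos_test_def)

lemma upper_add_le: "upper (\<lambda>x. u x + v x) \<le> upper u + upper v"
proof -
  define w where "w = (\<lambda>i::nat. if i = 0 then u else if i = 1 then v else (\<lambda>_. 0))"
  have "(\<Sum>i. w i x) = u x + v x" for x
    using suminf_finite[of "{0, 1}" "\<lambda>i. w i x"] by (simp add: w_def)
  moreover have "(\<Sum>i. upper (w i)) = upper u + upper v"
    using suminf_finite[of "{0, 1}" "\<lambda>i. upper (w i)"] by (simp add: w_def)
  ultimately show ?thesis using upper_countably_subadditive[of w] by simp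
qed

lemma upper_cmult_le:
  assumes "0 < c" shows "upper (\<lambda>x. ennreal c * u x) \<le> ennreal c * upper u"
proof -
  have "upper (\<lambda>x. ennreal c * u x) \<le> ennreal c * (\<Sum>i. ennreal (\<Lambda> (F i)))" if F: "covers F u" for F
  proof -
    have t: "\<And>i. test_fun S (F i)" "\<And>i x. 0 \<le> F i x" "\<And>x. u x \<le> (\<Sum>i. ennreal (F i x))"
      using F by (auto simp: covers_def pos_test_def)
    have "covers (\<lambda>i x. c * F i x) (\<lambda>x. ennreal c * u x)"
      unfolding covers_def pos_test_def using t assms
      by (auto simp: test_fun_cmult ennreal_mult intro!: mult_left_mono)
    from upper_le[OF this] show ?thesis
      using t assms by (simp add: scale ennreal_mult nonneg)
  qed
  then have "ennreal (1 / c) * upper (\<lambda>x. ennreal c * u x)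
      \<le> ennreal (1 / c) * (ennreal c * (\<Sum>i. ennreal (\<Lambda> (F i))))" if "covers F u" for F
    using that by (intro mult_left_mono) auto
  then have "ennreal (1 / c) * upper (\<lambda>x. ennreal c * u x) \<le> upper u"
    unfolding upper_def[of u] using assms
    by (intro INF_greatest) (simp add: mult.assoc[symmetric] ennreal_mult[symmetric])
  then have "ennreal c * (ennreal (1 / c) * upper (\<lambda>x. ennreal c * u x)) \<le> ennreal c * upper u"
    by (rule mult_left_mono) simp
  then show ?thesis
    using assms by (simp add: mult.assoc[symmetric] ennreal_mult[symmetric])
qed

lemma upper_cmult:
  assumes "0 < c" shows "upper (\<lambda>x. ennreal c * u x) = ennreal c * upper u"
proof (rule antisym[OF upper_cmult_le[OF assms]])
  have "upper (\<lambda>x. ennreal (1 / c) * (ennreal c * u x)) \<le> ennreal (1 / c) * upper (\<lambda>x. ennreal c * u x)"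
    using assms by (intro upper_cmult_le) auto
  then have "upper u \<le> ennreal (1 / c) * upper (\<lambda>x. ennreal c * u x)"
    using assms by (simp add: mult.assoc[symmetric] ennreal_mult[symmetric])
  then have "ennreal c * upper u \<le> ennreal c * (ennreal (1 / c) * upper (\<lambda>x. ennreal c * u x))"
    by (rule mult_left_mono) simp
  then show "ennreal c * upper u \<le> upper (\<lambda>x. ennreal c * u x)"
    using assms by (simp add: mult.assoc[symmetric] ennreal_mult[symmetric])
qed

text \<open>The Caratheodory inequality for a set \<open>H\<close> whose indicator is an increasing
  limit of smooth functions. Given a cover \<open>F\<close> of \<open>u\<close>, the increments of
  \<open>\<theta> L * F i\<close> in \<open>L\<close> telescope to \<open>F i\<close> on
  \<open>H\<close> and so cover \<open>u\<close> restricted to \<open>H\<close>, while the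
  remainders \<open>(1 - \<theta> L) * F i\<close> cover \<open>u\<close> off \<open>H\<close> for
  every \<open>L\<close>. At a fixed \<open>L\<close> the two costs add up to the cost of
  \<open>F\<close>.\<close>

lemma upper_split:
  fixes \<theta> :: "nat \<Rightarrow> 'a \<Rightarrow> real"
  assumes smooth: "\<And>L. smooth_on UNIV (\<theta> L)" and "\<And>x. \<theta> 0 x = 0" and inc: "\<And>L x. \<theta> L x \<le> \<theta> (Suc L) x"
    and le: "\<And>L x. \<theta> L x \<le> indicator H x" and lim: "\<And>x. (\<lambda>L. \<theta> L x) \<longlonglongrightarrow> indicator H x"
  shows "upper (\<lambda>x. u x * indicator H x) + upper (\<lambda>x. u x * indicator (- H) x) \<le> upper u"
proof -
  have "upper (\<lambda>x. u x * indicator H x) + upper (\<lambda>x. u x * indicator (- H) x)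
      \<le> (\<Sum>i. ennreal (\<Lambda> (F i)))" if "covers F u" for F
  proof -
    have t: "\<And>i. test_fun S (F i)" "\<And>i x. 0 \<le> F i x" "\<And>x. u x \<le> (\<Sum>i. ennreal (F i x))"
      using that by (auto simp: covers_def pos_test_def)
    have \<theta>: "0 \<le> \<theta> L x" for L x
      by (induction L) (use assms(2) inc order_trans in \<open>auto, blast\<close>)
    have \<theta>F: "test_fun S (\<lambda>x. \<theta> L x * F i x)" for L i
      by (rule test_fun_mult[OF t(1) smooth])
    define a where "a = (\<lambda>i L. \<Lambda> (\<lambda>x. \<theta> L x * F i x))"
    have a0: "0 \<le> a i L" for i L
      unfolding a_def by (rule nonneg[OF \<theta>F]) (simp add: \<theta> t)
    have ainc: "a i L \<le> a i (Suc L)" for i L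
      unfolding a_def by (rule mono[OF \<theta>F \<theta>F]) (simp add: inc t mult_right_mono)
    define G where "G = (\<lambda>i L x. \<theta> (Suc L) x * F i x - \<theta> L x * F i x)"
    have G: "pos_test (G i L)" for i L
      unfolding pos_test_def G_def
      using test_fun_diff[OF \<theta>F \<theta>F] inc t by (auto simp: mult_right_mono)
    have \<Lambda>G: "\<Lambda> (G i L) = a i (Suc L) - a i L" for i L
      unfolding G_def a_def by (rule diff[OF \<theta>F \<theta>F])
    define G' where "G' = (\<lambda>n. G (fst (prod_decode n)) (snd (prod_decode n)))"
    have G': "(\<Sum>n. \<phi> (G' n)) = (\<Sum>i. \<Sum>L. \<phi> (G i L))" for \<phi> :: "('a \<Rightarrow> real) \<Rightarrow> ennreal"
      unfolding G'_def using suminf_ennreal_2dimen[of _ "\<lambda>(i, j). \<phi> (G i j)"]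
      by (simp add: case_prod_unfold)
    have sumG: "(\<Sum>L. ennreal (G i L x)) = ennreal (F i x) * indicator H x" for i x
    proof -
      have "(\<lambda>L. \<theta> L x * F i x) \<longlonglongrightarrow> indicator H x * F i x"
        by (intro tendsto_mult lim tendsto_const)
      from telescope_sums[OF this] have "(\<lambda>L. G i L x) sums (indicator H x * F i x)"
        by (simp add: G_def assms(2))
      moreover have "0 \<le> G i L x" for L using G by (simp add: pos_test_def)
      ultimately have "(\<Sum>L. ennreal (G i L x)) = ennreal (indicator H x * F i x)"
        by (intro suminf_ennreal_eq)
      then show ?thesis by (simp add: indicator_def)
    qed
    have "covers G' (\<lambda>x. u x * indicator H x)"
      unfolding covers_def
    proof (intro conjI allI)
      show "pos_test (G' n)" for n using G by (simp add: G'_def)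
      show "u x * indicator H x \<le> (\<Sum>n. ennreal (G' n x))" for x
        unfolding G'[of "\<lambda>f. ennreal (f x)"] sumG ennreal_suminf_multc
        by (intro mult_right_mono t) simp
    qed
    then have "upper (\<lambda>x. u x * indicator H x) \<le> (\<Sum>i. \<Sum>L. ennreal (\<Lambda> (G i L)))"
      using upper_le G'[of "\<lambda>f. ennreal (\<Lambda> f)"] by metis
    also have "\<dots> = (\<Sum>i. SUP L. ennreal (a i L))"
    proof (intro suminf_cong)
      fix i
      have "(\<Sum>l<L. ennreal (\<Lambda> (G i l))) = ennreal (a i L)" for L
      proof -
        have "(\<Sum>l<L. \<Lambda> (G i l)) = a i L - a i 0" unfolding \<Lambda>G by (rule sum_lessThan_telescope)
        also have "a i 0 = 0" by (simp add: a_def assms(2))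
        finally show ?thesis using G by (subst sum_ennreal) (auto simp: pos_test_def intro: nonneg)
      qed
      then show "(\<Sum>L. ennreal (\<Lambda> (G i L))) = (SUP L. ennreal (a i L))"
        by (simp add: suminf_eq_SUP)
    qed
    also have "\<dots> = (SUP L. \<Sum>i. ennreal (a i L))"
      using ainc by (intro ennreal_suminf_SUP_eq) (auto simp: incseq_Suc_iff intro: ennreal_leI)
    finally have "upper (\<lambda>x. u x * indicator H x) + upper (\<lambda>x. u x * indicator (- H) x)
        \<le> (SUP L. \<Sum>i. ennreal (a i L)) + upper (\<lambda>x. u x * indicator (- H) x)"
      by (rule add_right_mono)
    \<comment> \<open>With the second term inside the supremum, its cover may be chosen depending on
      the same \<open>L\<close>.\<close>
    also have "\<dots> = (SUP L. (\<Sum>i. ennreal (a i L)) + upper (\<lambda>x. u x * indicator (- H) x))"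
      by (rule ennreal_SUP_add_left[symmetric]) simp
    also have "\<dots> \<le> (\<Sum>i. ennreal (\<Lambda> (F i)))"
    proof (rule SUP_least)
      fix L
      let ?E = "\<lambda>i x. F i x - \<theta> L x * F i x"
      have \<theta>1: "\<theta> L x \<le> 1" "x \<notin> H \<Longrightarrow> \<theta> L x = 0" for x
        using le[of L x] \<theta>[of L x] by (auto intro: order_trans[OF _ indicator_le_1])
      have E: "pos_test (?E i)" for i
        unfolding pos_test_def using test_fun_diff[OF t(1) \<theta>F] \<theta>1(1) t(2)
        by (auto simp: mult_left_le_one_le \<theta>)
      have "covers ?E (\<lambda>x. u x * indicator (- H) x)"
        unfolding covers_def using E t(3) \<theta>1(2) by (auto simp: indicator_def)
      from upper_le[OF this] have "upper (\<lambda>x. u x * indicator (- H) x)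
          \<le> (\<Sum>i. ennreal (\<Lambda> (F i) - a i L))"
        by (simp add: diff[OF t(1) \<theta>F] a_def)
      then have "(\<Sum>i. ennreal (a i L)) + upper (\<lambda>x. u x * indicator (- H) x)
          \<le> (\<Sum>i. ennreal (a i L)) + (\<Sum>i. ennreal (\<Lambda> (F i) - a i L))"
        by (rule add_left_mono)
      also have "\<dots> = (\<Sum>i. ennreal (a i L) + ennreal (\<Lambda> (F i) - a i L))"
        by (intro suminf_add) auto
      also have "\<dots> = (\<Sum>i. ennreal (\<Lambda> (F i)))"
      proof (intro suminf_cong)
        fix i
        have "a i L \<le> \<Lambda> (F i)"
          unfolding a_def by (rule mono[OF \<theta>F t(1)]) (simp add: mult_left_le_one_le \<theta> \<theta>1 t)
        then show "ennreal (a i L) + ennreal (\<Lambda> (F i) - a i L) = ennreal (\<Lambda> (F i))"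
          using a0 by (subst ennreal_plus[symmetric]) auto
      qed
      finally show "(\<Sum>i. ennreal (a i L)) + upper (\<lambda>x. u x * indicator (- H) x)
          \<le> (\<Sum>i. ennreal (\<Lambda> (F i)))" .
    qed
    finally show ?thesis .
  qed
  then show ?thesis unfolding upper_def[of u] by (auto intro: INF_greatest)
qed

section \<open>Weighted outer measures and their restriction to Borel sets\<close>

definition weight :: "('a \<Rightarrow> ennreal) \<Rightarrow> 'a set \<Rightarrow> ennreal" where
  "weight u A = upper (\<lambda>x. u x * indicator A x)"

lemma outer_measure_weight: "outer_measure_space (Pow UNIV) (weight u)"
  unfolding outer_measure_space_def
proof (intro conjI)
  show "positive (Pow UNIV) (weight u)" by (simp add: positive_def weight_def)
  show "increasing (Pow UNIV) (weight u)"
    by (auto simp: increasing_def weight_def intro!: upper_mono mult_left_mono split: split_indicator)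
  show "countably_subadditive (Pow UNIV) (weight u)"
    unfolding countably_subadditive_def
  proof (intro allI impI)
    fix A :: "nat \<Rightarrow> 'a set" assume "disjoint_family A"
    then have "(\<lambda>x. u x * indicator (\<Union>i. A i) x) = (\<lambda>x. \<Sum>i. u x * indicator (A i) x)"
      by (simp add: suminf_indicator)
    then show "weight u (\<Union>i. A i) \<le> (\<Sum>i. weight u (A i))"
      unfolding weight_def using upper_countably_subadditive[of "\<lambda>i x. u x * indicator (A i) x"] by simp
  qed
qed

lemma measure_space_weight: "measure_space UNIV (sets (borel :: 'a measure)) (weight u)"
proof -
  interpret P: sigma_algebra "UNIV :: 'a set" "Pow UNIV" by (rule sigma_algebra_Pow)
  let ?L = "lambda_system UNIV (Pow UNIV) (weight u)"
  have L: "measure_space UNIV ?L (weight u)"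
    by (rule P.caratheodory_lemma[OF outer_measure_weight])
  have half: "{x. x \<bullet> b < c} \<in> ?L" for b :: 'a and c
  proof -
    define H where "H = {x. x \<bullet> b < c}"
    define \<theta> where "\<theta> = (\<lambda>(L::nat) x. smooth_step (real L * (c - x \<bullet> b)))"
    have out: "\<theta> L x = 0" if "x \<notin> H" for L x
      using that by (simp add: \<theta>_def H_def smooth_step_eq_0 mult_nonneg_nonpos)
    have "weight u (E \<inter> H) + weight u (E - H) = weight u E" for E
    proof (rule antisym)
      \<comment> \<open>The test set \<open>E\<close> of the Caratheodory condition is absorbed into
        the weight, so \<open>upper_split\<close> is applied to the function \<open>u\<close> cut
        off to \<open>E\<close>.\<close>
      have *: "u x * indicator (E \<inter> H) x = (u x * indicator E x) * indicator H x"
        "u x * indicator (E - H) x = (u x * indicator E x) * indicator (- H) x" for x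
        by (auto split: split_indicator)
      show "weight u (E \<inter> H) + weight u (E - H) \<le> weight u E"
        unfolding weight_def *
      proof (rule upper_split)
        show "smooth_on UNIV (\<theta> L)" for L
          unfolding \<theta>_def
        proof (rule smooth_on_compose[OF open_UNIV smooth_smooth_step])
          show "smooth_on UNIV (\<lambda>x. real L * (c - x \<bullet> b))"
            by (intro smooth_on_mult smooth_on_diff smooth_on_const smooth_on_bounded_linear
                bounded_linear_inner_left open_UNIV)
        qed simp
        show "\<theta> 0 x = 0" for x by (simp add: \<theta>_def smooth_step_eq_0)
        show "\<theta> L x \<le> \<theta> (Suc L) x" for L x
        proof (cases "x \<in> H")
          case True
          then show ?thesis
            unfolding \<theta>_def H_def by (intro monoD[OF mono_smooth_step] mult_right_mono) auto
        qed (simp add: out)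
        show "\<theta> L x \<le> indicator H x" for L x
          using out[of x L] by (cases "x \<in> H") (auto simp: \<theta>_def smooth_step_le_1)
        show "(\<lambda>L. \<theta> L x) \<longlonglongrightarrow> indicator H x" for x
        proof (cases "x \<in> H")
          case True
          then have pos: "0 < c - x \<bullet> b" by (simp add: H_def)
          obtain J :: nat where J: "1 / (c - x \<bullet> b) < real J" using reals_Archimedean2 by blast
          have "\<theta> L x = 1" if "J \<le> L" for L
          proof -
            have "1 / (c - x \<bullet> b) \<le> real L" using J that by linarith
            then show ?thesis using pos by (simp add: \<theta>_def smooth_step_eq_1 field_simps)
          qed
          then have "\<forall>\<^sub>F L in sequentially. \<theta> L x = 1" using eventually_sequentially by blast
          then show ?thesis using True by (simp add: tendsto_eventually)
        qed (simp add: out)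
      qed
      have "weight u E = upper (\<lambda>x. u x * indicator (E \<inter> H) x + u x * indicator (E - H) x)"
        unfolding weight_def by (rule arg_cong[of _ _ upper]) (auto split: split_indicator)
      also have "\<dots> \<le> weight u (E \<inter> H) + weight u (E - H)"
        unfolding weight_def by (rule upper_add_le)
      finally show "weight u E \<le> weight u (E \<inter> H) + weight u (E - H)" .
    qed
    then show ?thesis by (subst P.lambda_system_eq) (auto simp: H_def)
  qed
  have "sets borel = sigma_sets UNIV ((\<lambda>(a, i). {x::'a. x \<bullet> i < a}) ` (UNIV \<times> Basis))"
    by (simp add: borel_eq_halfspace_less sets_measure_of)
  also have "\<dots> \<subseteq> ?L"
    using half L by (intro sigma_algebra.sigma_sets_subset) (auto simp: measure_space_def)
  finally show ?thesis
    using measure_down[OF L sets.sigma_algebra_axioms[of borel, simplified]] by simp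
qed

definition weight_measure :: "('a \<Rightarrow> ennreal) \<Rightarrow> 'a measure" where
  "weight_measure u = measure_of UNIV (sets borel) (weight u)"

lemma sets_weight_measure [simp, measurable_cong]: "sets (weight_measure u) = sets borel"
  using sets.sigma_sets_eq[of borel] by (simp add: weight_measure_def sets_measure_of_conv)

lemma space_weight_measure [simp]: "space (weight_measure u) = UNIV"
  by (simp add: weight_measure_def space_measure_of_conv)

lemma emeasure_weight_measure: "A \<in> sets borel \<Longrightarrow> emeasure (weight_measure u) A = weight u A"
  unfolding weight_measure_def using measure_space_weight[of u]
  by (intro emeasure_measure_of_sigma) (auto simp: measure_space_def)

definition representing_measure :: "'a measure" where
  "representing_measure = weight_measure (\<lambda>_. 1)"

lemma emeasure_representing_measure:
  "A \<in> sets borel \<Longrightarrow> emeasure representing_measure A = upper (indicator A)"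
  by (simp add: representing_measure_def emeasure_weight_measure weight_def)

section \<open>Integration against the representing measure\<close>

lemma borel_pos_test: "pos_test f \<Longrightarrow> f \<in> borel_measurable borel"
  by (auto simp: pos_test_def intro!: borel_measurable_continuous_onI smooth_on_continuous test_funD)

text \<open>This is where weights other than 1 are used. On each level set a simple function
  \<open>g \<le> f\<close> is a constant below \<open>f\<close>, so its integral is at most the sum
  of the masses of the level sets for the weight \<open>f\<close>. Additivity of that weighted
  measure bounds the sum by its total mass, which is \<open>\<Lambda> f\<close>.\<close>

lemma nn_integral_le: "pos_test f \<Longrightarrow> (\<integral>\<^sup>+x. ennreal (f x) \<partial>representing_measure) \<le> ennreal (\<Lambda> f)"
  unfolding nn_integral_def
proof (rule SUP_least, safe)
  fix g assume f: "pos_test f" and g: "simple_function representing_measure g"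
    and le: "g \<le> (\<lambda>x. ennreal (f x))"
  let ?M = "weight_measure (\<lambda>x. ennreal (f x))"
  have [measurable]: "g \<in> borel_measurable borel"
    using borel_measurable_simple_function[OF g] by (simp add: representing_measure_def)
  have A: "g -` {y} \<in> sets borel" for y
    using measurable_sets[OF \<open>g \<in> borel_measurable borel\<close>, of "{y}"] by simp
  have fin: "finite (range g)" using g by (simp add: simple_function_def representing_measure_def)
  have "y * emeasure representing_measure (g -` {y}) \<le> emeasure ?M (g -` {y})" if "y \<in> range g" for y
  proof -
    from that obtain z where z: "y = g z" by auto
    then have "y \<noteq> top" using le_funD[OF le, of z] by (auto simp: top_unique)
    then obtain c where c: "0 \<le> c" "y = ennreal c" by (cases y) auto
    have "y * emeasure representing_measure (g -` {y}) = upper (\<lambda>x. y * indicator (g -` {y}) x)"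
    proof (cases "c = 0")
      case False
      then show ?thesis
        using c A by (simp add: emeasure_representing_measure upper_cmult)
    qed (use c in simp)
    also have "\<dots> \<le> weight (\<lambda>x. ennreal (f x)) (g -` {y})"
      unfolding weight_def
      by (rule upper_mono) (use le_funD[OF le] in \<open>auto split: split_indicator\<close>)
    finally show ?thesis using A by (simp add: emeasure_weight_measure)
  qed
  then have "simple_integral representing_measure g \<le> (\<Sum>y\<in>range g. emeasure ?M (g -` {y}))"
    by (auto simp: simple_integral_def representing_measure_def intro!: sum_mono)
  also have "\<dots> = emeasure ?M (\<Union>y\<in>range g. g -` {y})"
    using A fin by (intro sum_emeasure) (auto simp: disjoint_family_on_def)
  also have "\<dots> \<le> weight (\<lambda>x. ennreal (f x)) UNIV"
    by (rule order_trans[OF emeasure_mono[of _ UNIV]]) (auto simp: emeasure_weight_measure)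
  also have "\<dots> = ennreal (\<Lambda> f)" using upper_pos_test[OF f] by (simp add: weight_def)
  finally show "integral\<^sup>S representing_measure g \<le> ennreal (\<Lambda> f)" .
qed

text \<open>The series is the staircase \<open>e\<close> times the floor of \<open>t / e\<close>,
  written by superlevel sets so that it can be composed with \<open>f\<close> and summed with
  countable subadditivity.\<close>

lemma layer_sum:
  fixes e t :: real
  assumes "0 < e" "0 \<le> t"
  shows "(\<Sum>i. ennreal e * indicator {s. (real i + 1) * e \<le> s} t) \<le> ennreal t"
    "ennreal t \<le> (\<Sum>i. ennreal e * indicator {s. (real i + 1) * e \<le> s} t) + ennreal e"
proof -
  define N where "N = nat \<lfloor>t / e\<rfloor>"
  have N: "real N \<le> t / e" "t / e < real N + 1"
    using assms by (auto simp: N_def)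
  have iff: "(real i + 1) * e \<le> t \<longleftrightarrow> i < N" for i
  proof -
    have "(real i + 1) * e \<le> t \<longleftrightarrow> real i + 1 \<le> t / e" using assms by (simp add: field_simps)
    also have "\<dots> \<longleftrightarrow> i < N" using N by linarith
    finally show ?thesis .
  qed
  have "(\<Sum>i. ennreal e * indicator {s. (real i + 1) * e \<le> s} t) = (\<Sum>i<N. ennreal e)"
    by (subst suminf_finite[of "{..<N}"]) (auto simp: iff)
  also have "\<dots> = ennreal (real N * e)"
    using assms by (simp add: ennreal_mult ennreal_of_nat_eq_real_of_nat)
  finally have *: "(\<Sum>i. ennreal e * indicator {s. (real i + 1) * e \<le> s} t) = ennreal (real N * e)" .
  show "(\<Sum>i. ennreal e * indicator {s. (real i + 1) * e \<le> s} t) \<le> ennreal t"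
    unfolding * using N assms by (intro ennreal_leI) (simp add: field_simps)
  show "ennreal t \<le> (\<Sum>i. ennreal e * indicator {s. (real i + 1) * e \<le> s} t) + ennreal e"
  proof -
    have "t \<le> real N * e + e" using N assms by (simp add: field_simps)
    then have "ennreal t \<le> ennreal (real N * e + e)" by (rule ennreal_leI)
    then show ?thesis unfolding * using assms by (subst ennreal_plus[symmetric]) auto
  qed
qed

text \<open>The staircase of height \<open>e\<close> approximates \<open>f\<close> from below with
  error at most \<open>e * \<eta>\<close>. Countable subadditivity of \<open>upper\<close> over its
  layers turns \<open>upper\<close> into the integral of the staircase, which is at most the
  integral of \<open>f\<close>.\<close>

lemma nn_integral_ge:
  assumes f: "pos_test f"
  shows "ennreal (\<Lambda> f) \<le> (\<integral>\<^sup>+x. ennreal (f x) \<partial>representing_measure)"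
proof -
  obtain K where K: "compact K" "K \<subseteq> S" "\<And>x. x \<notin> K \<Longrightarrow> f x = 0"
    using f by (auto simp: pos_test_def test_fun_def)
  obtain \<eta> where \<eta>: "test_fun S \<eta>" "\<And>x. 0 \<le> \<eta> x" "\<And>x. x \<in> K \<Longrightarrow> 1 \<le> \<eta> x"
    using test_fun_ge_1[OF open_S K(1,2)] by blast
  have [measurable]: "f \<in> borel_measurable borel" by (rule borel_pos_test[OF f])
  have f0: "0 \<le> f x" for x using f by (simp add: pos_test_def)
  have approx: "ennreal (\<Lambda> f) \<le> (\<integral>\<^sup>+x. ennreal (f x) \<partial>representing_measure) + ennreal (e * \<Lambda> \<eta>)"
    if e: "0 < e" for e
  proof -
    let ?A = "\<lambda>i::nat. {x. (real i + 1) * e \<le> f x}"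
    let ?s = "\<lambda>x. \<Sum>i. ennreal e * indicator (?A i) x"
    have ind: "indicator {s. (real i + 1) * e \<le> s} (f x) = (indicator (?A i) x :: ennreal)" for i x
      by (simp add: indicator_def)
    have A [measurable]: "?A i \<in> sets borel" for i by measurable
    have "ennreal (f x) \<le> ?s x + ennreal (e * \<eta> x)" for x
    proof (cases "x \<in> K")
      case True
      then have "ennreal e \<le> ennreal (e * \<eta> x)" using \<eta>(3) e by (intro ennreal_leI) simp
      then show ?thesis using layer_sum(2)[OF e f0[of x]] unfolding ind
        by (meson add_left_mono order_trans)
    qed (simp add: K)
    then have "upper (\<lambda>x. ennreal (f x)) \<le> upper (\<lambda>x. ?s x + ennreal (e * \<eta> x))"
      by (rule upper_mono)
    also have "\<dots> \<le> upper ?s + upper (\<lambda>x. ennreal (e * \<eta> x))" by (rule upper_add_le)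
    also have "upper (\<lambda>x. ennreal (e * \<eta> x)) = ennreal (e * \<Lambda> \<eta>)"
      using e \<eta> by (subst upper_pos_test) (auto simp: pos_test_def test_fun_cmult scale)
    also have "upper ?s \<le> (\<Sum>i. upper (\<lambda>x. ennreal e * indicator (?A i) x))"
      by (rule upper_countably_subadditive)
    also have "\<dots> = (\<Sum>i. ennreal e * emeasure representing_measure (?A i))"
      using e A by (simp add: upper_cmult emeasure_representing_measure)
    also have "\<dots> = (\<Sum>i. \<integral>\<^sup>+x. ennreal e * indicator (?A i) x \<partial>representing_measure)"
      by (intro suminf_cong nn_integral_cmult_indicator[symmetric])
        (simp add: representing_measure_def)
    also have "\<dots> = (\<integral>\<^sup>+x. ?s x \<partial>representing_measure)"
      by (intro nn_integral_suminf[symmetric]) (simp add: representing_measure_def)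
    also have "\<dots> \<le> (\<integral>\<^sup>+x. ennreal (f x) \<partial>representing_measure)"
      using layer_sum(1)[OF e f0] unfolding ind by (intro nn_integral_mono)
    finally show ?thesis using upper_pos_test[OF f] by (simp add: add_right_mono)
  qed
  show ?thesis
  proof (rule ennreal_le_epsilon)
    fix e :: real assume "0 < e"
    have "(e / (\<Lambda> \<eta> + 1)) * \<Lambda> \<eta> \<le> e" and pos: "0 < e / (\<Lambda> \<eta> + 1)"
      using nonneg[OF \<eta>(1,2)] \<open>0 < e\<close> by (auto simp: field_simps)
    then show "ennreal (\<Lambda> f) \<le> (\<integral>\<^sup>+x. ennreal (f x) \<partial>representing_measure) + ennreal e"
      using approx[OF pos] by (meson add_left_mono ennreal_leI order_trans)
  qed
qed

lemma integral_pos_test: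
  assumes "pos_test f"
  shows "integrable representing_measure f" "integral\<^sup>L representing_measure f = \<Lambda> f"
proof -
  have "(\<integral>\<^sup>+x. ennreal (f x) \<partial>representing_measure) = ennreal (\<Lambda> f)"
    using nn_integral_le nn_integral_ge assms by (intro antisym)
  moreover have "f \<in> borel_measurable representing_measure"
    using borel_pos_test[OF assms] by (simp add: representing_measure_def)
  moreover have "AE x in representing_measure. 0 \<le> f x" "0 \<le> \<Lambda> f"
    using assms by (auto simp: pos_test_def nonneg)
  ultimately show "integrable representing_measure f" "integral\<^sup>L representing_measure f = \<Lambda> f"
    using nn_integral_eq_integrable by blast+
qed

lemma integral_test_fun:
  assumes f: "test_fun S f"
  shows "integrable representing_measure f" "integral\<^sup>L representing_measure f = \<Lambda> f"
proof -
  obtain g where g: "test_fun S g" "\<And>x. 0 \<le> g x" "\<And>x. 0 \<le> f x + g x"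
    using test_fun_add_nonneg[OF open_S f] by blast
  then have "pos_test g" "pos_test (\<lambda>x. f x + g x)"
    using f by (auto simp: pos_test_def test_fun_add)
  note gh = integral_pos_test[OF this(1)] integral_pos_test[OF this(2)]
  have "integrable representing_measure (\<lambda>x. (f x + g x) - g x)"
    "integral\<^sup>L representing_measure (\<lambda>x. (f x + g x) - g x) = \<Lambda> (\<lambda>x. f x + g x) - \<Lambda> g"
    using Bochner_Integration.integrable_diff[OF gh(3,1)]
      Bochner_Integration.integral_diff[OF gh(3,1)] gh by simp_all
  then show "integrable representing_measure f" "integral\<^sup>L representing_measure f = \<Lambda> f"
    by (simp_all add: add[OF f g(1)])
qed

lemma emeasure_compact_finite:
  assumes "compact K" "K \<subseteq> S"
  shows "emeasure representing_measure K < \<infinity>"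
proof -
  obtain \<eta> where \<eta>: "test_fun S \<eta>" "\<And>x. 0 \<le> \<eta> x" "\<And>x. x \<in> K \<Longrightarrow> 1 \<le> \<eta> x"
    using test_fun_ge_1[OF open_S assms] by blast
  have "emeasure representing_measure K \<le> upper (\<lambda>x. ennreal (\<eta> x))"
    using assms \<eta> by (subst emeasure_representing_measure)
      (auto simp: borel_compact intro!: upper_mono split: split_indicator)
  also have "\<dots> = ennreal (\<Lambda> \<eta>)" using \<eta> by (intro upper_pos_test) (simp add: pos_test_def)
  finally show ?thesis by (simp add: le_less_trans)
qed

end

lemma riesz_representation:
  fixes S :: "'a::euclidean_space set"
  assumes "open S"
    and "\<And>f g. test_fun S f \<Longrightarrow> test_fun S g \<Longrightarrow> \<Lambda> (\<lambda>x. f x + g x) = \<Lambda> f + (\<Lambda> g :: real)"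
    and "\<And>f c. test_fun S f \<Longrightarrow> \<Lambda> (\<lambda>x. c * f x) = c * \<Lambda> f"
    and "\<And>f. test_fun S f \<Longrightarrow> (\<And>x. 0 \<le> f x) \<Longrightarrow> 0 \<le> \<Lambda> f"
  obtains \<mu> where "sets \<mu> = sets borel" "\<And>K. compact K \<Longrightarrow> K \<subseteq> S \<Longrightarrow> emeasure \<mu> K < \<infinity>"
    "\<And>f. test_fun S f \<Longrightarrow> integrable \<mu> f" "\<And>f. test_fun S f \<Longrightarrow> integral\<^sup>L \<mu> f = \<Lambda> f"
proof -
  interpret positive_functional S \<Lambda> by unfold_locales (use assms in auto)
  show ?thesis
    using that[of representing_measure] emeasure_compact_finite integral_test_fun
    by (simp add: representing_measure_def)
qed

section \<open>The exterior algebra\<close>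

lemma shuffle_sign_empty [simp]: "shuffle_sign {} A = 1" "shuffle_sign A {} = 1"
  by (simp_all add: shuffle_sign_def)

lemma shuffle_sign_square [simp]: "shuffle_sign A B * shuffle_sign A B = 1"
  by (simp add: shuffle_sign_def flip: power_add)

lemma shuffle_sign_Un_left:
  assumes "A \<inter> B = {}"
  shows "shuffle_sign (A \<union> B) C = shuffle_sign A C * shuffle_sign B C"
proof -
  have "{(a, b). a \<in> A \<union> B \<and> b \<in> C \<and> b < a} = {(a, b). a \<in> A \<and> b \<in> C \<and> b < a} \<union> {(a, b). a \<in> B \<and> b \<in> C \<and> b < a}"
    by auto
  moreover have "{(a, b). a \<in> A \<and> b \<in> C \<and> b < a} \<inter> {(a, b). a \<in> B \<and> b \<in> C \<and> b < a} = {}"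
    using assms by auto
  ultimately show ?thesis unfolding shuffle_sign_def by (simp add: card_Un_disjoint power_add)
qed

lemma shuffle_sign_Un_right:
  assumes "A \<inter> B = {}"
  shows "shuffle_sign C (A \<union> B) = shuffle_sign C A * shuffle_sign C B"
proof -
  have "{(a, b). a \<in> C \<and> b \<in> A \<union> B \<and> b < a} = {(a, b). a \<in> C \<and> b \<in> A \<and> b < a} \<union> {(a, b). a \<in> C \<and> b \<in> B \<and> b < a}"
    by auto
  moreover have "{(a, b). a \<in> C \<and> b \<in> A \<and> b < a} \<inter> {(a, b). a \<in> C \<and> b \<in> B \<and> b < a} = {}"
    using assms by auto
  ultimately show ?thesis unfolding shuffle_sign_def by (simp add: card_Un_disjoint power_add)
qed

text \<open>For disjoint sets every pair in \<open>A \<times> B\<close> is an inversion for exactly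
  one of the two orders, so the two inversion counts add up to
  \<open>card A * card B\<close>.\<close>

lemma shuffle_sign_swap:
  assumes "A \<inter> B = {}"
  shows "shuffle_sign A B = (-1) ^ (card A * card B) * shuffle_sign B A"
proof -
  let ?P = "{(a, b). a \<in> A \<and> b \<in> B \<and> b < a}" and ?Q = "{(b, a). b \<in> B \<and> a \<in> A \<and> a < b}"
  have un: "A \<times> B = ?P \<union> prod.swap ` ?Q"
    using assms linorder_neqE by (fastforce simp: image_iff)
  have "card (A \<times> B) = card ?P + card (prod.swap ` ?Q)"
    unfolding un by (rule card_Un_disjoint) auto
  also have "card (prod.swap ` ?Q) = card ?Q" by (rule card_image) simp
  finally have "card A * card B = card ?P + card ?Q" by (simp add: card_cartesian_product)
  then have "(-1 :: complex) ^ (card A * card B) = shuffle_sign A B * shuffle_sign B A"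
    by (simp add: shuffle_sign_def power_add)
  then show ?thesis by (simp add: mult.assoc)
qed

section \<open>The wedge product: bilinearity, associativity, commutation\<close>

definition smul :: "('n cspace \<Rightarrow> complex) \<Rightarrow> 'n::{finite,linorder} dform \<Rightarrow> 'n dform" where
  "smul c \<omega> = (\<lambda>x I J. c x * \<omega> x I J)"

definition fadd :: "'n::{finite,linorder} dform \<Rightarrow> 'n dform \<Rightarrow> 'n dform" where
  "fadd \<omega> \<eta> = (\<lambda>x I J. \<omega> x I J + \<eta> x I J)"

lemma wedge_smul_left: "wedge (smul c \<omega>) \<eta> = smul c (wedge \<omega> \<eta>)"
  by (simp add: wedge_def smul_def sum_distrib_left fun_eq_iff ac_simps)

lemma wedge_smul_right: "wedge \<omega> (smul c \<eta>) = smul c (wedge \<omega> \<eta>)"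
  by (simp add: wedge_def smul_def sum_distrib_left fun_eq_iff ac_simps)

lemma wedge_fadd_left: "wedge (fadd \<omega> \<eta>) \<zeta> = fadd (wedge \<omega> \<zeta>) (wedge \<eta> \<zeta>)"
  by (simp add: wedge_def fadd_def sum.distrib fun_eq_iff algebra_simps)

lemma wedge_fadd_right: "wedge \<zeta> (fadd \<omega> \<eta>) = fadd (wedge \<zeta> \<omega>) (wedge \<zeta> \<eta>)"
  by (simp add: wedge_def fadd_def sum.distrib fun_eq_iff algebra_simps)

lemma wedge_zero_left: "wedge (\<lambda>x I J. 0) \<omega> = (\<lambda>x I J. 0)"
  by (simp add: wedge_def fun_eq_iff)

lemma sum_eq_single:
  assumes "finite S" "a \<in> S" "\<And>x. x \<in> S \<Longrightarrow> x \<noteq> a \<Longrightarrow> f x = 0"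
  shows "sum f S = f a"
  using assms by (simp add: sum.remove)

lemma wedge_form0_left: "wedge (form0 f) \<omega> = smul f \<omega>"
proof (intro ext)
  fix x I J
  let ?t = "\<lambda>A B. (-1) ^ (card B * card (I - A)) * shuffle_sign A (I - A) * shuffle_sign B (J - B)
       * form0 f x A B * \<omega> x (I - A) (J - B)"
  have "(\<Sum>A\<in>Pow I. \<Sum>B\<in>Pow J. ?t A B) = (\<Sum>B\<in>Pow J. ?t {} B)"
    by (rule sum_eq_single) (auto simp: form0_def)
  also have "\<dots> = ?t {} {}" by (rule sum_eq_single) (auto simp: form0_def)
  finally show "wedge (form0 f) \<omega> x I J = smul f \<omega> x I J"
    by (simp add: wedge_def form0_def smul_def)
qed

lemma wedge_form0_right: "wedge \<omega> (form0 f) = smul f \<omega>"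
proof (intro ext)
  fix x I J
  let ?t = "\<lambda>A B. (-1) ^ (card B * card (I - A)) * shuffle_sign A (I - A) * shuffle_sign B (J - B)
       * \<omega> x A B * form0 f x (I - A) (J - B)"
  have "(\<Sum>A\<in>Pow I. \<Sum>B\<in>Pow J. ?t A B) = (\<Sum>B\<in>Pow J. ?t I B)"
    by (rule sum_eq_single) (auto simp: form0_def intro!: sum.neutral)
  also have "\<dots> = ?t I J" by (rule sum_eq_single) (auto simp: form0_def)
  finally show "wedge \<omega> (form0 f) x I J = smul f \<omega> x I J"
    by (simp add: wedge_def form0_def smul_def)
qed

text \<open>Both sides run over the ordered partitions of \<open>I\<close> into three parts: on the
  left the union of the first two is chosen first, on the right the first part.\<close>

lemma sum_Pow_split:
  fixes F :: "'n::finite set \<Rightarrow> 'n set \<Rightarrow> 'n set \<Rightarrow> complex"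
  shows "(\<Sum>A\<in>Pow I. \<Sum>A1\<in>Pow A. F A1 (A - A1) (I - A))
    = (\<Sum>A1\<in>Pow I. \<Sum>A2\<in>Pow (I - A1). F A1 A2 (I - A1 - A2))"
proof -
  have eq: "(A1 \<union> A2) - A1 = A2" "I - (A1 \<union> A2) = I - A1 - A2" if "A2 \<subseteq> I - A1" for A1 A2
    using that by auto
  have "(\<Sum>(A, A1)\<in>Sigma (Pow I) Pow. F A1 (A - A1) (I - A))
      = (\<Sum>(A1, A2)\<in>Sigma (Pow I) (\<lambda>A1. Pow (I - A1)). F A1 A2 (I - A1 - A2))"
    by (rule sum.reindex_bij_witness[where i = "\<lambda>(A1, A2). (A1 \<union> A2, A1)" and j = "\<lambda>(A, A1). (A1, A - A1)"])
      (auto simp: eq Un_absorb1 Diff_Diff_Int intro!: arg_cong[of _ _ "F _ _"])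
  then show ?thesis by (simp add: sum.Sigma)
qed

text \<open>Both bracketings become sums over ordered partitions of \<open>I\<close> and of
  \<open>J\<close> into three parts, with summands \<open>G\<close> and \<open>H\<close>. These
  agree because \<open>shuffle_sign\<close> is multiplicative over disjoint unions in each argument
  and cardinalities add.\<close>

lemma wedge_assoc: "wedge (wedge \<omega> \<eta>) \<zeta> = wedge \<omega> (wedge \<eta> \<zeta>)"
proof (intro ext)
  fix x I J
  define G where "G = (\<lambda>A1 A2 A3 B1 B2 B3.
    (-1) ^ (card (B1 \<union> B2) * card A3) * shuffle_sign (A1 \<union> A2) A3 * shuffle_sign (B1 \<union> B2) B3
    * ((-1) ^ (card B1 * card A2) * shuffle_sign A1 A2 * shuffle_sign B1 B2 * \<omega> x A1 B1 * \<eta> x A2 B2)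
    * \<zeta> x A3 B3)"
  define H where "H = (\<lambda>A1 A2 A3 B1 B2 B3.
    (-1) ^ (card B1 * card (A2 \<union> A3)) * shuffle_sign A1 (A2 \<union> A3) * shuffle_sign B1 (B2 \<union> B3)
    * \<omega> x A1 B1 * ((-1) ^ (card B2 * card A3) * shuffle_sign A2 A3 * shuffle_sign B2 B3 * \<eta> x A2 B2
    * \<zeta> x A3 B3))"
  have GH: "G A1 A2 A3 B1 B2 B3 = H A1 A2 A3 B1 B2 B3"
    if "A1 \<inter> A2 = {}" "A2 \<inter> A3 = {}" "B1 \<inter> B2 = {}" "B2 \<inter> B3 = {}" for A1 A2 A3 B1 B2 B3
    using that unfolding G_def H_def
    by (simp add: shuffle_sign_Un_left shuffle_sign_Un_right card_Un_disjoint power_add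
        algebra_simps)
  have "wedge (wedge \<omega> \<eta>) \<zeta> x I J = (\<Sum>A\<in>Pow I. \<Sum>B\<in>Pow J. \<Sum>A1\<in>Pow A. \<Sum>B1\<in>Pow B.
      G A1 (A - A1) (I - A) B1 (B - B1) (J - B))"
    unfolding wedge_def G_def
    by (intro sum.cong refl) (auto simp: sum_distrib_left sum_distrib_right Un_absorb1 intro!: sum.cong)
  also have "\<dots> = (\<Sum>A\<in>Pow I. \<Sum>A1\<in>Pow A. \<Sum>B\<in>Pow J. \<Sum>B1\<in>Pow B.
      G A1 (A - A1) (I - A) B1 (B - B1) (J - B))"
    by (intro sum.cong refl sum.swap)
  also have "\<dots> = (\<Sum>A1\<in>Pow I. \<Sum>A2\<in>Pow (I - A1). \<Sum>B\<in>Pow J. \<Sum>B1\<in>Pow B.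
      G A1 A2 (I - A1 - A2) B1 (B - B1) (J - B))"
    by (rule sum_Pow_split)
  also have "\<dots> = (\<Sum>A1\<in>Pow I. \<Sum>A2\<in>Pow (I - A1). \<Sum>B1\<in>Pow J. \<Sum>B2\<in>Pow (J - B1).
      G A1 A2 (I - A1 - A2) B1 B2 (J - B1 - B2))"
    by (intro sum.cong refl sum_Pow_split)
  also have "\<dots> = (\<Sum>A1\<in>Pow I. \<Sum>A2\<in>Pow (I - A1). \<Sum>B1\<in>Pow J. \<Sum>B2\<in>Pow (J - B1).
      H A1 A2 (I - A1 - A2) B1 B2 (J - B1 - B2))"
    by (intro sum.cong refl GH) auto
  also have "\<dots> = (\<Sum>A1\<in>Pow I. \<Sum>B1\<in>Pow J. \<Sum>A2\<in>Pow (I - A1). \<Sum>B2\<in>Pow (J - B1).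
      H A1 A2 (I - A1 - A2) B1 B2 (J - B1 - B2))"
    by (intro sum.cong refl sum.swap)
  also have "\<dots> = wedge \<omega> (wedge \<eta> \<zeta>) x I J"
    unfolding wedge_def H_def
    by (intro sum.cong refl) (auto simp: sum_distrib_left Un_absorb1 intro!: sum.cong)
  finally show "wedge (wedge \<omega> \<eta>) \<zeta> x I J = wedge \<omega> (wedge \<eta> \<zeta>) x I J" .
qed

definition even_form :: "'n::{finite,linorder} dform \<Rightarrow> bool" where
  "even_form \<omega> \<longleftrightarrow> (\<forall>x I J. \<omega> x I J \<noteq> 0 \<longrightarrow> even (card I + card J))"

lemma wedge_commute:
  assumes "even_form \<omega>"
  shows "wedge \<omega> \<eta> = wedge \<eta> \<omega>"
proof (intro ext)
  fix x I J
  have swap: "(-1) ^ (card B * card (I - A)) * shuffle_sign A (I - A) * shuffle_sign B (J - B)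
       * \<omega> x A B * \<eta> x (I - A) (J - B)
     = (-1) ^ (card (J - B) * card A) * shuffle_sign (I - A) A * shuffle_sign (J - B) B
       * \<eta> x (I - A) (J - B) * \<omega> x A B" for A B
  proof (cases "\<omega> x A B = 0")
    case False
    let ?a = "card A" and ?b = "card B" and ?c = "card (I - A)" and ?d = "card (J - B)"
    have "even (?a + ?b)" using assms False by (simp add: even_form_def)
    \<comment> \<open>The two exponents differ modulo 2 by \<open>(?a + ?b) * (?c + ?d)\<close>,
      which is even because the total degree of the first factor is.\<close>
    then have "even (?b * ?c + ?a * ?c + ?b * ?d) = even (?d * ?a)" by auto
    then have "(-1 :: complex) ^ (?b * ?c + ?a * ?c + ?b * ?d) = (-1) ^ (?d * ?a)"
      by (simp add: minus_one_power_iff)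
    moreover have "shuffle_sign A (I - A) = (-1) ^ (?a * ?c) * shuffle_sign (I - A) A"
      "shuffle_sign B (J - B) = (-1) ^ (?b * ?d) * shuffle_sign (J - B) B"
      by (auto intro!: shuffle_sign_swap)
    ultimately show ?thesis by (simp add: power_add ac_simps)
  qed simp
  have "wedge \<omega> \<eta> x I J = (\<Sum>A\<in>Pow I. \<Sum>B\<in>Pow J.
      (-1) ^ (card (J - B) * card A) * shuffle_sign (I - A) A * shuffle_sign (J - B) B
       * \<eta> x (I - A) (J - B) * \<omega> x A B)"
    unfolding wedge_def swap ..
  also have "\<dots> = (\<Sum>A\<in>Pow I. \<Sum>B\<in>Pow J.
      (-1) ^ (card B * card (I - A)) * shuffle_sign A (I - A) * shuffle_sign B (J - B)
       * \<eta> x A B * \<omega> x (I - A) (J - B))"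
  proof (rule sum.reindex_bij_witness[where i = "\<lambda>A. I - A" and j = "\<lambda>A. I - A"])
    fix A assume "A \<in> Pow I"
    then have A: "I - (I - A) = A" by auto
    show "(\<Sum>B\<in>Pow J. (-1) ^ (card B * card (I - (I - A))) * shuffle_sign (I - A) (I - (I - A))
       * shuffle_sign B (J - B) * \<eta> x (I - A) B * \<omega> x (I - (I - A)) (J - B))
     = (\<Sum>B\<in>Pow J. (-1) ^ (card (J - B) * card A) * shuffle_sign (I - A) A * shuffle_sign (J - B) B
       * \<eta> x (I - A) (J - B) * \<omega> x A B)"
      unfolding A
      by (rule sum.reindex_bij_witness[where i = "\<lambda>B. J - B" and j = "\<lambda>B. J - B"])
        (auto simp: double_diff)
  qed auto
  finally show "wedge \<omega> \<eta> x I J = wedge \<eta> \<omega> x I J" unfolding wedge_def .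
qed

lemma even_form_wedge:
  assumes "even_form \<omega>" "even_form \<eta>"
  shows "even_form (wedge \<omega> \<eta>)"
  unfolding even_form_def
proof (intro allI impI)
  fix x I J assume "wedge \<omega> \<eta> x I J \<noteq> 0"
  then obtain A B where *: "A \<subseteq> I" "B \<subseteq> J" "\<omega> x A B \<noteq> 0" "\<eta> x (I - A) (J - B) \<noteq> 0"
    unfolding wedge_def by (fastforce elim!: sum.not_neutral_contains_not_neutral)
  then have "even ((card A + card B) + (card (I - A) + card (J - B)))"
    using assms by (simp add: even_form_def)
  also have "(card A + card B) + (card (I - A) + card (J - B)) = card I + card J"
    using card_mono[OF finite *(1)] card_mono[OF finite *(2)] * by (simp add: card_Diff_subset)
  finally show "even (card I + card J)" .
qed

lemma wedge_power_0: "wedge_power \<omega> 0 = form0 (\<lambda>_. 1)"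
  and wedge_power_Suc: "wedge_power \<omega> (Suc k) = wedge \<omega> (wedge_power \<omega> k)"
  by (simp_all add: wedge_power_def wedge_list_def)

lemma smul_1 [simp]: "smul (\<lambda>_. 1) \<omega> = \<omega>"
  and smul_smul: "smul c (smul d \<omega>) = smul (\<lambda>x. c x * d x) \<omega>"
  and smul_fadd: "smul c (fadd \<omega> \<eta>) = fadd (smul c \<omega>) (smul c \<eta>)"
  by (simp_all add: smul_def fadd_def fun_eq_iff algebra_simps)

lemma wedge_power_add: "wedge (wedge_power \<omega> j) (wedge_power \<omega> k) = wedge_power \<omega> (j + k)"
  by (induction j) (simp_all add: wedge_power_0 wedge_power_Suc wedge_form0_left wedge_assoc)

lemma even_form_wedge_power: "even_form \<omega> \<Longrightarrow> even_form (wedge_power \<omega> k)"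
proof (induction k)
  case 0
  then show ?case by (auto simp: wedge_power_0 even_form_def form0_def)
qed (simp add: wedge_power_Suc even_form_wedge)

definition one_one :: "('n cspace \<Rightarrow> 'n \<Rightarrow> 'n \<Rightarrow> complex) \<Rightarrow> 'n::{finite,linorder} dform" where
  "one_one h = (\<lambda>x I J. if card I = 1 \<and> card J = 1 then h x (the_elem I) (the_elem J) else 0)"

lemma even_form_one_one: "even_form (one_one h)"
  by (simp add: even_form_def one_one_def)

lemma smul_one_one: "smul c (one_one h) = one_one (\<lambda>x a b. c x * h x a b)"
  by (auto simp: smul_def one_one_def fun_eq_iff)

lemma fadd_one_one: "fadd (one_one h) (one_one k) = one_one (\<lambda>x a b. h x a b + k x a b)"
  by (auto simp: fadd_def one_one_def fun_eq_iff)

lemma sum_Pow_singletons: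
  fixes I :: "'n::finite set" and f :: "'n set \<Rightarrow> complex"
  assumes "\<And>A. card A \<noteq> 1 \<Longrightarrow> f A = 0"
  shows "(\<Sum>A\<in>Pow I. f A) = (\<Sum>a\<in>I. f {a})"
proof -
  have "(\<Sum>A\<in>Pow I. f A) = (\<Sum>A\<in>(\<lambda>a. {a}) ` I. f A)"
  proof (rule sum.mono_neutral_right)
    show "\<forall>A\<in>Pow I - (\<lambda>a. {a}) ` I. f A = 0"
    proof
      fix A assume A: "A \<in> Pow I - (\<lambda>a. {a}) ` I"
      have "card A \<noteq> 1"
      proof
        assume "card A = 1"
        then obtain a where "A = {a}" by (auto simp: card_1_singleton_iff)
        with A show False by auto
      qed
      then show "f A = 0" by (rule assms)
    qed
  qed auto
  then show ?thesis by (simp add: sum.reindex)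
qed

lemma wedge_one_one:
  "wedge (one_one h) \<eta> x I J = (\<Sum>a\<in>I. \<Sum>b\<in>J. (-1) ^ card (I - {a}) * shuffle_sign {a} (I - {a})
     * shuffle_sign {b} (J - {b}) * h x a b * \<eta> x (I - {a}) (J - {b}))"
proof -
  let ?f = "\<lambda>A B. (-1) ^ (card B * card (I - A)) * shuffle_sign A (I - A) * shuffle_sign B (J - B)
     * one_one h x A B * \<eta> x (I - A) (J - B)"
  have "wedge (one_one h) \<eta> x I J = (\<Sum>A\<in>Pow I. \<Sum>b\<in>J. ?f A {b})"
    unfolding wedge_def by (intro sum.cong refl sum_Pow_singletons) (simp add: one_one_def)
  also have "\<dots> = (\<Sum>a\<in>I. \<Sum>b\<in>J. ?f {a} {b})"
    by (rule sum_Pow_singletons) (simp add: one_one_def)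
  finally show ?thesis by (simp add: one_one_def)
qed

section \<open>The Kaehler form and its powers\<close>

abbreviation kc :: complex where "kc \<equiv> \<i> / (2 * of_real pi)"

text \<open>The explicit coordinate expression of dd^c|z|^2, identified with \<open>kaehler\<close>
  only in \<open>kaehler_eq\<close>. This keeps the algebra of its powers free of
  differentiation.\<close>

definition std_kaehler :: "'n::{finite,linorder} dform" where
  "std_kaehler = one_one (\<lambda>x a b. if a = b then kc else 0)"

text \<open>This is \<open>d\<phi> \<and> d\<^sup>c\<phi>\<close> for \<open>\<phi> = |x - z|\<^sup>2\<close>.\<close>

definition grad_form :: "'n cspace \<Rightarrow> 'n::{finite,linorder} dform" where
  "grad_form z = one_one (\<lambda>x a b. kc * cnj ((x - z) $ a) * (x - z) $ b)"

text \<open>In closed form j! kc^j (-1)^(j(j-1)/2); the sign comes from sorting a product of pairs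
  dz dzbar into all dz followed by all dzbar.\<close>

fun kaehler_coeff :: "nat \<Rightarrow> complex" where
  "kaehler_coeff 0 = 1"
| "kaehler_coeff (Suc j) = of_nat (Suc j) * (-1) ^ j * kc * kaehler_coeff j"

text \<open>In the induction step only diagonal terms survive. Each of the \<open>Suc j\<close>
  indices contributes the same amount: its two equal shuffle signs cancel, and moving its dzbar past
  \<open>j\<close> factors dz leaves (-1)^j.\<close>

lemma std_kaehler_power:
  "wedge_power std_kaehler j x I J = (if I = J \<and> card I = j then kaehler_coeff j else 0)"
proof (induction j arbitrary: I J)
  case 0
  then show ?case by (auto simp: wedge_power_0 form0_def)
next
  case (Suc j)
  define t where "t = (\<lambda>a b. (-1) ^ card (I - {a}) * shuffle_sign {a} (I - {a}) * shuffle_sign {b} (J - {b})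
      * (if a = b then kc else 0) * wedge_power std_kaehler j x (I - {a}) (J - {b}))"
  have eq: "wedge_power std_kaehler (Suc j) x I J = (\<Sum>a\<in>I. \<Sum>b\<in>J. t a b)"
    unfolding wedge_power_Suc t_def by (subst (1) std_kaehler_def) (rule wedge_one_one)
  show ?case
  proof (cases "I = J \<and> card I = Suc j")
    case True
    have "(\<Sum>b\<in>J. t a b) = (-1) ^ j * kc * kaehler_coeff j" if "a \<in> I" for a
    proof -
      have "(\<Sum>b\<in>J. t a b) = (\<Sum>b\<in>{a}. t a b)"
        using that True by (intro sum.mono_neutral_right) (auto simp: t_def)
      also have "\<dots> = (-1) ^ j * kc * kaehler_coeff j"
        using that conjunct1[OF True] conjunct2[OF True]
        by (simp add: t_def Suc.IH card_Diff_singleton mult.assoc[symmetric])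
      finally show ?thesis .
    qed
    then show ?thesis using conjunct1[OF True] conjunct2[OF True] unfolding eq by simp
  next
    case False
    have "t a b = 0" if "a \<in> I" "b \<in> J" for a b
    proof (rule ccontr)
      assume "t a b \<noteq> 0"
      then have "b = a" "I - {a} = J - {b}" "card (I - {a}) = j"
        by (auto simp: t_def Suc.IH split: if_splits)
      then have "I = J" "card I = Suc j"
        using that by (blast, metis card_Suc_Diff1 finite)
      then show False using False by simp
    qed
    then show ?thesis unfolding eq using False by auto
  qed
qed

text \<open>The form is a multiple of the product of a (1,0)-form and a (0,1)-form, and one-forms
  square to zero. In coordinates, exchanging the two elements of \<open>I\<close> flips a shuffle
  sign and preserves the product of the coefficients.\<close>

lemma grad_form_square:
  fixes z :: "'n::{finite,linorder} cspace"
  shows "wedge (grad_form z) (grad_form z) = (\<lambda>x I J. 0)"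
proof (intro ext)
  fix x :: "'n cspace" and I J :: "'n set"
  let ?w = "x - z"
  define t where "t = (\<lambda>a b. (-1) ^ card (I - {a}) * shuffle_sign {a} (I - {a}) * shuffle_sign {b} (J - {b})
      * (kc * cnj (?w $ a) * ?w $ b) * grad_form z x (I - {a}) (J - {b}))"
  have eq: "wedge (grad_form z) (grad_form z) x I J = (\<Sum>a\<in>I. \<Sum>b\<in>J. t a b)"
    unfolding t_def by (subst (1) grad_form_def) (rule wedge_one_one)
  show "wedge (grad_form z) (grad_form z) x I J = 0"
  proof (cases "card I = 2")
    case True
    then obtain p q where I: "I = {p, q}" "p \<noteq> q" by (auto simp: card_2_iff)
    then have "I - {p} = {q}" "I - {q} = {p}" by auto
    moreover have "shuffle_sign {q} {p} = - shuffle_sign {p} {q}"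
      using shuffle_sign_swap[of "{q}" "{p}"] I by simp
    ultimately have "t p b + t q b = 0" for b
      by (simp add: t_def grad_form_def one_one_def I(1)[symmetric])
    moreover have "(\<Sum>a\<in>I. \<Sum>b\<in>J. t a b) = (\<Sum>b\<in>J. t p b + t q b)"
      using I by (simp add: sum.distrib)
    ultimately show ?thesis unfolding eq by simp
  next
    case False
    have "t a b = 0" if "a \<in> I" for a b
      using False that by (auto simp: t_def grad_form_def one_one_def card_Diff_singleton)
    then show ?thesis unfolding eq by simp
  qed
qed

text \<open>Wedging a (1,1)-form with \<beta>^(n-1) yields 1/n times its trace with respect to
  \<beta>, times \<beta>^n. The rank-one form here has trace |x - z|^2.\<close>

lemma grad_form_wedge_kaehler_power:
  "wedge (grad_form z) (wedge_power std_kaehler (CARD('n) - 1)) =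
    smul (\<lambda>x. of_real ((norm (x - z))\<^sup>2 / real CARD('n))) (wedge_power std_kaehler CARD('n))"
  for z :: "'n::{finite,linorder} cspace"
proof (intro ext)
  fix x :: "'n cspace" and I J :: "'n set"
  let ?w = "x - z"
  obtain n where n: "CARD('n) = Suc n" by (metis card_0_eq finite empty_not_UNIV not0_implies_Suc)
  define t where "t = (\<lambda>a b. (-1) ^ card (I - {a}) * shuffle_sign {a} (I - {a}) * shuffle_sign {b} (J - {b})
      * (kc * cnj (?w $ a) * ?w $ b) * wedge_power std_kaehler n x (I - {a}) (J - {b}))"
  have eq: "wedge (grad_form z) (wedge_power std_kaehler n) x I J = (\<Sum>a\<in>I. \<Sum>b\<in>J. t a b)"
    unfolding t_def by (subst (1) grad_form_def) (rule wedge_one_one)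
  have full: "I = UNIV" if "card I = Suc n" for I :: "'n set"
    using that n by (metis card_subset_eq finite top_greatest)
  have "wedge (grad_form z) (wedge_power std_kaehler n) x I J
      = (of_real ((norm ?w)\<^sup>2) / of_nat (Suc n)) * wedge_power std_kaehler (Suc n) x I J"
  proof (cases "I = J \<and> card I = Suc n")
    case True
    have cancel: "X * Y = (Y / c) * (c * X)" if "c \<noteq> 0" for X Y c :: complex
      using that by simp
    have "(\<Sum>b\<in>J. t a b) = ((-1) ^ n * kc * kaehler_coeff n) * of_real ((cmod (?w $ a))\<^sup>2)" if "a \<in> I" for a
    proof -
      have "(\<Sum>b\<in>J. t a b) = (\<Sum>b\<in>{a}. t a b)"
        using that True by (intro sum.mono_neutral_right) (auto simp: t_def std_kaehler_power)
      also have "\<dots> = ((-1) ^ n * kc * kaehler_coeff n) * (cnj (?w $ a) * ?w $ a)"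
        using that conjunct1[OF True] conjunct2[OF True]
        by (simp add: t_def std_kaehler_power card_Diff_singleton mult.assoc[symmetric])
      also have "cnj (?w $ a) * ?w $ a = of_real ((cmod (?w $ a))\<^sup>2)"
        by (simp only: complex_norm_square mult.commute)
      finally show ?thesis .
    qed
    then have "(\<Sum>a\<in>I. \<Sum>b\<in>J. t a b)
        = ((-1) ^ n * kc * kaehler_coeff n) * of_real (\<Sum>a\<in>I. (cmod (?w $ a))\<^sup>2)"
      by (simp add: sum_distrib_left)
    also have "(\<Sum>a\<in>I. (cmod (?w $ a))\<^sup>2) = (norm ?w)\<^sup>2"
      unfolding full[OF conjunct2[OF True]] by (simp add: norm_vec_def L2_set_def sum_nonneg)
    also have "((-1) ^ n * kc * kaehler_coeff n) * of_real ((norm ?w)\<^sup>2)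
      = (of_real ((norm ?w)\<^sup>2) / of_nat (Suc n)) *
        (of_nat (Suc n) * ((-1) ^ n * kc * kaehler_coeff n))"
      by (rule cancel) (simp del: of_nat_Suc)
    also have "of_nat (Suc n) * ((-1) ^ n * kc * kaehler_coeff n) = kaehler_coeff (Suc n)"
      by (simp only: kaehler_coeff.simps mult.assoc)
    also have "\<dots> = wedge_power std_kaehler (Suc n) x I J"
      unfolding std_kaehler_power by (rule if_P[OF True, symmetric])
    finally show ?thesis unfolding eq .
  next
    case False
    have "t a b = 0" if "a \<in> I" "b \<in> J" for a b
    proof (rule ccontr)
      assume "t a b \<noteq> 0"
      then have *: "I - {a} = J - {b}" "card (I - {a}) = n" by (auto simp: t_def std_kaehler_power split: if_splits)
      then have "card I = Suc n" "card J = Suc n"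
        using that by (metis card_Suc_Diff1 finite)+
      then show False using full False by metis
    qed
    moreover have "wedge_power std_kaehler (Suc n) x I J = 0"
      unfolding std_kaehler_power by (rule if_not_P[OF False])
    ultimately show ?thesis unfolding eq by simp
  qed
  then show "wedge (grad_form z) (wedge_power std_kaehler (CARD('n) - 1)) x I J
    = smul (\<lambda>x. of_real ((norm (x - z))\<^sup>2 / real CARD('n))) (wedge_power std_kaehler CARD('n)) x I J"
    by (simp add: n smul_def)
qed

section \<open>An \<open>m\<close>-positive form\<close>

text \<open>With respect to \<open>\<beta>\<close>, the form \<open>(m/n) |x - z|\<^sup>2 \<beta> - d\<phi> \<and> d\<^sup>c\<phi>\<close> for \<open>\<phi> = |x - z|\<^sup>2\<close> has the
  eigenvalues \<open>(m/n) \<phi>\<close> with multiplicity \<open>n - 1\<close> and \<open>(m/n - 1) \<phi>\<close>; the constant \<open>m/n\<close> is the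
  smallest one for which it is \<open>m\<close>-positive.\<close>

definition cone_form :: "real \<Rightarrow> 'n cspace \<Rightarrow> 'n::{finite,linorder} dform" where
  "cone_form C z = fadd (smul (\<lambda>x. of_real (C * (norm (x - z))\<^sup>2)) std_kaehler)
     (smul (\<lambda>_. -1) (grad_form z))"

lemma fadd_smul_cancel: "fadd \<omega> (smul (\<lambda>_. 0) \<eta>) = \<omega>"
  by (simp add: fadd_def smul_def)

lemma even_std_kaehler: "even_form std_kaehler"
  by (simp add: std_kaehler_def even_form_one_one)

text \<open>The binomial expansion stops after two terms because \<open>grad_form z\<close> squares
  to zero.\<close>

lemma cone_form_power:
  fixes z :: "'n::{finite,linorder} cspace"
  shows "wedge_power (cone_form C z) (Suc j) =
    fadd (smul (\<lambda>x. of_real ((C * (norm (x - z))\<^sup>2) ^ Suc j)) (wedge_power std_kaehler (Suc j)))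
      (smul (\<lambda>x. of_real (- real (Suc j) * (C * (norm (x - z))\<^sup>2) ^ j))
        (wedge (grad_form z) (wedge_power std_kaehler j)))"
proof (induction j)
  case 0
  show ?case
    by (simp add: wedge_power_Suc wedge_power_0 wedge_form0_right cone_form_def smul_def)
next
  case (Suc j)
  let ?u = "\<lambda>x. complex_of_real (C * (norm (x - z))\<^sup>2)"
  let ?P = "wedge_power std_kaehler"
  have swap: "wedge std_kaehler (wedge (grad_form z) (?P j)) = wedge (grad_form z) (?P (Suc j))"
    by (simp add: wedge_power_Suc wedge_commute[OF even_std_kaehler, of "grad_form z"] flip: wedge_assoc)
  have zero: "wedge (grad_form z) (wedge (grad_form z) (?P j)) = (\<lambda>x I J. 0)"
    by (simp add: grad_form_square wedge_zero_left flip: wedge_assoc)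
  show ?case
    unfolding wedge_power_Suc[of "cone_form C z" "Suc j"] Suc.IH
    unfolding cone_form_def wedge_fadd_left wedge_fadd_right wedge_smul_left wedge_smul_right
      smul_smul smul_fadd swap zero
    by (auto simp: wedge_power_Suc[of _ "Suc j"] smul_def fadd_def fun_eq_iff algebra_simps)
qed

text \<open>Combining the two-term expansion with the trace of \<open>grad_form z\<close>. The sign
  is that of \<open>C - j / n\<close>, which is why \<open>C = m / n\<close> makes all conditions up
  to \<open>j = m\<close> hold.\<close>

lemma cone_form_power_wedge:
  fixes z :: "'n::{finite,linorder} cspace"
  assumes "1 \<le> j" "j \<le> CARD('n)"
  shows "wedge (wedge_power (cone_form C z) j) (wedge_power std_kaehler (CARD('n) - j)) =
    smul (\<lambda>x. of_real ((C * (norm (x - z))\<^sup>2) ^ (j - 1) * (norm (x - z))\<^sup>2 * (C - real j / real CARD('n))))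
      (wedge_power std_kaehler CARD('n))"
proof -
  obtain i where i: "j = Suc i" using assms(1) by (metis Suc_le_D One_nat_def)
  have pow: "wedge (wedge_power std_kaehler (Suc i)) (wedge_power std_kaehler (CARD('n) - Suc i))
      = wedge_power (std_kaehler :: 'n dform) CARD('n)"
    using assms i by (simp add: wedge_power_add)
  have "wedge (wedge (grad_form z) (wedge_power std_kaehler i)) (wedge_power std_kaehler (CARD('n) - Suc i))
      = wedge (grad_form z) (wedge_power std_kaehler (CARD('n) - 1))"
    using assms i by (simp add: wedge_assoc wedge_power_add)
  also note grad_form_wedge_kaehler_power
  finally have grad: "wedge (wedge (grad_form z) (wedge_power std_kaehler i))
      (wedge_power std_kaehler (CARD('n) - Suc i))
      = smul (\<lambda>x. of_real ((norm (x - z))\<^sup>2 / real CARD('n))) (wedge_power std_kaehler CARD('n))" .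
  show ?thesis
    unfolding i cone_form_power wedge_fadd_left wedge_smul_left pow grad smul_smul
    by (auto simp: smul_def fadd_def fun_eq_iff algebra_simps add_divide_distrib)
qed

section \<open>Differentiation of forms\<close>

lemma axis_Basis [simp]: "axis j 1 \<in> (Basis :: 'n::finite cspace set)" "axis j \<i> \<in> (Basis :: 'n cspace set)"
  by (auto simp: Basis_vec_def Basis_complex_def)

definition smooth_coeffs :: "'n::{finite,linorder} dform \<Rightarrow> bool" where
  "smooth_coeffs \<omega> \<longleftrightarrow> (\<forall>I J. smooth_on UNIV (\<lambda>x. \<omega> x I J))"

lemma wirtinger_sum_cmult:
  assumes "\<And>i. i \<in> A \<Longrightarrow> smooth_on UNIV (f i)"
  shows "wirtinger j (\<lambda>x. \<Sum>i\<in>A. c i * f i x) x = (\<Sum>i\<in>A. c i * wirtinger j (f i) x)"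
    "wirtinger_bar j (\<lambda>x. \<Sum>i\<in>A. c i * f i x) x = (\<Sum>i\<in>A. c i * wirtinger_bar j (f i) x)"
proof -
  have D: "dir_deriv v (\<lambda>x. \<Sum>i\<in>A. c i * f i x) x = (\<Sum>i\<in>A. c i * dir_deriv v (f i) x)" for v
  proof -
    have d: "f i differentiable at x" if "i \<in> A" for i
      using smooth_on_differentiable assms that by blast
    then have "(\<lambda>x. c i * f i x) differentiable at x" if "i \<in> A" for i
      using that by (intro differentiable_mult) auto
    then show ?thesis using d by (simp add: dir_deriv_sum dir_deriv_cmult)
  qed
  show "wirtinger j (\<lambda>x. \<Sum>i\<in>A. c i * f i x) x = (\<Sum>i\<in>A. c i * wirtinger j (f i) x)"
    "wirtinger_bar j (\<lambda>x. \<Sum>i\<in>A. c i * f i x) x = (\<Sum>i\<in>A. c i * wirtinger_bar j (f i) x)"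
    unfolding wirtinger_def wirtinger_bar_def D sum_distrib_left sum_subtractf[symmetric]
      sum.distrib[symmetric] sum_divide_distrib
    by (auto intro!: sum.cong simp: field_simps)
qed

lemma smooth_wirtinger:
  assumes "smooth_on UNIV f"
  shows "smooth_on UNIV (wirtinger j f)" "smooth_on UNIV (wirtinger_bar j f)"
proof -
  have D: "smooth_on UNIV (dir_deriv (axis j 1) f)" "smooth_on UNIV (dir_deriv (axis j \<i>) f)"
    by (auto intro!: smooth_on_dir_deriv assms)
  have "smooth_on UNIV (\<lambda>x. (1/2) * (dir_deriv (axis j 1) f x - \<i> * dir_deriv (axis j \<i>) f x))"
    "smooth_on UNIV (\<lambda>x. (1/2) * (dir_deriv (axis j 1) f x + \<i> * dir_deriv (axis j \<i>) f x))"
    by (intro smooth_on_mult smooth_on_diff smooth_on_add smooth_on_const D open_UNIV)+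
  then show "smooth_on UNIV (wirtinger j f)" "smooth_on UNIV (wirtinger_bar j f)"
    by (simp_all add: wirtinger_def [abs_def] wirtinger_bar_def [abs_def])
qed

lemma wirtinger_zero [simp]: "wirtinger j (\<lambda>_. 0) x = 0" "wirtinger_bar j (\<lambda>_. 0) x = 0"
  by (simp_all add: wirtinger_def wirtinger_bar_def)

lemma wirtinger_cmult:
  assumes "smooth_on UNIV f"
  shows "wirtinger j (\<lambda>x. c * f x) x = c * wirtinger j f x"
    "wirtinger_bar j (\<lambda>x. c * f x) x = c * wirtinger_bar j f x"
  using wirtinger_sum_cmult[of "{()}" "\<lambda>_. f" j "\<lambda>_. c"] assms by simp_all

lemma wirtinger_add:
  assumes "smooth_on UNIV f" "smooth_on UNIV g"
  shows "wirtinger j (\<lambda>x. f x + g x) x = wirtinger j f x + wirtinger j g x"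
    "wirtinger_bar j (\<lambda>x. f x + g x) x = wirtinger_bar j f x + wirtinger_bar j g x"
  using wirtinger_sum_cmult[of UNIV "\<lambda>b. if b then f else g" j "\<lambda>_. 1"] assms
  by (simp_all add: UNIV_bool add.commute)

lemma wirtinger_commute:
  assumes "smooth_on UNIV f"
  shows "wirtinger_bar j (wirtinger k f) x = wirtinger k (wirtinger_bar j f) x"
    "wirtinger j (wirtinger k f) x = wirtinger k (wirtinger j f) x"
    "wirtinger_bar j (wirtinger_bar k f) x = wirtinger_bar k (wirtinger_bar j f) x"
proof -
  have D: "smooth_on UNIV (dir_deriv v f)" if "v \<in> Basis" for v
    by (intro smooth_on_dir_deriv assms that)
  have lin: "dir_deriv v (\<lambda>x. (dir_deriv u f x + c * dir_deriv w f x) / 2) x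
      = (dir_deriv v (dir_deriv u f) x + c * dir_deriv v (dir_deriv w f) x) / 2"
    if "u \<in> Basis" "w \<in> Basis" for u w v c
  proof -
    have d: "dir_deriv u f differentiable at x" "dir_deriv w f differentiable at x"
      using smooth_on_differentiable[OF D] that by auto
    then have "(\<lambda>x. c * dir_deriv w f x) differentiable at x" by (intro differentiable_mult) auto
    with d have "(\<lambda>x. dir_deriv u f x + c * dir_deriv w f x) differentiable at x"
      "dir_deriv v (\<lambda>x. dir_deriv u f x + c * dir_deriv w f x) x
        = dir_deriv v (dir_deriv u f) x + c * dir_deriv v (dir_deriv w f) x"
      by (auto intro: differentiable_add simp: dir_deriv_add dir_deriv_cmult)
    then show ?thesis using dir_deriv_cmult[of "\<lambda>x. dir_deriv u f x + c * dir_deriv w f x" x v "1/2"]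
      by simp
  qed
  have W: "wirtinger j f = (\<lambda>x. (dir_deriv (axis j 1) f x + (- \<i>) * dir_deriv (axis j \<i>) f x) / 2)"
    "wirtinger_bar j f = (\<lambda>x. (dir_deriv (axis j 1) f x + \<i> * dir_deriv (axis j \<i>) f x) / 2)" for j
    by (auto simp: wirtinger_def wirtinger_bar_def)
  have W': "wirtinger j g x = (dir_deriv (axis j 1) g x + (- \<i>) * dir_deriv (axis j \<i>) g x) / 2"
    "wirtinger_bar j g x = (dir_deriv (axis j 1) g x + \<i> * dir_deriv (axis j \<i>) g x) / 2" for j g
    by (auto simp: wirtinger_def wirtinger_bar_def)
  have c: "dir_deriv (axis j a) (dir_deriv (axis k b) f) x = dir_deriv (axis k b) (dir_deriv (axis j a) f) x"
    if "a = 1 \<or> a = \<i>" "b = 1 \<or> b = \<i>" for a b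
    using that by (intro dir_deriv_commute assms) auto
  show "wirtinger_bar j (wirtinger k f) x = wirtinger k (wirtinger_bar j f) x"
    "wirtinger j (wirtinger k f) x = wirtinger k (wirtinger j f) x"
    "wirtinger_bar j (wirtinger_bar k f) x = wirtinger_bar k (wirtinger_bar j f) x"
    unfolding W W' by (simp_all only: lin axis_Basis c simp_thms) (simp_all add: field_simps)
qed

definition coeffwise :: "(('n cspace \<Rightarrow> complex) \<Rightarrow> 'n cspace \<Rightarrow> complex) \<Rightarrow>
    'n::{finite,linorder} dform \<Rightarrow> 'n dform" where
  "coeffwise D \<omega> = (\<lambda>x I J. D (\<lambda>u. \<omega> u I J) x)"

lemma del_eq: "del \<omega> = (\<lambda>x I J. \<Sum>j\<in>UNIV. wedge (dz j) (coeffwise (wirtinger j) \<omega>) x I J)"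
  and delbar_eq: "delbar \<omega> = (\<lambda>x I J. \<Sum>j\<in>UNIV. wedge (dzbar j) (coeffwise (wirtinger_bar j) \<omega>) x I J)"
  by (simp_all add: del_def delbar_def coeffwise_def)

definition const_form :: "'n::{finite,linorder} dform \<Rightarrow> bool" where
  "const_form P \<longleftrightarrow> (\<forall>x y. P x = P y)"

lemma wedge_sum_right: "wedge P (\<lambda>x I J. \<Sum>j\<in>S. \<omega> j x I J) = (\<lambda>x I J. \<Sum>j\<in>S. wedge P (\<omega> j) x I J)"
proof (intro ext)
  fix x I J
  define t where "t = (\<lambda>j A B. (-1) ^ (card B * card (I - A)) * shuffle_sign A (I - A)
    * shuffle_sign B (J - B) * P x A B * \<omega> j x (I - A) (J - B))"
  have "(\<Sum>A\<in>Pow I. \<Sum>B\<in>Pow J. \<Sum>j\<in>S. t j A B) = (\<Sum>A\<in>Pow I. \<Sum>j\<in>S. \<Sum>B\<in>Pow J. t j A B)"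
    by (intro sum.cong refl sum.swap)
  also have "\<dots> = (\<Sum>j\<in>S. \<Sum>A\<in>Pow I. \<Sum>B\<in>Pow J. t j A B)" by (rule sum.swap)
  finally show "wedge P (\<lambda>x I J. \<Sum>j\<in>S. \<omega> j x I J) x I J = (\<Sum>j\<in>S. wedge P (\<omega> j) x I J)"
    by (simp add: wedge_def sum_distrib_left t_def)
qed

lemma coeffwise_wedge_const:
  assumes "const_form P" "smooth_coeffs \<omega>"
  shows "coeffwise (wirtinger j) (wedge P \<omega>) = wedge P (coeffwise (wirtinger j) \<omega>)"
    "coeffwise (wirtinger_bar j) (wedge P \<omega>) = wedge P (coeffwise (wirtinger_bar j) \<omega>)"
proof -
  let ?c = "\<lambda>I J (A, B). (-1) ^ (card B * card (I - A)) * shuffle_sign A (I - A)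
    * shuffle_sign B (J - B) * P 0 A B"
  have P: "P x = P 0" for x using assms by (simp add: const_form_def)
  have w: "wedge P \<eta> x I J = (\<Sum>(A, B)\<in>Pow I \<times> Pow J. ?c I J (A, B) * \<eta> x (I - A) (J - B))" for \<eta> x I J
    unfolding wedge_def P[of x] by (simp add: sum.cartesian_product)
  have s: "smooth_on UNIV (\<lambda>x. \<omega> x I J)" for I J using assms(2) by (simp add: smooth_coeffs_def)
  show "coeffwise (wirtinger j) (wedge P \<omega>) = wedge P (coeffwise (wirtinger j) \<omega>)"
    "coeffwise (wirtinger_bar j) (wedge P \<omega>) = wedge P (coeffwise (wirtinger_bar j) \<omega>)"
    unfolding w coeffwise_def fun_eq_iff case_prod_unfold
    using s by (simp_all add: wirtinger_sum_cmult)
qed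

text \<open>An even form commutes past dz_j and dzbar_j without a sign, and constant coefficients
  pass through the Wirtinger derivatives.\<close>

lemma del_wedge_const:
  assumes "const_form P" "even_form P" "smooth_coeffs \<omega>"
  shows "del (wedge P \<omega>) = wedge P (del \<omega>)" "delbar (wedge P \<omega>) = wedge P (delbar \<omega>)"
proof -
  have "wedge \<eta> (wedge P \<zeta>) = wedge P (wedge \<eta> \<zeta>)" for \<eta> \<zeta>
    by (metis wedge_assoc wedge_commute assms(2))
  then show "del (wedge P \<omega>) = wedge P (del \<omega>)" "delbar (wedge P \<omega>) = wedge P (delbar \<omega>)"
    unfolding del_eq delbar_eq wedge_sum_right coeffwise_wedge_const[OF assms(1,3)] by simp_all
qed

lemma smooth_coeffs_wedge:
  assumes "smooth_coeffs \<omega>" "smooth_coeffs \<eta>"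
  shows "smooth_coeffs (wedge \<omega> \<eta>)"
  using assms unfolding smooth_coeffs_def wedge_def
  by (auto intro!: smooth_on_sum smooth_on_mult)

lemma smooth_coeffs_const: "const_form P \<Longrightarrow> smooth_coeffs P"
  unfolding smooth_coeffs_def
proof (intro allI)
  fix I J assume "const_form P"
  then have "(\<lambda>x. P x I J) = (\<lambda>x. P 0 I J)" by (auto simp: const_form_def fun_eq_iff)
  then show "smooth_on UNIV (\<lambda>x. P x I J)" by simp
qed

lemma const_form_dz: "const_form (dz j)" "const_form (dzbar j)"
  by (simp_all add: const_form_def dz_def dzbar_def)

lemma smooth_coeffs_del:
  assumes "smooth_coeffs \<omega>"
  shows "smooth_coeffs (del \<omega>)" "smooth_coeffs (delbar \<omega>)"
proof -
  have "smooth_coeffs (coeffwise (wirtinger j) \<omega>)" "smooth_coeffs (coeffwise (wirtinger_bar j) \<omega>)" for j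
    using assms by (auto simp: smooth_coeffs_def coeffwise_def intro!: smooth_wirtinger)
  then have *: "smooth_coeffs (wedge (dz j) (coeffwise (wirtinger j) \<omega>))"
    "smooth_coeffs (wedge (dzbar j) (coeffwise (wirtinger_bar j) \<omega>))" for j
    by (auto intro!: smooth_coeffs_wedge[OF smooth_coeffs_const[OF const_form_dz(1)]]
        smooth_coeffs_wedge[OF smooth_coeffs_const[OF const_form_dz(2)]])
  show "smooth_coeffs (del \<omega>)" "smooth_coeffs (delbar \<omega>)"
    unfolding del_eq delbar_eq smooth_coeffs_def
    using * by (auto intro!: smooth_on_sum simp: smooth_coeffs_def)
qed

lemma ext_dc_eq: "ext_dc \<omega> = smul (\<lambda>_. \<i> / (4 * of_real pi)) (fadd (delbar \<omega>) (smul (\<lambda>_. -1) (del \<omega>)))"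
  and ext_d_eq: "ext_d \<omega> = fadd (del \<omega>) (delbar \<omega>)"
  by (auto simp: ext_dc_def ext_d_def smul_def fadd_def fun_eq_iff)

lemma smooth_coeffs_ext_dc:
  assumes "smooth_coeffs \<omega>"
  shows "smooth_coeffs (ext_dc \<omega>)"
  unfolding ext_dc_def smooth_coeffs_def
proof (intro allI)
  fix I J
  show "smooth_on UNIV (\<lambda>x. \<i> / (4 * of_real pi) * (delbar \<omega> x I J - del \<omega> x I J))"
    using smooth_coeffs_del[OF assms] unfolding smooth_coeffs_def
    by (intro smooth_on_mult smooth_on_diff smooth_on_const open_UNIV) auto
qed

text \<open>This stands in for the Leibniz rule together with the closedness of \<beta>: powers of
  \<beta> are pulled out of dd^c.\<close>

lemma ddc_wedge_const:
  assumes "const_form P" "even_form P" "smooth_coeffs \<omega>"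
  shows "ddc (wedge P \<omega>) = wedge P (ddc \<omega>)"
proof -
  have "ext_dc (wedge P \<omega>) = wedge P (ext_dc \<omega>)"
    unfolding ext_dc_eq wedge_smul_right wedge_fadd_right del_wedge_const[OF assms] ..
  then show ?thesis
    unfolding ddc_def ext_d_eq
    by (simp add: wedge_fadd_right del_wedge_const[OF assms(1,2) smooth_coeffs_ext_dc[OF assms(3)]])
qed

section \<open>Coefficients of the differential operators, and dd^c of a function\<close>

lemma wedge_dz:
  "wedge (dz j) \<eta> x I J = (if j \<in> I then shuffle_sign {j} (I - {j}) * \<eta> x (I - {j}) J else 0)"
proof -
  let ?t = "\<lambda>A B. (-1) ^ (card B * card (I - A)) * shuffle_sign A (I - A) * shuffle_sign B (J - B)
       * dz j x A B * \<eta> x (I - A) (J - B)"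
  have "(\<Sum>A\<in>Pow I. \<Sum>B\<in>Pow J. ?t A B) = (\<Sum>A\<in>Pow I. ?t A {})"
    by (intro sum.cong refl sum_eq_single) (auto simp: dz_def)
  also have "\<dots> = (if j \<in> I then ?t {j} {} else 0)"
  proof (cases "j \<in> I")
    case True
    then have "(\<Sum>A\<in>Pow I. ?t A {}) = ?t {j} {}"
      by (intro sum_eq_single) (auto simp: dz_def)
    then show ?thesis using True by simp
  qed (auto simp: dz_def intro!: sum.neutral)
  finally show ?thesis by (simp add: wedge_def dz_def)
qed

lemma wedge_dzbar:
  "wedge (dzbar j) \<eta> x I J =
    (if j \<in> J then (-1) ^ card I * shuffle_sign {j} (J - {j}) * \<eta> x I (J - {j}) else 0)"
proof -
  let ?t = "\<lambda>A B. (-1) ^ (card B * card (I - A)) * shuffle_sign A (I - A) * shuffle_sign B (J - B)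
       * dzbar j x A B * \<eta> x (I - A) (J - B)"
  have "(\<Sum>A\<in>Pow I. \<Sum>B\<in>Pow J. ?t A B) = (\<Sum>B\<in>Pow J. ?t {} B)"
    by (intro sum_eq_single) (auto simp: dzbar_def intro!: sum.neutral)
  also have "\<dots> = (if j \<in> J then ?t {} {j} else 0)"
  proof (cases "j \<in> J")
    case True
    then have "(\<Sum>B\<in>Pow J. ?t {} B) = ?t {} {j}"
      by (intro sum_eq_single) (auto simp: dzbar_def)
    then show ?thesis using True by simp
  qed (auto simp: dzbar_def intro!: sum.neutral)
  finally show ?thesis by (simp add: wedge_def dzbar_def)
qed

lemma del_coeff: "del \<omega> x I J = (\<Sum>j\<in>I. shuffle_sign {j} (I - {j}) * wirtinger j (\<lambda>u. \<omega> u (I - {j}) J) x)"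
proof -
  have "(\<Sum>j\<in>I. shuffle_sign {j} (I - {j}) * wirtinger j (\<lambda>u. \<omega> u (I - {j}) J) x)
    = (\<Sum>j\<in>UNIV. if j \<in> I then shuffle_sign {j} (I - {j}) * wirtinger j (\<lambda>u. \<omega> u (I - {j}) J) x else 0)"
    by (simp add: sum.If_cases)
  then show ?thesis by (simp add: del_eq wedge_dz coeffwise_def)
qed

lemma delbar_coeff: "delbar \<omega> x I J =
  (\<Sum>j\<in>J. (-1) ^ card I * shuffle_sign {j} (J - {j}) * wirtinger_bar j (\<lambda>u. \<omega> u I (J - {j})) x)"
proof -
  have "(\<Sum>j\<in>J. (-1) ^ card I * shuffle_sign {j} (J - {j}) * wirtinger_bar j (\<lambda>u. \<omega> u I (J - {j})) x)
    = (\<Sum>j\<in>UNIV. if j \<in> J then (-1) ^ card I * shuffle_sign {j} (J - {j}) * wirtinger_bar j (\<lambda>u. \<omega> u I (J - {j})) x else 0)"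
    by (simp add: sum.If_cases)
  then show ?thesis by (simp add: delbar_eq wedge_dzbar coeffwise_def)
qed

lemma ext_dc_form0:
  "ext_dc (form0 f) x I J =
    (if I = {} \<and> card J = 1 then \<i> / (4 * of_real pi) * wirtinger_bar (the_elem J) f x
     else if card I = 1 \<and> J = {} then - (\<i> / (4 * of_real pi) * wirtinger (the_elem I) f x) else 0)"
proof -
  have del: "del (form0 f) x I J = (if card I = 1 \<and> J = {} then wirtinger (the_elem I) f x else 0)"
  proof (cases "card I = 1")
    case True
    then obtain a where "I = {a}" by (auto simp: card_1_singleton_iff)
    then show ?thesis by (simp add: del_coeff form0_def)
  next
    case False
    then have "I - {j} \<noteq> {}" if "j \<in> I" for j using that by (auto simp: card_1_singleton_iff)
    then have "(\<lambda>u. form0 f u (I - {j}) J) = (\<lambda>_. 0)" if "j \<in> I" for j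
      using that by (auto simp: form0_def)
    then show ?thesis using False by (simp add: del_coeff)
  qed
  have delbar: "delbar (form0 f) x I J = (if I = {} \<and> card J = 1 then wirtinger_bar (the_elem J) f x else 0)"
  proof (cases "card J = 1")
    case True
    then obtain a where "J = {a}" by (auto simp: card_1_singleton_iff)
    then show ?thesis by (simp add: delbar_coeff form0_def)
  next
    case False
    then have "J - {j} \<noteq> {}" if "j \<in> J" for j using that by (auto simp: card_1_singleton_iff)
    then have "(\<lambda>u. form0 f u I (J - {j})) = (\<lambda>_. 0)" if "j \<in> J" for j
      using that by (auto simp: form0_def)
    then show ?thesis using False by (simp add: delbar_coeff)
  qed
  show ?thesis by (auto simp: ext_dc_def del delbar)
qed

text \<open>The parts of bidegree (2,0) and (0,2) cancel because second derivatives are symmetric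
  and shuffle signs are antisymmetric. In bidegree (1,1), the del of the (0,1)-part of d^c f and the
  delbar of its (1,0)-part contribute equally, which doubles i/(4 pi) to \<open>kc\<close>.\<close>

lemma ddc_form0:
  fixes f :: "'n::{finite,linorder} cspace \<Rightarrow> complex"
  assumes f: "smooth_on UNIV f"
  shows "ddc (form0 f) = one_one (\<lambda>x a b. kc * wirtinger a (wirtinger_bar b f) x)"
proof (intro ext)
  fix x :: "'n cspace" and I J :: "'n set"
  define c :: complex where "c = \<i> / (4 * of_real pi)"
  have kc: "kc = 2 * c" by (simp add: c_def)
  let ?\<theta> = "ext_dc (form0 f)"
  note W = wirtinger_cmult[OF smooth_wirtinger(1)[OF f]] wirtinger_cmult[OF smooth_wirtinger(2)[OF f]]
  note Wm = W[where c = "- c", simplified]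
  have \<theta>: "?\<theta> u A B = (if A = {} \<and> card B = 1 then c * wirtinger_bar (the_elem B) f u
     else if card A = 1 \<and> B = {} then (- c) * wirtinger (the_elem A) f u else 0)" for u A B
    unfolding ext_dc_form0 c_def by simp
  consider (one) "card I = 1" "card J = 1" | (two) "card I = 2" "J = {}" | (bar) "I = {}" "card J = 2"
    | (other) "card I + card J \<noteq> 2"
    by (cases "card I = 1"; cases "card I = 0"; cases "card J = 0"; cases "card I = 2") (auto simp: card_eq_0_iff)
  then show "ddc (form0 f) x I J = one_one (\<lambda>x a b. kc * wirtinger a (wirtinger_bar b f) x) x I J"
  proof cases
    case one
    then obtain a b where [simp]: "I = {a}" "J = {b}" by (auto simp: card_1_singleton_iff)
    show ?thesis
      by (simp add: ddc_def ext_d_def del_coeff delbar_coeff \<theta> one_one_def kc W Wm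
          wirtinger_commute(1)[OF f])
  next
    case two
    then obtain p q where I: "I = {p, q}" "p \<noteq> q" by (auto simp: card_2_iff)
    then have *: "I - {p} = {q}" "I - {q} = {p}" by auto
    have sumI: "(\<Sum>j\<in>I. F j) = F p + F q" for F :: "'n \<Rightarrow> complex" using I by simp
    have "shuffle_sign {q} {p} = - shuffle_sign {p} {q}"
      using shuffle_sign_swap[of "{q}" "{p}"] I by simp
    moreover have "del ?\<theta> x I J = shuffle_sign {p} {q} * wirtinger p (\<lambda>u. ?\<theta> u {q} {}) x
        + shuffle_sign {q} {p} * wirtinger q (\<lambda>u. ?\<theta> u {p} {}) x"
      unfolding del_coeff sumI * by (simp add: two)
    ultimately show ?thesis
      using two by (simp add: ddc_def ext_d_def delbar_coeff \<theta> one_one_def W Wm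
          wirtinger_commute(2)[OF f, of p q])
  next
    case bar
    then obtain p q where J: "J = {p, q}" "p \<noteq> q" by (auto simp: card_2_iff)
    then have *: "J - {p} = {q}" "J - {q} = {p}" by auto
    have sumJ: "(\<Sum>j\<in>J. F j) = F p + F q" for F :: "'n \<Rightarrow> complex" using J by simp
    have "shuffle_sign {q} {p} = - shuffle_sign {p} {q}"
      using shuffle_sign_swap[of "{q}" "{p}"] J by simp
    moreover have "delbar ?\<theta> x I J = shuffle_sign {p} {q} * wirtinger_bar p (\<lambda>u. ?\<theta> u {} {q}) x
        + shuffle_sign {q} {p} * wirtinger_bar q (\<lambda>u. ?\<theta> u {} {p}) x"
      unfolding delbar_coeff sumJ * by (simp add: bar)
    ultimately show ?thesis
      using bar by (simp add: ddc_def ext_d_def del_coeff \<theta> one_one_def W Wm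
          wirtinger_commute(3)[OF f, of p q])
  next
    case other
    have zero: "?\<theta> u A B = 0" if "card A + card B \<noteq> 1" for u A B
      using that by (auto simp: \<theta>)
    have "(\<lambda>u. ?\<theta> u (I - {j}) J) = (\<lambda>_. 0)" if "j \<in> I" for j
      using that other card_Suc_Diff1[OF finite that] by (intro ext zero) auto
    moreover have "(\<lambda>u. ?\<theta> u I (J - {j})) = (\<lambda>_. 0)" if "j \<in> J" for j
      using that other card_Suc_Diff1[OF finite that] by (intro ext zero) auto
    ultimately show ?thesis
      using other by (auto simp: ddc_def ext_d_def del_coeff delbar_coeff one_one_def)
  qed
qed

text \<open>The chain rule g'(\<phi>) dd^c\<phi> + g''(\<phi>) d\<phi> \<and> d^c\<phi>. Because of
  it, radial test functions reduce the whole argument to the algebra generated by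
  \<open>std_kaehler\<close> and \<open>grad_form z\<close>.\<close>

lemma ddc_radial:
  fixes z :: "'n::{finite,linorder} cspace" and g g' g'' :: "real \<Rightarrow> real"
  assumes g: "smooth_on UNIV g" and g': "smooth_on UNIV g'"
    and D: "\<And>t. (g has_real_derivative g' t) (at t)" "\<And>t. (g' has_real_derivative g'' t) (at t)"
  shows "ddc (form0 (\<lambda>x. of_real (g ((norm (x - z))\<^sup>2)))) =
    fadd (smul (\<lambda>x. of_real (g' ((norm (x - z))\<^sup>2))) std_kaehler)
      (smul (\<lambda>x. of_real (g'' ((norm (x - z))\<^sup>2))) (grad_form z))"
proof -
  let ?\<phi> = "\<lambda>x. (norm (x - z))\<^sup>2"
  have \<phi>: "(?\<phi> has_derivative (\<lambda>v. 2 * ((x - z) \<bullet> v))) (at x)" for x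
    unfolding power2_norm_eq_inner by (auto intro!: derivative_eq_intros simp: inner_commute)
  have comp: "((\<lambda>x. complex_of_real (h (?\<phi> x))) has_derivative (\<lambda>v. of_real (2 * h' (?\<phi> x) * ((x - z) \<bullet> v)))) (at x)"
    if "\<And>t. (h has_real_derivative h' t) (at t)" for h h' x
  proof -
    have "((\<lambda>x. h (?\<phi> x)) has_derivative (\<lambda>v. h' (?\<phi> x) * (2 * ((x - z) \<bullet> v)))) (at x)"
      using has_derivative_compose[OF \<phi> that[unfolded has_field_derivative_def]] .
    from has_derivative_of_real[OF this, where 'a = complex] show ?thesis
      by (simp add: algebra_simps)
  qed
  have inner: "v \<bullet> axis j 1 = Re (v $ j)" "v \<bullet> axis j \<i> = Im (v $ j)" for v :: "'n cspace" and j
    by (simp_all add: inner_axis complex_inner_1_right complex_inner_i_right)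
  have wbar: "wirtinger_bar b (\<lambda>x. complex_of_real (h (?\<phi> x))) x = of_real (h' (?\<phi> x)) * (x - z) $ b"
    and w: "wirtinger b (\<lambda>x. complex_of_real (h (?\<phi> x))) x = of_real (h' (?\<phi> x)) * cnj ((x - z) $ b)"
    if "\<And>t. (h has_real_derivative h' t) (at t)" for h h' b x
    unfolding wirtinger_bar_def wirtinger_def dir_deriv_eq[OF comp[OF that]] inner
    by (simp_all add: complex_eq_iff field_simps)
  have coord: "((\<lambda>x. (x - z) $ b) has_derivative (\<lambda>v. v $ b)) (at x)" for b x
    by (auto intro!: derivative_eq_intros bounded_linear_imp_has_derivative bounded_linear_vec_nth)
  have "wirtinger a (wirtinger_bar b (\<lambda>x. complex_of_real (g (?\<phi> x)))) x
      = of_real (g' (?\<phi> x)) * (if a = b then 1 else 0) + of_real (g'' (?\<phi> x)) * cnj ((x - z) $ a) * (x - z) $ b"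
    for a b x
  proof -
    let ?u = "\<lambda>x. complex_of_real (g' (?\<phi> x))" and ?v = "\<lambda>x. (x - z) $ b"
    have d: "?u differentiable at x" "?v differentiable at x"
      using comp[OF D(2)] coord by (auto simp: differentiable_def)
    have "wirtinger a (\<lambda>x. ?u x * ?v x) x = ?u x * wirtinger a ?v x + wirtinger a ?u x * ?v x"
      unfolding wirtinger_def dir_deriv_mult[OF d] by (simp add: field_simps)
    moreover have "wirtinger a ?v x = (if a = b then 1 else 0)"
      unfolding wirtinger_def dir_deriv_eq[OF coord] by (simp add: axis_def)
    ultimately show ?thesis unfolding wbar[OF D(1)] by (simp add: w[OF D(2)])
  qed
  note second = this
  have "smooth_on UNIV (\<lambda>x. complex_of_real (g (?\<phi> x)))"
    by (intro smooth_on_compose_linear[OF open_UNIV bounded_linear_of_real]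
        smooth_on_compose[OF open_UNIV g] smooth_on_norm_square open_UNIV) simp
  note ddc_form0[OF this]
  also have "one_one (\<lambda>x a b. kc * wirtinger a (wirtinger_bar b (\<lambda>x. complex_of_real (g (?\<phi> x)))) x)
      = fadd (smul (\<lambda>x. of_real (g' (?\<phi> x))) std_kaehler) (smul (\<lambda>x. of_real (g'' (?\<phi> x))) (grad_form z))"
    unfolding second std_kaehler_def grad_form_def smul_one_one fadd_one_one
    by (rule arg_cong[of _ _ one_one]) (auto simp: fun_eq_iff distrib_left ac_simps)
  finally show ?thesis .
qed

lemma kaehler_eq: "kaehler = std_kaehler"
proof -
  have "kaehler = ddc (form0 (\<lambda>x. of_real ((\<lambda>t. t) ((norm (x - 0))\<^sup>2))))"
    by (simp add: kaehler_def)
  also have "\<dots> = std_kaehler"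
    by (subst ddc_radial[where g' = "\<lambda>_. 1" and g'' = "\<lambda>_. 0"])
      (auto intro!: smooth_on_bounded_linear bounded_linear_ident simp: fadd_smul_cancel)
  finally show ?thesis .
qed

section \<open>Currents of order zero\<close>

lemma bideg_on_wedge:
  assumes "bideg_on UNIV a b \<omega>" "bideg_on UNIV c d \<eta>"
  shows "bideg_on UNIV (a + c) (b + d) (wedge \<omega> \<eta>)"
  unfolding bideg_on_def
proof (intro ballI allI impI)
  fix x I J assume "wedge \<omega> \<eta> x I J \<noteq> 0"
  then obtain A B where *: "A \<subseteq> I" "B \<subseteq> J" "\<omega> x A B \<noteq> 0" "\<eta> x (I - A) (J - B) \<noteq> 0"
    unfolding wedge_def by (fastforce elim!: sum.not_neutral_contains_not_neutral)
  then have "card A = a" "card B = b" "card (I - A) = c" "card (J - B) = d"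
    using assms by (auto simp: bideg_on_def)
  then show "card I = a + c \<and> card J = b + d"
    using * card_mono[OF finite *(1)] card_mono[OF finite *(2)] by (auto simp: card_Diff_subset)
qed

lemma bideg_on_kaehler_power: "bideg_on UNIV q q (wedge_power std_kaehler q)"
  by (auto simp: bideg_on_def std_kaehler_power split: if_splits)

lemma bideg_on_one_one: "bideg_on S 1 1 (one_one h)"
  by (auto simp: bideg_on_def one_one_def split: if_splits)

lemma bideg_on_cone_form: "bideg_on S 1 1 (cone_form C z)"
  by (simp only: cone_form_def std_kaehler_def grad_form_def smul_one_one fadd_one_one bideg_on_one_one)

lemma bideg_on_wedge_power: "bideg_on UNIV 1 1 \<omega> \<Longrightarrow> bideg_on UNIV q q (wedge_power \<omega> q)"
proof (induction q)
  case 0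
  then show ?case by (auto simp: bideg_on_def wedge_power_0 form0_def split: if_splits)
next
  case (Suc q)
  then show ?case using bideg_on_wedge[of 1 1 \<omega> q q] by (simp add: wedge_power_Suc)
qed

lemma bideg_on_smul: "bideg_on S a b \<omega> \<Longrightarrow> bideg_on S a b (smul f \<omega>)"
  by (auto simp: bideg_on_def smul_def)

lemma smooth_coeffs_smul: "smooth_on UNIV f \<Longrightarrow> smooth_coeffs \<omega> \<Longrightarrow> smooth_coeffs (smul f \<omega>)"
  by (simp add: smooth_coeffs_def smul_def smooth_on_mult)

lemma smooth_coeffs_fadd: "smooth_coeffs \<omega> \<Longrightarrow> smooth_coeffs \<eta> \<Longrightarrow> smooth_coeffs (fadd \<omega> \<eta>)"
  by (simp add: smooth_coeffs_def fadd_def smooth_on_add)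

lemma smooth_coeffs_form0:
  fixes f :: "'n::{finite,linorder} cspace \<Rightarrow> complex"
  assumes "smooth_on UNIV f"
  shows "smooth_coeffs (form0 f)"
  unfolding smooth_coeffs_def
proof (intro allI)
  fix I J :: "'n set"
  show "smooth_on UNIV (\<lambda>x. form0 f x I J)"
  proof (cases "I = {} \<and> J = {}")
    case True
    then show ?thesis using assms by (simp add: form0_def)
  next
    case False
    then have "(\<lambda>x. form0 f x I J) = (\<lambda>_. 0)" by (auto simp: form0_def)
    then show ?thesis by simp
  qed
qed

lemma const_kaehler: "const_form (wedge_power std_kaehler q)"
  by (simp add: const_form_def std_kaehler_power fun_eq_iff)

lemma const_std_kaehler: "const_form std_kaehler"
  by (simp add: const_form_def std_kaehler_def one_one_def fun_eq_iff)

lemma smooth_on_of_real: "smooth_on S f \<Longrightarrow> open S \<Longrightarrow> smooth_on S (\<lambda>x. complex_of_real (f x))"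
  by (rule smooth_on_compose_linear[OF _ bounded_linear_of_real])

lemma smooth_coeffs_grad: "smooth_coeffs (grad_form z)"
proof -
  have c: "smooth_on UNIV (\<lambda>x. (x - z) $ b)" "smooth_on UNIV (\<lambda>x. cnj ((x - z) $ b))" for b
  proof -
    show *: "smooth_on UNIV (\<lambda>x. (x - z) $ b)"
      using smooth_on_diff[OF open_UNIV smooth_on_bounded_linear[OF open_UNIV bounded_linear_vec_nth]
          smooth_on_const[OF open_UNIV]] by simp
    show "smooth_on UNIV (\<lambda>x. cnj ((x - z) $ b))"
      by (rule smooth_on_compose_linear[OF open_UNIV bounded_linear_cnj *])
  qed
  show ?thesis
    unfolding smooth_coeffs_def
  proof (intro allI)
    fix I J
    show "smooth_on UNIV (\<lambda>x. grad_form z x I J)"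
    proof (cases "card I = 1 \<and> card J = 1")
      case True
      have "smooth_on UNIV (\<lambda>x. kc * cnj ((x - z) $ the_elem I) * (x - z) $ the_elem J)"
        by (intro smooth_on_mult smooth_on_const c open_UNIV)
      then show ?thesis using True by (simp add: grad_form_def one_one_def)
    qed (auto simp: grad_form_def one_one_def)
  qed
qed

lemma smooth_coeffs_cone: "smooth_coeffs (cone_form C z)"
proof -
  have "smooth_on UNIV (\<lambda>x. complex_of_real (C * (norm (x - z))\<^sup>2))"
    by (intro smooth_on_of_real smooth_on_mult smooth_on_const smooth_on_norm_square open_UNIV)
  then show ?thesis
    unfolding cone_form_def
    by (intro smooth_coeffs_fadd smooth_coeffs_smul smooth_on_const open_UNIV smooth_coeffs_grad
        smooth_coeffs_const const_std_kaehler)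
qed

lemma smooth_coeffs_power: "smooth_coeffs \<omega> \<Longrightarrow> smooth_coeffs (wedge_power \<omega> q)"
  by (induction q) (auto simp: wedge_power_0 wedge_power_Suc smooth_coeffs_form0 smooth_coeffs_wedge)

lemma test_form_smul:
  assumes "test_fun S f" "smooth_coeffs \<omega>" "bideg_on UNIV q q \<omega>"
  shows "test_form S q (smul (\<lambda>x. of_real (f x)) \<omega>)"
proof -
  obtain K where K: "compact K" "K \<subseteq> S" "\<And>x. x \<notin> K \<Longrightarrow> f x = 0"
    using assms(1) by (auto simp: test_fun_def)
  have "smooth_coeffs (smul (\<lambda>x. of_real (f x)) \<omega>)"
    using assms by (intro smooth_coeffs_smul smooth_on_of_real test_funD) auto
  then show ?thesis
    unfolding test_form_def test_form_in_def smooth_form_on_def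
    using K bideg_on_smul[OF assms(3)] by (auto simp: smooth_coeffs_def smul_def intro!: exI[of _ K])
qed

lemma test_form_form0:
  fixes f :: "'n::{finite,linorder} cspace \<Rightarrow> real"
  assumes "test_fun S f"
  shows "test_form S 0 (form0 (\<lambda>x. of_real (f x)))"
proof -
  have "form0 (\<lambda>x. of_real (f x)) = smul (\<lambda>x. of_real (f x)) (form0 (\<lambda>_. 1))"
    by (auto simp: smul_def form0_def fun_eq_iff)
  moreover have "bideg_on UNIV 0 0 (form0 (\<lambda>_. 1) :: 'n dform)"
    by (auto simp: bideg_on_def form0_def split: if_splits)
  ultimately show ?thesis using assms by (simp add: test_form_smul smooth_coeffs_form0)
qed

lemma test_form_0E:
  fixes \<phi> :: "'n::{finite,linorder} dform"
  assumes "test_form S 0 \<phi>"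
  obtains f K where "\<phi> = form0 f" "smooth_on UNIV f" "compact K" "K \<subseteq> S" "\<And>x. x \<notin> K \<Longrightarrow> f x = 0"
proof -
  obtain K where K: "compact K" "K \<subseteq> S" "smooth_form_on UNIV \<phi>" "bideg_on UNIV 0 0 \<phi>"
    "\<And>x I J. x \<notin> K \<Longrightarrow> \<phi> x I J = 0"
    using assms by (auto simp: test_form_def test_form_in_def)
  have "\<phi> x I J = 0" if "\<not> (I = {} \<and> J = {})" for x I J
    using K(4) that by (auto simp: bideg_on_def)
  then have "\<phi> = form0 (\<lambda>x. \<phi> x {} {})" by (auto simp: form0_def fun_eq_iff)
  with K show ?thesis by (intro that[of "\<lambda>x. \<phi> x {} {}" K]) (auto simp: smooth_form_on_def)
qed

lemma test_form_smul_const: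
  assumes "test_form S q \<phi>"
  shows "test_form S q (smul (\<lambda>_. c) \<phi>)"
  using assms
  by (auto simp: test_form_def test_form_in_def smooth_form_on_def bideg_on_def smul_def
      intro!: smooth_on_mult)

lemma test_form_0_cases:
  assumes "test_form S 0 \<phi>"
  obtains u v where "test_fun S u" "test_fun S v"
    "\<phi> = fadd (form0 (\<lambda>x. of_real (u x))) (smul (\<lambda>_. \<i>) (form0 (\<lambda>x. of_real (v x))))"
proof -
  obtain f K where f: "\<phi> = form0 f" "smooth_on UNIV f" "compact K" "K \<subseteq> S" "\<And>x. x \<notin> K \<Longrightarrow> f x = 0"
    using test_form_0E[OF assms] by metis
  then have "test_fun S (\<lambda>x. Re (f x))" "test_fun S (\<lambda>x. Im (f x))"
    unfolding test_fun_def
    by (auto intro!: smooth_on_compose_linear[OF _ bounded_linear_Re] smooth_on_compose_linear[OF _ bounded_linear_Im])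
  then show ?thesis
    by (rule that) (auto simp: f(1) fadd_def smul_def form0_def fun_eq_iff complex_eq_iff)
qed

text \<open>Positivity makes \<open>R\<close> real on all real test functions, since these are
  differences of nonnegative ones; Riesz representation then applies to the real part. A general
  test form of bidegree (0,0) is treated through its real and imaginary parts.\<close>

lemma positive_current_measure:
  fixes R :: "'n::{finite,linorder} current"
  assumes "open \<Omega>"
    and add: "\<And>f g. test_form \<Omega> 0 f \<Longrightarrow> test_form \<Omega> 0 g \<Longrightarrow> R (fadd f g) = R f + R g"
    and scale: "\<And>f c. test_form \<Omega> 0 f \<Longrightarrow> R (smul (\<lambda>_. c) f) = c * R f"
    and pos: "\<And>f. test_fun \<Omega> f \<Longrightarrow> (\<And>x. 0 \<le> f x) \<Longrightarrow> \<exists>c\<ge>0. R (form0 (\<lambda>x. of_real (f x))) = of_real c"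
  obtains \<mu> where "radon_on \<Omega> \<mu>" "\<And>f. test_fun \<Omega> f \<Longrightarrow> integrable \<mu> f"
    "\<And>f. test_fun \<Omega> f \<Longrightarrow> R (form0 (\<lambda>x. of_real (f x))) = of_real (integral\<^sup>L \<mu> f)"
    "\<And>\<phi>. test_form \<Omega> 0 \<phi> \<Longrightarrow> R \<phi> = integral\<^sup>L \<mu> (\<lambda>x. \<phi> x {} {})"
proof -
  let ?F = "\<lambda>f. form0 (\<lambda>x. complex_of_real (f x)) :: 'n dform"
  have F_add: "?F (\<lambda>x. f x + g x) = fadd (?F f) (?F g)" for f g
    by (auto simp: form0_def fadd_def fun_eq_iff)
  have F_scale: "?F (\<lambda>x. c * f x) = smul (\<lambda>_. of_real c) (?F f)" for f c
    by (auto simp: form0_def smul_def fun_eq_iff)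
  have Radd: "R (?F (\<lambda>x. f x + g x)) = R (?F f) + R (?F g)" if "test_fun \<Omega> f" "test_fun \<Omega> g" for f g
    unfolding F_add using that by (intro add test_form_form0)
  have real: "R (?F f) = of_real (Re (R (?F f)))" if f: "test_fun \<Omega> f" for f
  proof -
    obtain g where g: "test_fun \<Omega> g" "\<And>x. 0 \<le> g x" "\<And>x. 0 \<le> f x + g x"
      using test_fun_add_nonneg[OF assms(1) f] by blast
    obtain c d where "R (?F (\<lambda>x. f x + g x)) = of_real c" "R (?F g) = of_real d"
      using pos[OF g(1,2)] pos[OF test_fun_add[OF f g(1)] g(3)] by auto
    then have "R (?F f) = of_real (c - d)" using Radd[OF f g(1)] by simp
    then show ?thesis by simp
  qed
  obtain \<mu> where \<mu>: "sets \<mu> = sets borel" "\<And>K. compact K \<Longrightarrow> K \<subseteq> \<Omega> \<Longrightarrow> emeasure \<mu> K < \<infinity>"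
    "\<And>f. test_fun \<Omega> f \<Longrightarrow> integrable \<mu> f" "\<And>f. test_fun \<Omega> f \<Longrightarrow> integral\<^sup>L \<mu> f = Re (R (?F f))"
  proof (rule riesz_representation[OF assms(1), of "\<lambda>f. Re (R (?F f))"])
    show "Re (R (?F (\<lambda>x. f x + g x))) = Re (R (?F f)) + Re (R (?F g))"
      if "test_fun \<Omega> f" "test_fun \<Omega> g" for f g
      using Radd[OF that] by simp
    show "Re (R (?F (\<lambda>x. c * f x))) = c * Re (R (?F f))" if "test_fun \<Omega> f" for f c
      unfolding F_scale scale[OF test_form_form0[OF that]] by simp
    show "0 \<le> Re (R (?F f))" if "test_fun \<Omega> f" "\<And>x. 0 \<le> f x" for f
      using pos[OF that] by auto
  qed (rule that)
  have R: "R (?F f) = of_real (integral\<^sup>L \<mu> f)" if "test_fun \<Omega> f" for f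
    using real[OF that] \<mu>(4)[OF that] by simp
  show ?thesis
  proof (rule that[OF _ \<mu>(3) R])
    show "radon_on \<Omega> \<mu>" using \<mu> by (auto simp: radon_on_def)
    show "R \<phi> = integral\<^sup>L \<mu> (\<lambda>x. \<phi> x {} {})" if \<phi>: "test_form \<Omega> 0 \<phi>" for \<phi>
    proof -
      obtain u v where uv: "test_fun \<Omega> u" "test_fun \<Omega> v" "\<phi> = fadd (?F u) (smul (\<lambda>_. \<i>) (?F v))"
        using test_form_0_cases[OF \<phi>] by blast
      have t: "test_form \<Omega> 0 (smul (\<lambda>_. \<i>) (?F v))"
        by (intro test_form_smul_const test_form_form0 uv)
      have "R \<phi> = of_real (integral\<^sup>L \<mu> u) + \<i> * of_real (integral\<^sup>L \<mu> v)"
        unfolding uv(3) add[OF test_form_form0[OF uv(1)] t] scale[OF test_form_form0[OF uv(2)]]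
        by (simp add: R uv)
      moreover have "integral\<^sup>L \<mu> (\<lambda>x. complex_of_real (u x) + \<i> * complex_of_real (v x))
          = of_real (integral\<^sup>L \<mu> u) + \<i> * of_real (integral\<^sup>L \<mu> v)"
        using \<mu>(3)[OF uv(1)] \<mu>(3)[OF uv(2)] by simp
      ultimately show ?thesis by (simp add: uv(3) fadd_def smul_def form0_def)
    qed
  qed auto
qed

text \<open>The definite description in \<open>current_integral\<close> needs uniqueness. For every
  representing pair of measures, the difference of the masses of the ball is the limit of
  \<open>R\<close> along the same sequence of test functions, so it depends on \<open>R\<close>
  alone.\<close>

lemma current_integral_ball:
  fixes R :: "'n::{finite,linorder} current"
  assumes "radon_on \<Omega> \<mu>" "radon_on \<Omega> \<nu>" "cball a r \<subseteq> \<Omega>"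
    and R: "\<And>\<phi>. test_form \<Omega> 0 \<phi> \<Longrightarrow>
      R \<phi> = integral\<^sup>L \<mu> (\<lambda>x. \<phi> x {} {}) - integral\<^sup>L \<nu> (\<lambda>x. \<phi> x {} {})"
  shows "current_integral \<Omega> R (ball a r) = measure \<mu> (ball a r) - measure \<nu> (ball a r)"
proof -
  obtain f :: "nat \<Rightarrow> 'n cspace \<Rightarrow> real" where f: "\<And>j. test_fun \<Omega> (f j)"
    "\<And>j x. 0 \<le> f j x" "\<And>j x. f j x \<le> 1" "\<And>j x. x \<notin> ball a r \<Longrightarrow> f j x = 0"
    "\<And>x. (\<lambda>j. f j x) \<longlonglongrightarrow> indicator (ball a r) x"
    using smooth_exhaustion_ball[OF assms(3)] by blast
  have lim: "(\<lambda>j. integral\<^sup>L \<mu> (f j)) \<longlonglongrightarrow> measure \<mu> (ball a r)" if \<mu>: "radon_on \<Omega> \<mu>" for \<mu>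
  proof -
    have s [measurable_cong]: "sets \<mu> = sets borel" using \<mu> by (simp add: radon_on_def)
    have fin: "emeasure \<mu> (cball a r) < \<infinity>" using \<mu> assms(3) by (simp add: radon_on_def)
    have fb: "f j \<in> borel_measurable borel" for j
      by (intro borel_measurable_continuous_onI smooth_on_continuous test_funD[OF f(1)])
    have "(\<lambda>j. integral\<^sup>L \<mu> (f j)) \<longlonglongrightarrow> integral\<^sup>L \<mu> (indicator (ball a r))"
    proof (rule integral_dominated_convergence[where w = "indicator (cball a r)"])
      show "AE x in \<mu>. norm (f j x) \<le> indicator (cball a r) x" for j
        using f(2,3,4) by (auto simp: indicator_def)
      show "indicator (ball a r) \<in> borel_measurable \<mu>"
        by (intro borel_measurable_indicator) (simp add: s)
      show "f j \<in> borel_measurable \<mu>" for j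
        using fb by (simp add: measurable_cong_sets[OF s refl])
      show "integrable \<mu> (indicator (cball a r) :: _ \<Rightarrow> real)"
        using fin s by (intro integrable_real_indicator) auto
      show "AE x in \<mu>. (\<lambda>j. f j x) \<longlonglongrightarrow> indicator (ball a r) x"
        by (intro always_eventually allI f(5))
    qed
    then show ?thesis using sets_eq_imp_space_eq[OF s] by simp
  qed
  have lim': "(\<lambda>j. R (form0 (\<lambda>x. of_real (f j x)))) \<longlonglongrightarrow> of_real (measure \<mu> (ball a r) - measure \<nu> (ball a r))"
    if "radon_on \<Omega> \<mu>" "radon_on \<Omega> \<nu>" "\<And>\<phi>. test_form \<Omega> 0 \<phi> \<Longrightarrow>
      R \<phi> = integral\<^sup>L \<mu> (\<lambda>x. \<phi> x {} {}) - integral\<^sup>L \<nu> (\<lambda>x. \<phi> x {} {})" for \<mu> \<nu>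
  proof -
    have "R (form0 (\<lambda>x. of_real (f j x))) = of_real (integral\<^sup>L \<mu> (f j) - integral\<^sup>L \<nu> (f j))" for j
      unfolding that(3)[OF test_form_form0[OF f(1)]] by (simp add: form0_def)
    moreover have "(\<lambda>j. complex_of_real (integral\<^sup>L \<mu> (f j) - integral\<^sup>L \<nu> (f j)))
        \<longlonglongrightarrow> of_real (measure \<mu> (ball a r) - measure \<nu> (ball a r))"
      by (intro tendsto_of_real tendsto_diff lim that)
    ultimately show ?thesis by simp
  qed
  show ?thesis
    unfolding current_integral_def
  proof (rule the_equality)
    show "\<exists>\<mu>' \<nu>'. radon_on \<Omega> \<mu>' \<and> radon_on \<Omega> \<nu>' \<and>
        (\<forall>\<phi>. test_form \<Omega> 0 \<phi> \<longrightarrow>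
           R \<phi> = integral\<^sup>L \<mu>' (\<lambda>x. \<phi> x {} {}) - integral\<^sup>L \<nu>' (\<lambda>x. \<phi> x {} {})) \<and>
        measure \<mu> (ball a r) - measure \<nu> (ball a r) = measure \<mu>' (ball a r) - measure \<nu>' (ball a r)"
      using assms R by blast
    fix c
    assume "\<exists>\<mu>' \<nu>'. radon_on \<Omega> \<mu>' \<and> radon_on \<Omega> \<nu>' \<and>
        (\<forall>\<phi>. test_form \<Omega> 0 \<phi> \<longrightarrow>
           R \<phi> = integral\<^sup>L \<mu>' (\<lambda>x. \<phi> x {} {}) - integral\<^sup>L \<nu>' (\<lambda>x. \<phi> x {} {})) \<and>
        c = measure \<mu>' (ball a r) - measure \<nu>' (ball a r)"
    then obtain \<mu>' \<nu>' where *: "radon_on \<Omega> \<mu>'" "radon_on \<Omega> \<nu>'"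
      "\<And>\<phi>. test_form \<Omega> 0 \<phi> \<Longrightarrow> R \<phi> = integral\<^sup>L \<mu>' (\<lambda>x. \<phi> x {} {}) - integral\<^sup>L \<nu>' (\<lambda>x. \<phi> x {} {})"
      "c = measure \<mu>' (ball a r) - measure \<nu>' (ball a r)" by blast
    have "complex_of_real (measure \<mu>' (ball a r) - measure \<nu>' (ball a r))
        = of_real (measure \<mu> (ball a r) - measure \<nu> (ball a r))"
      by (rule LIMSEQ_unique[OF lim'[OF *(1-3)] lim'[OF assms(1,2) R]])
    then show "c = measure \<mu> (ball a r) - measure \<nu> (ball a r)"
      unfolding *(4) of_real_eq_iff .
  qed
qed

lemma radon_on_null: "radon_on \<Omega> (null_measure borel)"
  by (simp add: radon_on_def)

section \<open>Positivity of forms\<close>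

lemma smooth_coeffs_form_on: "smooth_coeffs \<omega> \<Longrightarrow> smooth_form_on \<Omega> \<omega>"
  by (auto simp: smooth_coeffs_def smooth_form_on_def intro: smooth_on_subset)

lemma cnj_form_one_one:
  "cnj_form (one_one h) = one_one (\<lambda>x a b. - cnj (h x b a))"
  by (auto simp: cnj_form_def one_one_def fun_eq_iff)

lemma m_positive_std_kaehler:
  assumes "m \<le> CARD('n)"
  shows "m_positive_form \<Omega> m (std_kaehler :: 'n::{finite,linorder} dform)"
  unfolding m_positive_form_def
proof (intro conjI ballI)
  show "smooth_form_on \<Omega> (std_kaehler :: 'n dform)"
    by (intro smooth_coeffs_form_on smooth_coeffs_const const_std_kaehler)
  show "bideg_on \<Omega> 1 1 (std_kaehler :: 'n dform)"
    unfolding std_kaehler_def by (rule bideg_on_one_one)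
  show "cnj_form std_kaehler x = std_kaehler x" for x :: "'n cspace"
    unfolding std_kaehler_def cnj_form_one_one by (auto simp: one_one_def fun_eq_iff)
  show "top_form_nonneg (wedge (wedge_power std_kaehler j) (wedge_power kaehler (CARD('n) - j))) x"
    if "j \<in> {1..m}" for j and x :: "'n cspace"
    using that assms by (auto simp: top_form_nonneg_def kaehler_eq wedge_power_add intro!: exI[of _ 1])
qed

lemma m_positive_cone_form:
  fixes z :: "'n::{finite,linorder} cspace"
  assumes "m \<le> CARD('n)"
  shows "m_positive_form \<Omega> m (cone_form (real m / real CARD('n)) z)"
  unfolding m_positive_form_def
proof (intro conjI ballI)
  let ?C = "real m / real CARD('n)"
  show "smooth_form_on \<Omega> (cone_form ?C z)"
    by (intro smooth_coeffs_form_on smooth_coeffs_cone)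
  show "bideg_on \<Omega> 1 1 (cone_form ?C z)" by (rule bideg_on_cone_form)
  show "cnj_form (cone_form ?C z) x = cone_form ?C z x" for x
    unfolding cone_form_def std_kaehler_def grad_form_def smul_one_one fadd_one_one cnj_form_one_one
    by (auto simp: one_one_def fun_eq_iff)
  show "top_form_nonneg (wedge (wedge_power (cone_form ?C z) j) (wedge_power kaehler (CARD('n) - j))) x"
    if "j \<in> {1..m}" for j x
    unfolding top_form_nonneg_def kaehler_eq
  proof (intro exI conjI allI)
    have "real j / real CARD('n) \<le> ?C" using that by (simp add: divide_right_mono)
    then show "0 \<le> (?C * (norm (x - z))\<^sup>2) ^ (j - 1) * (norm (x - z))\<^sup>2 * (?C - real j / real CARD('n))"
      by simp
    have j: "1 \<le> j" "j \<le> CARD('n)" using that assms by auto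
    show "wedge (wedge_power (cone_form ?C z) j) (wedge_power std_kaehler (CARD('n) - j)) x I J
      = of_real ((?C * (norm (x - z))\<^sup>2) ^ (j - 1) * (norm (x - z))\<^sup>2 * (?C - real j / real CARD('n)))
        * wedge_power std_kaehler CARD('n) x I J" for I J
      unfolding cone_form_power_wedge[OF j] by (simp add: smul_def)
  qed
qed

text \<open>The definition prescribes n choose q summands; only the first carries a nonzero
  coefficient, and all factors are the same form. The bound on \<open>q\<close> ensures that a first
  summand exists.\<close>

lemma strongly_m_positive_power:
  fixes \<alpha> :: "'n::{finite,linorder} dform"
  assumes "open \<Omega>" "q \<le> CARD('n)" "m_positive_form \<Omega> m \<alpha>" "smooth_on \<Omega> f" "\<And>x. x \<in> \<Omega> \<Longrightarrow> 0 \<le> f x"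
  shows "strongly_m_positive \<Omega> m q (smul (\<lambda>x. of_real (f x)) (wedge_power \<alpha> q))"
  unfolding strongly_m_positive_def
proof (intro exI conjI allI ballI impI)
  let ?a = "\<lambda>(k::nat) x. if k = 0 then f x else 0" and ?\<alpha> = "\<lambda>(j::nat) (k::nat). \<alpha>"
  show "smooth_on \<Omega> (?a k)" for k using assms(1,4) by (cases k) auto
  show "0 \<le> ?a k x" if "x \<in> \<Omega>" for k x using assms(5)[OF that] by simp
  show "m_positive_form \<Omega> m \<alpha>" by fact
  have "map (\<lambda>j. \<alpha>) [0..<q] = replicate q \<alpha>" by (simp add: map_replicate_const)
  then have "wedge_list (map (\<lambda>j. \<alpha>) [0..<q]) = wedge_power \<alpha> q" by (simp add: wedge_power_def)
  moreover have "0 < CARD('n) choose q" using assms(2) by simp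
  ultimately show "smul (\<lambda>x. of_real (f x)) (wedge_power \<alpha> q) x I J =
      (\<Sum>k < CARD('n) choose q. of_real (?a k x) * wedge_list (map (\<lambda>j. ?\<alpha> j k) [0..<q]) x I J)" for x I J
    by (subst sum_eq_single[where a = 0]) (auto simp: smul_def)
qed

section \<open>The basic inequality\<close>

lemma test_form_wedge:
  assumes "test_form S q \<phi>" "smooth_coeffs P" "bideg_on UNIV a a P"
  shows "test_form S (a + q) (wedge P \<phi>)"
proof -
  obtain K where K: "compact K" "K \<subseteq> S" "smooth_coeffs \<phi>" "bideg_on UNIV q q \<phi>"
    "\<And>x I J. x \<notin> K \<Longrightarrow> \<phi> x I J = 0"
    using assms(1) by (auto simp: test_form_def test_form_in_def smooth_form_on_def smooth_coeffs_def)
  have "wedge P \<phi> x I J = 0" if "x \<notin> K" for x I J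
    using K(5)[OF that] by (simp add: wedge_def)
  then show ?thesis
    using K smooth_coeffs_wedge[OF assms(2) K(3)] bideg_on_wedge[OF assms(3) K(4)]
    unfolding test_form_def test_form_in_def smooth_form_on_def smooth_coeffs_def by blast
qed

lemma smooth_coeffs_ddc: "smooth_coeffs \<omega> \<Longrightarrow> smooth_coeffs (ddc \<omega>)"
  unfolding ddc_def ext_d_eq by (intro smooth_coeffs_fadd smooth_coeffs_del smooth_coeffs_ext_dc)

lemma test_form_fadd:
  assumes "test_form S q \<phi>" "test_form S q \<psi>"
  shows "test_form S q (fadd \<phi> \<psi>)"
proof -
  obtain K L where K: "compact K" "K \<subseteq> S" "test_form_in K q \<phi>"
    and L: "compact L" "L \<subseteq> S" "test_form_in L q \<psi>"
    using assms by (auto simp: test_form_def)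
  have "test_form_in (K \<union> L) q (fadd \<phi> \<psi>)"
    unfolding test_form_in_def smooth_form_on_def bideg_on_def
  proof (intro conjI allI ballI impI)
    show "smooth_on UNIV (\<lambda>x. fadd \<phi> \<psi> x I J)" for I J
      using K(3) L(3) by (auto simp: test_form_in_def smooth_form_on_def fadd_def intro!: smooth_on_add)
    show "card I = q" "card J = q" if "fadd \<phi> \<psi> x I J \<noteq> 0" for x I J
    proof -
      have "\<phi> x I J \<noteq> 0 \<or> \<psi> x I J \<noteq> 0" using that by (auto simp: fadd_def)
      then show "card I = q" "card J = q"
        using K(3) L(3) by (auto simp: test_form_in_def bideg_on_def)
    qed
    show "fadd \<phi> \<psi> x I J = 0" if "x \<notin> K \<union> L" for x I J
      using K(3) L(3) that by (simp add: test_form_in_def fadd_def)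
  qed
  then show ?thesis
    using K L unfolding test_form_def by (intro exI[of _ "K \<union> L"]) auto
qed

lemma form0_fadd: "fadd (form0 f) (form0 g) = form0 (\<lambda>x. f x + g x)"
  and form0_smul: "smul (\<lambda>_. c) (form0 f) = form0 (\<lambda>x. c * f x)"
  by (auto simp: form0_def fadd_def smul_def fun_eq_iff)

lemma ddc_form0_fadd:
  assumes "smooth_on UNIV f" "smooth_on UNIV g"
  shows "ddc (fadd (form0 f) (form0 g)) = fadd (ddc (form0 f)) (ddc (form0 g))"
proof -
  have "wirtinger_bar b (\<lambda>x. f x + g x) = (\<lambda>x. wirtinger_bar b f x + wirtinger_bar b g x)" for b
    using wirtinger_add(2)[OF assms] by blast
  then show ?thesis
    unfolding form0_fadd ddc_form0[OF smooth_on_add[OF open_UNIV assms]] ddc_form0[OF assms(1)]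
      ddc_form0[OF assms(2)] fadd_one_one
    by (simp add: wirtinger_add smooth_wirtinger assms algebra_simps)
qed

lemma ddc_form0_smul:
  assumes "smooth_on UNIV f"
  shows "ddc (smul (\<lambda>_. c) (form0 f)) = smul (\<lambda>_. c) (ddc (form0 f))"
proof -
  have "wirtinger_bar b (\<lambda>x. c * f x) = (\<lambda>x. c * wirtinger_bar b f x)" for b
    using wirtinger_cmult(2)[OF assms] by blast
  moreover have "smooth_on UNIV (\<lambda>x. c * f x)" by (intro smooth_on_mult smooth_on_const assms open_UNIV)
  ultimately show ?thesis
    unfolding form0_smul by (simp add: ddc_form0 assms smul_one_one wirtinger_cmult smooth_wirtinger algebra_simps)
qed

lemma test_form_ddc:
  fixes \<phi> :: "'n::{finite,linorder} dform"
  assumes "test_form S 0 \<phi>"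
  shows "test_form S 1 (ddc \<phi>)"
proof -
  obtain f K where f: "\<phi> = form0 f" "smooth_on UNIV f" "compact K" "K \<subseteq> S" "\<And>x. x \<notin> K \<Longrightarrow> f x = 0"
    using test_form_0E[OF assms] by metis
  have open_K: "open (- K)" using f(3) by (simp add: compact_imp_closed open_Compl)
  have D: "dir_deriv v g x = 0" if "\<And>x. x \<notin> K \<Longrightarrow> g x = 0" "x \<notin> K"
    for v x and g :: "'n cspace \<Rightarrow> complex"
    using dir_deriv_cong_open(1)[OF open_K, of x g "\<lambda>_. 0" v] that by simp
  have "wirtinger a (wirtinger_bar b f) x = 0" if "x \<notin> K" for a b x
    unfolding wirtinger_def using that D[of "wirtinger_bar b f"]
    by (simp add: wirtinger_bar_def D[OF f(5)])
  then have "ddc \<phi> x I J = 0" if "x \<notin> K" for x I J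
    using that by (simp add: f(1) ddc_form0[OF f(2)] one_one_def)
  moreover have "bideg_on UNIV 1 1 (ddc \<phi>)"
    unfolding f(1) ddc_form0[OF f(2)] by (rule bideg_on_one_one)
  moreover have "smooth_coeffs (ddc \<phi>)"
    unfolding f(1) by (intro smooth_coeffs_ddc smooth_coeffs_form0 f)
  ultimately show ?thesis
    using f(3,4) unfolding test_form_def test_form_in_def smooth_form_on_def smooth_coeffs_def by blast
qed

lemma test_fun_radial:
  fixes u :: "real \<Rightarrow> real"
  assumes "smooth_on UNIV u" "\<And>t. R\<^sup>2 \<le> t \<Longrightarrow> u t = 0" "0 < R" "cball z R \<subseteq> S"
  shows "test_fun S (\<lambda>x. u ((norm (x - z))\<^sup>2))"
proof -
  have "u ((norm (x - z))\<^sup>2) = 0" if "x \<notin> cball z R" for x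
    using that assms(3) by (intro assms(2) power_mono) (auto simp: dist_norm norm_minus_commute)
  moreover have "smooth_on UNIV (\<lambda>x. u ((norm (x - z))\<^sup>2))"
    by (rule smooth_on_compose[OF open_UNIV assms(1) smooth_on_norm_square[OF open_UNIV]]) simp
  ultimately show ?thesis
    unfolding test_fun_def using assms(4) by (blast intro: compact_cball)
qed

locale m_negative_m_subharmonic =
  fixes \<Omega> :: "'n::{finite,linorder} cspace set" and T :: "'n current" and m p :: nat
  assumes m: "1 \<le> m" "m < CARD('n)" and open_\<Omega>: "open \<Omega>"
    and p: "p \<le> CARD('n)" "CARD('n) + 1 \<le> m + p"
    and current: "is_current \<Omega> p T"
    and negative: "m_negative_current \<Omega> m p T"
    and subharmonic: "m_subharmonic_current \<Omega> m p T"
begin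

abbreviation B :: "nat \<Rightarrow> 'n dform" where "B \<equiv> wedge_power std_kaehler"

lemma T_fadd: "test_form \<Omega> p \<phi> \<Longrightarrow> test_form \<Omega> p \<psi> \<Longrightarrow> T (fadd \<phi> \<psi>) = T \<phi> + T \<psi>"
  using current by (simp add: is_current_def fadd_def)

lemma T_smul: "test_form \<Omega> p \<phi> \<Longrightarrow> T (smul (\<lambda>_. c) \<phi>) = c * T \<phi>"
  using current by (simp add: is_current_def smul_def)

lemma smooth_B: "smooth_coeffs (B q)"
  by (intro smooth_coeffs_const const_kaehler)

text \<open>Here \<open>\<mu>\<close> represents - T \<and> \<beta>^p. Its positivity follows by
  testing negativity on f \<beta>^(m+p-n), which the factor \<beta>^(n-m) in the definition
  completes to f \<beta>^p.\<close>

lemma trace_measure_exists: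
  obtains \<mu> where "radon_on \<Omega> \<mu>" "\<And>f. test_fun \<Omega> f \<Longrightarrow> integrable \<mu> f"
    "\<And>f. test_fun \<Omega> f \<Longrightarrow> T (smul (\<lambda>x. of_real (f x)) (B p)) = - of_real (integral\<^sup>L \<mu> f)"
    "\<And>a r. cball a r \<subseteq> \<Omega> \<Longrightarrow>
      current_integral \<Omega> (current_wedge T (wedge_power kaehler p)) (ball a r) = - measure \<mu> (ball a r)"
proof -
  let ?R = "\<lambda>\<phi>. - T (wedge (B p) \<phi>)"
  have t: "test_form \<Omega> p (wedge (B p) \<phi>)" if "test_form \<Omega> 0 \<phi>" for \<phi>
    using test_form_wedge[OF that smooth_B bideg_on_kaehler_power] by simp
  obtain \<mu> where \<mu>: "radon_on \<Omega> \<mu>" "\<And>f. test_fun \<Omega> f \<Longrightarrow> integrable \<mu> f"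
    "\<And>f. test_fun \<Omega> f \<Longrightarrow> ?R (form0 (\<lambda>x. of_real (f x))) = of_real (integral\<^sup>L \<mu> f)"
    "\<And>\<phi>. test_form \<Omega> 0 \<phi> \<Longrightarrow> ?R \<phi> = integral\<^sup>L \<mu> (\<lambda>x. \<phi> x {} {})"
  proof (rule positive_current_measure[OF open_\<Omega>, of ?R])
    show "?R (fadd f g) = ?R f + ?R g" if "test_form \<Omega> 0 f" "test_form \<Omega> 0 g" for f g
      using that by (simp add: wedge_fadd_right T_fadd t)
    show "?R (smul (\<lambda>_. c) f) = c * ?R f" if "test_form \<Omega> 0 f" for f c
      using that by (simp add: wedge_smul_right T_smul t)
    show "\<exists>c\<ge>0. ?R (form0 (\<lambda>x. of_real (f x))) = of_real c"
      if f: "test_fun \<Omega> f" "\<And>x. 0 \<le> f x" for f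
    proof -
      let ?k = "m + p - CARD('n)"
      let ?\<alpha> = "smul (\<lambda>x. of_real (f x)) (B ?k)"
      have "test_form \<Omega> ?k ?\<alpha>" by (intro test_form_smul f smooth_B bideg_on_kaehler_power)
      moreover have "strongly_m_positive \<Omega> m ?k ?\<alpha>"
        using m p f by (intro strongly_m_positive_power open_\<Omega> m_positive_std_kaehler)
          (auto intro: smooth_on_subset test_funD)
      ultimately have "\<exists>c\<ge>0. - T (wedge (B (CARD('n) - m)) ?\<alpha>) = of_real c"
        using negative unfolding m_negative_current_def m_positive_current_def current_wedge_def kaehler_eq
        by blast
      moreover have "wedge (B (CARD('n) - m)) ?\<alpha> = wedge (B p) (form0 (\<lambda>x. of_real (f x)))"
        using m p by (simp add: wedge_smul_right wedge_power_add wedge_form0_right)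
      ultimately show ?thesis by simp
    qed
  qed (rule that)
  show ?thesis
  proof (rule that[OF \<mu>(1,2)])
    show "T (smul (\<lambda>x. of_real (f x)) (B p)) = - of_real (integral\<^sup>L \<mu> f)" if "test_fun \<Omega> f" for f
      using \<mu>(3)[OF that] by (simp add: wedge_form0_right minus_equation_iff)
    show "current_integral \<Omega> (current_wedge T (wedge_power kaehler p)) (ball a r) = - measure \<mu> (ball a r)"
      if "cball a r \<subseteq> \<Omega>" for a r
    proof -
      have "current_wedge T (wedge_power kaehler p) \<phi>
          = integral\<^sup>L (null_measure borel) (\<lambda>x. \<phi> x {} {}) - integral\<^sup>L \<mu> (\<lambda>x. \<phi> x {} {})"
        if "test_form \<Omega> 0 \<phi>" for \<phi>
      proof -
        have "T (wedge (B p) \<phi>) = - integral\<^sup>L \<mu> (\<lambda>x. \<phi> x {} {})"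
          using \<mu>(4)[OF that] by (metis minus_minus)
        then show ?thesis by (simp add: current_wedge_def kaehler_eq)
      qed
      from current_integral_ball[where R = "current_wedge T (wedge_power kaehler p)",
          OF radon_on_null \<mu>(1) that this] show ?thesis
        by (simp add: measure_def)
    qed
  qed
qed

lemma ddc_wedge_B: "smooth_on UNIV f \<Longrightarrow> ddc (wedge (B q) (form0 f)) = wedge (B q) (ddc (form0 f))"
  by (intro ddc_wedge_const const_kaehler even_form_wedge_power even_std_kaehler smooth_coeffs_form0)

text \<open>Here \<open>\<nu>\<close> represents dd^cT \<and> \<beta>^(p-1). Positivity is tested on
  f \<beta>^(m+p-1-n); the third property has dd^c moved past \<beta>^(p-1) onto the function, the
  form in which \<open>ddc_radial\<close> can be applied.\<close>

lemma ddc_trace_measure_exists: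
  obtains \<nu> where "radon_on \<Omega> \<nu>" "\<And>f. test_fun \<Omega> f \<Longrightarrow> integrable \<nu> f"
    "\<And>f. test_fun \<Omega> f \<Longrightarrow>
      T (wedge (B (p - 1)) (ddc (form0 (\<lambda>x. of_real (f x))))) = of_real (integral\<^sup>L \<nu> f)"
    "\<And>a r. cball a r \<subseteq> \<Omega> \<Longrightarrow>
      current_integral \<Omega> (current_wedge (current_ddc T) (wedge_power kaehler (p - 1))) (ball a r)
        = measure \<nu> (ball a r)"
proof -
  let ?R = "\<lambda>\<phi>. T (ddc (wedge (B (p - 1)) \<phi>))"
  have R: "?R \<phi> = T (wedge (B (p - 1)) (ddc \<phi>))" if "test_form \<Omega> 0 \<phi>" for \<phi>
    using test_form_0E[OF that] ddc_wedge_B by metis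
  have "1 \<le> p" using m p by simp
  then have t: "test_form \<Omega> p (wedge (B (p - 1)) (ddc \<phi>))" if "test_form \<Omega> 0 \<phi>" for \<phi>
    using test_form_wedge[OF test_form_ddc[OF that] smooth_B bideg_on_kaehler_power, of "p - 1"] by simp
  obtain \<nu> where \<nu>: "radon_on \<Omega> \<nu>" "\<And>f. test_fun \<Omega> f \<Longrightarrow> integrable \<nu> f"
    "\<And>f. test_fun \<Omega> f \<Longrightarrow> ?R (form0 (\<lambda>x. of_real (f x))) = of_real (integral\<^sup>L \<nu> f)"
    "\<And>\<phi>. test_form \<Omega> 0 \<phi> \<Longrightarrow> ?R \<phi> = integral\<^sup>L \<nu> (\<lambda>x. \<phi> x {} {})"
  proof (rule positive_current_measure[OF open_\<Omega>, of ?R])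
    show "?R (fadd f g) = ?R f + ?R g" if fg: "test_form \<Omega> 0 f" "test_form \<Omega> 0 g" for f g
    proof -
      have "ddc (fadd f g) = fadd (ddc f) (ddc g)"
        using test_form_0E[OF fg(1)] test_form_0E[OF fg(2)] ddc_form0_fadd by metis
      then show ?thesis
        unfolding R[OF test_form_fadd[OF fg]] R[OF fg(1)] R[OF fg(2)]
        by (simp only: wedge_fadd_right T_fadd t fg)
    qed
    show "?R (smul (\<lambda>_. c) f) = c * ?R f" if f: "test_form \<Omega> 0 f" for f c
    proof -
      have "ddc (smul (\<lambda>_. c) f) = smul (\<lambda>_. c) (ddc f)"
        using test_form_0E[OF f] ddc_form0_smul by metis
      then show ?thesis
        unfolding R[OF test_form_smul_const[OF f]] R[OF f]
        by (simp only: wedge_smul_right T_smul t f)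
    qed
    show "\<exists>c\<ge>0. ?R (form0 (\<lambda>x. of_real (f x))) = of_real c"
      if f: "test_fun \<Omega> f" "\<And>x. 0 \<le> f x" for f
    proof -
      let ?k = "m + (p - 1) - CARD('n)"
      let ?\<alpha> = "smul (\<lambda>x. of_real (f x)) (B ?k)"
      have "test_form \<Omega> ?k ?\<alpha>" by (intro test_form_smul f smooth_B bideg_on_kaehler_power)
      moreover have "strongly_m_positive \<Omega> m ?k ?\<alpha>"
        using m p f by (intro strongly_m_positive_power open_\<Omega> m_positive_std_kaehler)
          (auto intro: smooth_on_subset test_funD)
      ultimately have "\<exists>c\<ge>0. T (ddc (wedge (B (CARD('n) - m)) ?\<alpha>)) = of_real c"
        using subharmonic
        unfolding m_subharmonic_current_def m_positive_current_def current_wedge_def current_ddc_def kaehler_eq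
        by blast
      moreover have "CARD('n) - m + ?k = p - 1" using m p by simp
      then have "wedge (B (CARD('n) - m)) ?\<alpha> = wedge (B (p - 1)) (form0 (\<lambda>x. of_real (f x)))"
        by (simp add: wedge_smul_right wedge_power_add wedge_form0_right)
      ultimately show ?thesis by simp
    qed
  qed (rule that)
  show ?thesis
  proof (rule that[OF \<nu>(1,2)])
    show "T (wedge (B (p - 1)) (ddc (form0 (\<lambda>x. of_real (f x))))) = of_real (integral\<^sup>L \<nu> f)"
      if "test_fun \<Omega> f" for f
      using \<nu>(3)[OF that] R[OF test_form_form0[OF that]] by simp
    show "current_integral \<Omega> (current_wedge (current_ddc T) (wedge_power kaehler (p - 1))) (ball a r)
        = measure \<nu> (ball a r)"
      if "cball a r \<subseteq> \<Omega>" for a r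
    proof -
      have "current_wedge (current_ddc T) (wedge_power kaehler (p - 1)) \<phi>
          = integral\<^sup>L \<nu> (\<lambda>x. \<phi> x {} {}) - integral\<^sup>L (null_measure borel) (\<lambda>x. \<phi> x {} {})"
        if "test_form \<Omega> 0 \<phi>" for \<phi>
        using \<nu>(4)[OF that] by (simp add: current_wedge_def current_ddc_def kaehler_eq)
      from current_integral_ball[where R = "current_wedge (current_ddc T) (wedge_power kaehler (p - 1))",
          OF \<nu>(1) radon_on_null that this] show ?thesis
        by (simp add: measure_def)
    qed
  qed
qed

text \<open>Testing \<open>dd\<^sup>cT\<close> against \<open>g(\<phi>) \<beta>\<^bsup>p-1\<^esup>\<close>, where \<open>\<phi> = |x - z|\<^sup>2\<close>, produces \<open>T\<close> applied to
  \<open>g'(\<phi>) \<beta>\<^sup>p + g''(\<phi>) \<beta>\<^bsup>p-1\<^esup> \<and> d\<phi> \<and> d\<^sup>c\<phi>\<close>.  The last term is bounded by testing \<open>T\<close> against a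
  multiple of the \<open>(m + p - n)\<close>-th power of the cone form.\<close>

lemma basic_inequality:
  assumes \<mu>: "\<And>f. test_fun \<Omega> f \<Longrightarrow> integrable \<mu> f"
    "\<And>f. test_fun \<Omega> f \<Longrightarrow> T (smul (\<lambda>x. of_real (f x)) (B p)) = - of_real (integral\<^sup>L \<mu> f)"
    and \<nu>: "\<And>f. test_fun \<Omega> f \<Longrightarrow>
      T (wedge (B (p - 1)) (ddc (form0 (\<lambda>x. of_real (f x))))) = of_real (integral\<^sup>L \<nu> f)"
    and ball: "cball z R \<subseteq> \<Omega>" "0 < R"
    and smooth: "smooth_on UNIV g" "smooth_on UNIV g'" "smooth_on UNIV h"
    and D: "\<And>t. (g has_real_derivative g' t) (at t)" "\<And>t. (g' has_real_derivative h t) (at t)"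
    and out: "\<And>t. R\<^sup>2 \<le> t \<Longrightarrow> g t = 0" "\<And>t. R\<^sup>2 \<le> t \<Longrightarrow> g' t = 0" "\<And>t. R\<^sup>2 \<le> t \<Longrightarrow> h t = 0"
    and h: "\<And>t. 0 \<le> h t" "0 < d" "\<And>t. t \<le> d \<Longrightarrow> h t = 0"
  defines "\<kappa> \<equiv> real CARD('n) * real (m + p - CARD('n)) / real m"
  shows "0 \<le> \<kappa> * (\<integral>x. g ((norm (x - z))\<^sup>2) \<partial>\<nu>)
    + (\<integral>x. \<kappa> * g' ((norm (x - z))\<^sup>2) + (norm (x - z))\<^sup>2 * h ((norm (x - z))\<^sup>2) \<partial>\<mu>)"
proof -
  let ?\<phi> = "\<lambda>x. (norm (x - z))\<^sup>2"
  \<comment> \<open>One less than the degree \<open>m + p - n\<close> of the test form, so that the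
    exponents in \<open>cone_form_power\<close> appear as \<open>Suc k\<close> and
    \<open>k\<close>.\<close>
  define k where "k = m + p - CARD('n) - 1"
  have k: "m + p - CARD('n) = Suc k" "CARD('n) - m + k = p - 1" "CARD('n) - m + Suc k = p" "Suc k \<le> CARD('n)"
    using m p by (auto simp: k_def)
  define C where "C = real m / real CARD('n)"
  have C: "0 < C" using m by (simp add: C_def)
  note radial = test_fun_radial[OF _ _ ball(2,1)]
  let ?H = "\<lambda>x. complex_of_real (h (?\<phi> x))"
  let ?G = "wedge (grad_form z) (B (p - 1))"
  have "bideg_on UNIV (1 + (p - 1)) (1 + (p - 1)) ?G"
    unfolding grad_form_def by (intro bideg_on_wedge bideg_on_one_one bideg_on_kaehler_power)
  then have bideg_G: "bideg_on UNIV p p ?G" using m p by simp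
  have smooth_G: "smooth_coeffs ?G"
    by (intro smooth_coeffs_wedge smooth_coeffs_grad smooth_B)
  have th: "test_form \<Omega> p (smul ?H ?G)"
    by (intro test_form_smul radial smooth out smooth_G bideg_G)
  have tB: "test_form \<Omega> p (smul (\<lambda>x. of_real (u x)) (B p))" if "test_fun \<Omega> u" for u
    by (intro test_form_smul that smooth_B bideg_on_kaehler_power)
  have tg: "test_fun \<Omega> (\<lambda>x. g (?\<phi> x))" "test_fun \<Omega> (\<lambda>x. g' (?\<phi> x))"
    using radial smooth out by auto
  \<comment> \<open>The term that neither measure represents directly. The formula for dd^c
    expresses it through \<open>\<mu>\<close> and \<open>\<nu>\<close>; the cone form then gives the
    inequality for it.\<close>
  define X where "X = T (smul ?H ?G)"
  have "wedge (B (p - 1)) std_kaehler = B p"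
  proof -
    have "wedge (B (p - 1)) (B 1) = B (p - 1 + 1)" by (rule wedge_power_add)
    then show ?thesis using k by (simp add: wedge_power_Suc wedge_power_0 wedge_form0_right)
  qed
  then have "wedge (B (p - 1)) (ddc (form0 (\<lambda>x. of_real (g (?\<phi> x)))))
      = fadd (smul (\<lambda>x. of_real (g' (?\<phi> x))) (B p)) (smul ?H ?G)"
    by (simp add: ddc_radial[OF smooth(1,2) D] wedge_fadd_right wedge_smul_right
        wedge_commute[OF even_form_wedge_power[OF even_std_kaehler]] flip: grad_form_def)
  then have "of_real (\<integral>x. g (?\<phi> x) \<partial>\<nu>) = - complex_of_real (\<integral>x. g' (?\<phi> x) \<partial>\<mu>) + X"
    using \<nu>[OF tg(1)] \<mu>(2)[OF tg(2)] T_fadd[OF tB[OF tg(2)] th] by (simp add: X_def)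
  then have X: "X = of_real ((\<integral>x. g (?\<phi> x) \<partial>\<nu>) + (\<integral>x. g' (?\<phi> x) \<partial>\<mu>))" by simp
  \<comment> \<open>The division cancels the factor \<phi>^k in the power of the cone form, leaving
    the coefficient \<open>h\<close> in front of \<open>?G\<close>. It does not spoil smoothness at
    the origin, because \<open>h\<close> vanishes up to \<open>d > 0\<close>: \<open>q\<close> is a
    smooth quotient on the positive axis and zero to the left of \<open>d\<close>.\<close>
  define q where "q = (\<lambda>t. h t * (1 / t ^ k))"
  have smooth_q: "smooth_on UNIV q"
  proof -
    have "smooth_on {0<..} (\<lambda>t. h t * t powr (- real k))"
      by (intro smooth_on_mult smooth_on_subset[OF smooth(3)] smooth_on_powr) auto
    then have "smooth_on {0<..} q"
      by (rule smooth_on_cong[rotated 2]) (auto simp: q_def powr_minus powr_realpow divide_simps)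
    moreover have "smooth_on {..<d} q"
      by (rule smooth_on_cong[where g = "\<lambda>_. 0"]) (auto simp: q_def h(3))
    moreover have "{0<..} \<union> {..<d} = (UNIV :: real set)" using h(2) by auto
    ultimately show ?thesis using smooth_on_Un by metis
  qed
  have q: "0 \<le> q (?\<phi> x)" for x using h(1) by (simp add: q_def)
  have tq: "test_fun \<Omega> (\<lambda>x. q (?\<phi> x))" using smooth_q out(3) by (intro radial) (auto simp: q_def)
  have q_eq: "q t * t ^ k = h t" for t
    using h(2) h(3)[of t] by (cases "t \<le> d") (auto simp: q_def)
  let ?A = "smul (\<lambda>x. of_real (q (?\<phi> x))) (wedge_power (cone_form C z) (Suc k))"
  have "test_form \<Omega> (Suc k) ?A"
    by (intro test_form_smul tq smooth_coeffs_power smooth_coeffs_cone bideg_on_wedge_power bideg_on_cone_form)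
  moreover have "strongly_m_positive \<Omega> m (Suc k) ?A"
    using m p k q unfolding C_def
    by (intro strongly_m_positive_power open_\<Omega> m_positive_cone_form)
      (auto intro: smooth_on_subset[OF test_funD[OF tq]])
  ultimately have "\<exists>c\<ge>0. - T (wedge (B (CARD('n) - m)) ?A) = of_real c"
    using negative unfolding m_negative_current_def m_positive_current_def current_wedge_def kaehler_eq k(1)
    by blast
  then obtain c where c: "0 \<le> c" "- T (wedge (B (CARD('n) - m)) ?A) = of_real c" by blast
  have swap: "wedge (B (CARD('n) - m)) (wedge (grad_form z) (B k)) = ?G"
  proof -
    have "wedge (B (CARD('n) - m)) (wedge (grad_form z) (B k))
        = wedge (wedge (B (CARD('n) - m)) (grad_form z)) (B k)"
      by (rule wedge_assoc[symmetric])
    also have "wedge (B (CARD('n) - m)) (grad_form z) = wedge (grad_form z) (B (CARD('n) - m))"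
      by (rule wedge_commute[OF even_form_wedge_power[OF even_std_kaehler]])
    finally show ?thesis by (simp only: wedge_assoc wedge_power_add k(2))
  qed
  have coeffs: "of_real (q (?\<phi> x)) * of_real ((C * ?\<phi> x) ^ Suc k)
      = complex_of_real (C ^ Suc k * (?\<phi> x * h (?\<phi> x)))"
    "of_real (q (?\<phi> x)) * of_real (- real (Suc k) * (C * ?\<phi> x) ^ k)
      = complex_of_real (- real (Suc k) * C ^ k) * ?H x" for x
    unfolding q_eq[symmetric] by (simp_all add: power_mult_distrib)
  have "wedge (B (CARD('n) - m)) ?A = fadd (smul (\<lambda>x. of_real (C ^ Suc k * (?\<phi> x * h (?\<phi> x)))) (B p))
      (smul (\<lambda>_. of_real (- real (Suc k) * C ^ k)) (smul ?H ?G))"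
    unfolding wedge_smul_right cone_form_power smul_fadd wedge_fadd_right smul_smul swap wedge_power_add k(3)
      coeffs ..
  moreover have tu: "test_fun \<Omega> (\<lambda>x. C ^ Suc k * (?\<phi> x * h (?\<phi> x)))"
  proof -
    have "smooth_on UNIV (\<lambda>t. C ^ Suc k * (t * h t))"
      by (intro smooth_on_mult smooth_on_const smooth smooth_on_bounded_linear bounded_linear_ident open_UNIV)
    then show ?thesis by (rule radial) (simp add: out)
  qed
  moreover have "test_form \<Omega> p (smul (\<lambda>_. of_real (- real (Suc k) * C ^ k)) (smul ?H ?G))"
    by (rule test_form_smul_const[OF th])
  ultimately have "T (wedge (B (CARD('n) - m)) ?A) = - of_real (\<integral>x. C ^ Suc k * (?\<phi> x * h (?\<phi> x)) \<partial>\<mu>)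
      + of_real (- real (Suc k) * C ^ k) * X"
    using T_fadd[OF tB[OF tu]] T_smul[OF th] \<mu>(2)[OF tu] by (simp add: X_def)
  then have "T (wedge (B (CARD('n) - m)) ?A) = - of_real (C ^ Suc k * (\<integral>x. ?\<phi> x * h (?\<phi> x) \<partial>\<mu>)
      + real (Suc k) * C ^ k * ((\<integral>x. g (?\<phi> x) \<partial>\<nu>) + (\<integral>x. g' (?\<phi> x) \<partial>\<mu>)))"
    by (simp add: X algebra_simps)
  then have "complex_of_real c = of_real (C ^ Suc k * (\<integral>x. ?\<phi> x * h (?\<phi> x) \<partial>\<mu>)
      + real (Suc k) * C ^ k * ((\<integral>x. g (?\<phi> x) \<partial>\<nu>) + (\<integral>x. g' (?\<phi> x) \<partial>\<mu>)))"
    using c(2) by (simp only: minus_minus)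
  then have "0 \<le> C ^ Suc k * (\<integral>x. ?\<phi> x * h (?\<phi> x) \<partial>\<mu>)
      + real (Suc k) * C ^ k * ((\<integral>x. g (?\<phi> x) \<partial>\<nu>) + (\<integral>x. g' (?\<phi> x) \<partial>\<mu>))"
    using c(1) by (simp only: of_real_eq_iff)
  \<comment> \<open>\<open>\<kappa>\<close> equals \<open>Suc k / C\<close>, so the positive factor
    \<open>C ^ Suc k\<close> comes out of both terms.\<close>
  also have "\<dots> = C ^ Suc k * ((\<integral>x. ?\<phi> x * h (?\<phi> x) \<partial>\<mu>)
      + \<kappa> * ((\<integral>x. g (?\<phi> x) \<partial>\<nu>) + (\<integral>x. g' (?\<phi> x) \<partial>\<mu>)))"
    using C m by (simp add: \<kappa>_def k(1) C_def field_simps)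
  finally have "0 \<le> (\<integral>x. ?\<phi> x * h (?\<phi> x) \<partial>\<mu>)
      + \<kappa> * ((\<integral>x. g (?\<phi> x) \<partial>\<nu>) + (\<integral>x. g' (?\<phi> x) \<partial>\<mu>))"
    using zero_less_power[OF C, of "Suc k"] unfolding zero_le_mult_iff by linarith
  moreover have "(\<integral>x. \<kappa> * g' (?\<phi> x) + ?\<phi> x * h (?\<phi> x) \<partial>\<mu>)
      = \<kappa> * (\<integral>x. g' (?\<phi> x) \<partial>\<mu>) + (\<integral>x. ?\<phi> x * h (?\<phi> x) \<partial>\<mu>)"
  proof -
    have "smooth_on UNIV (\<lambda>t. t * h t)"
      by (intro smooth_on_mult smooth smooth_on_bounded_linear bounded_linear_ident open_UNIV)
    then have "integrable \<mu> (\<lambda>x. ?\<phi> x * h (?\<phi> x))" by (intro \<mu>(1) radial) (simp_all add: out)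
    then show ?thesis using \<mu>(1)[OF tg(2)] by simp
  qed
  ultimately show ?thesis by (simp add: algebra_simps)
qed

end

section \<open>Existence of the limit\<close>

text \<open>If \<open>h\<close> were \<open>t\<^bsup>-\<kappa>-1\<^esup>\<close> on \<open>(r1, r2)\<close> and \<open>0\<close> elsewhere, then \<open>\<kappa> g' + t h\<close> would be the
  step function \<open>r2\<^bsup>-\<kappa>\<^esup> 1\<^bsub>t < r2\<^esub> - r1\<^bsup>-\<kappa>\<^esup> 1\<^bsub>t < r1\<^esub>\<close>; the following is a smooth version of this.\<close>

lemma smooth_profile:
  fixes \<kappa> r1 r2 d :: real
  assumes "1 < \<kappa>" "0 < r1" "0 < d" "r1 + d < r2 - d"
  shows "\<exists>g g' h. smooth_on UNIV g \<and> smooth_on UNIV g' \<and> smooth_on UNIV h \<and>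
    (\<forall>t. (g has_real_derivative g' t) (at t)) \<and> (\<forall>t. (g' has_real_derivative h t) (at t)) \<and>
    (\<forall>t\<ge>r2. g t = 0 \<and> g' t = 0 \<and> h t = 0) \<and> (\<forall>t. 0 \<le> h t \<and> 0 \<le> g t) \<and> (\<forall>t\<le>r1. h t = 0) \<and>
    (\<forall>t<r1. \<kappa> * g' t + t * h t \<le> (r2 - d) powr - \<kappa> - (r1 + d) powr - \<kappa>) \<and>
    (\<forall>t. r1 \<le> t \<and> t < r2 \<longrightarrow>
      \<kappa> * g' t + t * h t \<le> (r2 - d) powr - \<kappa> + (r1 powr - \<kappa> - (r1 + d) powr - \<kappa>)) \<and>
    (\<forall>t. 0 < t \<and> t \<le> r2 \<longrightarrow> \<kappa> * g t \<le> (t powr (1 - \<kappa>) - r2 powr (1 - \<kappa>)) / (\<kappa> - 1))"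
proof -
  obtain f :: "real \<Rightarrow> real" where f0: "smooth_on UNIV f" "\<forall>t. 0 \<le> f t \<and> f t \<le> 1"
    "\<forall>t. t \<le> r1 \<or> r2 \<le> t \<longrightarrow> f t = 0" "\<forall>t. r1 + d \<le> t \<and> t \<le> r2 - d \<longrightarrow> f t = 1"
    using smooth_cutoff_exists[OF assms(3), of r1 r2] by (elim exE conjE)
  have f: "smooth_on UNIV f" "\<And>t. 0 \<le> f t" "\<And>t. f t \<le> 1"
    "\<And>t. t \<le> r1 \<Longrightarrow> f t = 0" "\<And>t. r2 \<le> t \<Longrightarrow> f t = 0" "\<And>t. r1 + d \<le> t \<Longrightarrow> t \<le> r2 - d \<Longrightarrow> f t = 1"
    using f0 by simp_all
  define h where "h = (\<lambda>t. f t * t powr (- \<kappa> - 1))"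
  have h0: "0 \<le> h t" for t using f(2) by (simp add: h_def)
  have h_out: "h t = 0" if "t \<le> r1 \<or> r2 \<le> t" for t using f(4,5) that by (auto simp: h_def)
  have smooth_h: "smooth_on UNIV h"
  proof -
    have "smooth_on {0<..} h"
      unfolding h_def by (intro smooth_on_mult smooth_on_subset[OF f(1)] smooth_on_powr) auto
    moreover have "smooth_on {..<r1} h"
      by (rule smooth_on_cong[where g = "\<lambda>_. 0"]) (auto simp: h_out)
    moreover have "{0<..} \<union> {..<r1} = (UNIV :: real set)" using assms(2) by auto
    ultimately show ?thesis using smooth_on_Un by metis
  qed
  obtain H where H: "smooth_on UNIV H" "\<And>t. (H has_real_derivative h t) (at t)"
    using smooth_antiderivative[OF smooth_h] by blast
  \<comment> \<open>Both primitives are normalized at \<open>r2\<close>. Since \<open>h\<close>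
    vanishes beyond \<open>r2\<close>, so do \<open>g'\<close> and then \<open>g\<close>.\<close>
  define g' where "g' = (\<lambda>t. H t - H r2)"
  have smooth_g': "smooth_on UNIV g'" unfolding g'_def by (intro smooth_on_diff H smooth_on_const open_UNIV)
  have Dg': "(g' has_real_derivative h t) (at t)" for t
    unfolding g'_def using H(2) by (auto intro!: derivative_eq_intros)
  obtain G where G: "smooth_on UNIV G" "\<And>t. (G has_real_derivative g' t) (at t)"
    using smooth_antiderivative[OF smooth_g'] by blast
  define g where "g = (\<lambda>t. G t - G r2)"
  have smooth_g: "smooth_on UNIV g" unfolding g_def by (intro smooth_on_diff G smooth_on_const open_UNIV)
  have Dg: "(g has_real_derivative g' t) (at t)" for t
    unfolding g_def using G(2) by (auto intro!: derivative_eq_intros)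
  have g'_out: "g' t = 0" if "r2 \<le> t" for t
  proof (cases "t = r2")
    case False
    then have "r2 < t" using that by simp
    then obtain y where "r2 < y" "g' t - g' r2 = (t - r2) * h y" using MVT2[of r2 t g' h] Dg' by blast
    then show ?thesis by (simp add: h_out g'_def)
  qed (simp add: g'_def)
  have g_out: "g t = 0" if "r2 \<le> t" for t
  proof (cases "t = r2")
    case False
    then have "r2 < t" using that by simp
    then obtain y where "r2 < y" "g t - g r2 = (t - r2) * g' y" using MVT2[of r2 t g g'] Dg by blast
    then show ?thesis by (simp add: g'_out g_def)
  qed (simp add: g_def)
  have g'_mono: "g' x \<le> g' y" if "x \<le> y" for x y
    using DERIV_nonneg_imp_nondecreasing[OF that, of g'] Dg' h0 by blast
  have g'_le: "g' t \<le> 0" for t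
    using g'_mono[of t "max t r2"] g'_out[of "max t r2"] by simp
  have g_nonneg: "0 \<le> g t" for t
    using DERIV_nonpos_imp_nonincreasing[of t "max t r2" g] Dg g'_le g_out[of "max t r2"]
    by (metis max.cobounded1 max.cobounded2)
  \<comment> \<open>On the plateau where \<open>f\<close> is 1 this is the quantity
    \<open>\<kappa> * g' t + t * h t\<close> to be estimated. Its derivative is a nonnegative
    multiple of \<open>f - 1\<close>, so \<open>u\<close> decreases on the positive axis and is
    constant on the plateau.\<close>
  define u where "u = (\<lambda>t. \<kappa> * g' t + t powr - \<kappa>)"
  have Du: "(u has_real_derivative \<kappa> * (f t - 1) * t powr (- \<kappa> - 1)) (at t)" if "0 < t" for t
    unfolding u_def using that Dg'[of t]
    by (auto intro!: derivative_eq_intros simp: h_def algebra_simps)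
  have u_mono: "u y \<le> u x" if "0 < x" "x \<le> y" for x y
  proof (rule DERIV_nonpos_imp_nonincreasing[OF that(2)])
    fix t assume "x \<le> t"
    then have "0 < t" using that by simp
    moreover have "\<kappa> * (f t - 1) * t powr (- \<kappa> - 1) \<le> 0"
      using f(3)[of t] assms(1) by (intro mult_nonpos_nonneg mult_nonneg_nonpos) auto
    ultimately show "\<exists>y. (u has_real_derivative y) (at t) \<and> y \<le> 0" using Du by blast
  qed
  let ?a = "r1 + d" and ?b = "r2 - d"
  have u_const: "u t = u ?b" if "?a \<le> t" "t \<le> ?b" for t
  proof (cases "t = ?b")
    case False
    then have "t < ?b" using that by simp
    moreover have "(u has_real_derivative \<kappa> * (f s - 1) * s powr (- \<kappa> - 1)) (at s)" if "t \<le> s" for s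
      using that \<open>?a \<le> t\<close> assms by (intro Du) simp
    ultimately obtain y where "t < y" "y < ?b" "u ?b - u t = (?b - t) * (\<kappa> * (f y - 1) * y powr (- \<kappa> - 1))"
      using MVT2[of t ?b u "\<lambda>s. \<kappa> * (f s - 1) * s powr (- \<kappa> - 1)"] by blast
    then show ?thesis using f(6)[of y] that by simp
  qed simp
  have ub: "u ?b \<le> ?b powr - \<kappa>" using g'_le[of ?b] assms(1) by (simp add: u_def mult_nonneg_nonpos)
  have left: "\<kappa> * g' t \<le> ?b powr - \<kappa> - ?a powr - \<kappa>" if "t \<le> ?a" for t
  proof -
    have "\<kappa> * g' t \<le> \<kappa> * g' ?a" using g'_mono[OF that] assms(1) by simp
    also have "\<dots> = u ?b - ?a powr - \<kappa>" using u_const[of ?a] assms(4) by (simp add: u_def)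
    finally show ?thesis using ub by simp
  qed
  have powr_le: "y powr - \<kappa> \<le> x powr - \<kappa>" if "0 < x" "x \<le> y" for x y :: real
    using that assms(1) by (intro powr_mono2') auto
  have th: "t * h t \<le> t powr - \<kappa>" if "0 < t" for t
  proof -
    have "t * h t = f t * t powr - \<kappa>" using that by (simp add: h_def powr_diff)
    also have "\<dots> \<le> t powr - \<kappa>" using f(2,3) by (intro mult_left_le_one_le) auto
    finally show ?thesis .
  qed
  show ?thesis
  proof (rule exI[of _ g], rule exI[of _ g'], rule exI[of _ h], intro conjI allI impI)
    show "\<kappa> * g' t + t * h t \<le> ?b powr - \<kappa> - ?a powr - \<kappa>" if "t < r1" for t
      using left[of t] h_out[of t] that assms(3) by simp
    show "\<kappa> * g' t + t * h t \<le> ?b powr - \<kappa> + (r1 powr - \<kappa> - ?a powr - \<kappa>)" if "r1 \<le> t \<and> t < r2" for t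
    proof -
      have t: "0 < t" using that assms by simp
      \<comment> \<open>This correction is the loss on the inner transition layer, where
        \<open>t * h t\<close> is bounded only by \<open>r1 powr - \<kappa>\<close> and
        \<open>g'\<close> only by its value at \<open>r1 + d\<close>.\<close>
      have eta: "0 \<le> r1 powr - \<kappa> - ?a powr - \<kappa>" using powr_le[of r1 ?a] assms by simp
      consider "t \<le> ?a" | "?a \<le> t" "t \<le> ?b" | "?b \<le> t" by linarith
      then show ?thesis
      proof cases
        case 1
        then show ?thesis using left[OF 1] th[OF t] powr_le[OF assms(2) conjunct1[OF that]] by linarith
      next
        case 2
        then have "\<kappa> * g' t + t * h t = u t"
          using f(6)[of t] t by (simp add: u_def h_def powr_diff)
        then show ?thesis using u_const[OF 2] ub eta by simp
      next
        case 3
        have "\<kappa> * g' t \<le> 0" using g'_le assms(1) by (simp add: mult_nonneg_nonpos)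
        then show ?thesis using th[OF t] powr_le[of ?b t] 3 assms eta by linarith
      qed
    qed
    show "\<kappa> * g t \<le> (t powr (1 - \<kappa>) - r2 powr (1 - \<kappa>)) / (\<kappa> - 1)" if "0 < t \<and> t \<le> r2" for t
    proof -
      \<comment> \<open>The derivative of \<open>?w\<close> is \<open>u\<close>, which is
        nonnegative up to \<open>r2\<close> because it decreases to the value
        \<open>r2 powr - \<kappa>\<close> there.\<close>
      let ?w = "\<lambda>t. \<kappa> * g t - t powr (1 - \<kappa>) / (\<kappa> - 1)"
      have "?w t \<le> ?w r2"
      proof (rule DERIV_nonneg_imp_nondecreasing[OF conjunct2[OF that]])
        fix s assume s: "t \<le> s" "s \<le> r2"
        then have "0 < s" using that by simp
        then have "(?w has_real_derivative u s) (at s)"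
          unfolding u_def using Dg[of s] assms(1)
          by (auto intro!: derivative_eq_intros simp: divide_simps) (simp add: algebra_simps)
        moreover have "0 \<le> u s" using u_mono[OF \<open>0 < s\<close> s(2)] by (simp add: u_def g'_out)
          (meson order_trans powr_ge_zero)
        ultimately show "\<exists>y. (?w has_real_derivative y) (at s) \<and> 0 \<le> y" by blast
      qed
      then show ?thesis by (simp add: g_out diff_divide_distrib)
    qed
  qed (simp_all add: smooth_g smooth_g' smooth_h Dg Dg' g_out g'_out h_out h0 g_nonneg)
qed

text \<open>At t = s^2 the bound on \<open>w\<close> is the integral of 2 \<tau>^(1-2\<kappa>) over
  \<tau> from s to \<rho>. Inserting this for s = |x - z| and exchanging the integrals by Tonelli,
  the set of \<open>x\<close> belonging to a given \<tau> is the ball of radius \<tau>.\<close>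

lemma radial_nn_integral_le:
  fixes \<nu> :: "'a::euclidean_space measure" and w :: "real \<Rightarrow> real"
  assumes sets [measurable_cong]: "sets \<nu> = sets borel" and fin: "emeasure \<nu> (ball z \<rho>) < \<infinity>"
    and \<kappa>: "1 < \<kappa>" and \<rho>: "0 < \<rho>" and cont: "continuous_on UNIV w" and nonneg: "\<And>t. 0 \<le> w t"
    and out: "\<And>t. \<rho>\<^sup>2 \<le> t \<Longrightarrow> w t = 0"
    and le: "\<And>t. 0 < t \<Longrightarrow> t \<le> \<rho>\<^sup>2 \<Longrightarrow> w t \<le> (t powr (1 - \<kappa>) - (\<rho>\<^sup>2) powr (1 - \<kappa>)) / (\<kappa> - 1)"
  shows "(\<integral>\<^sup>+x. ennreal (w ((norm (x - z))\<^sup>2)) \<partial>\<nu>) \<le>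
    (\<integral>\<^sup>+\<tau>. ennreal (2 * \<tau> powr (1 - 2 * \<kappa>)) * emeasure \<nu> (ball z \<tau>) * indicator {0<..\<rho>} \<tau> \<partial>lborel)"
proof -
  let ?k = "\<lambda>\<tau>. 2 * \<tau> powr (1 - 2 * \<kappa>)"
  define K where "K = (\<lambda>(x::'a) \<tau>. if norm (x - z) < \<tau> \<and> \<tau> \<le> \<rho> then ennreal (?k \<tau>) else 0)"
  \<comment> \<open>Radii \<open>s\<close> strictly larger than |x - z| come first because the power
    is singular at 0, the value of the norm at the centre; continuity of \<open>w\<close> lets
    \<open>s\<close> decrease to |x - z| afterwards.\<close>
  have above: "ennreal (w (s\<^sup>2)) \<le> (\<integral>\<^sup>+\<tau>. K x \<tau> \<partial>lborel)" if s: "norm (x - z) < s" "s < \<rho>" for x s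
  proof -
    have s0: "0 < s" using s(1) norm_ge_zero[of "x - z"] by linarith
    let ?P = "\<lambda>\<tau>. - (\<tau> powr (2 - 2 * \<kappa>)) / (\<kappa> - 1)"
    have "(\<integral>\<^sup>+\<tau>. ennreal (?k \<tau>) * indicator {s..\<rho>} \<tau> \<partial>lborel) = ennreal (?P \<rho> - ?P s)"
    proof (rule nn_integral_FTC_Icc)
      fix \<tau> assume "\<tau> \<in> {s..\<rho>}"
      then have "0 < \<tau>" using s0 by simp
      then show "(?P has_real_derivative ?k \<tau>) (at \<tau>)"
        using \<kappa>
        by (auto intro!: derivative_eq_intros simp: divide_simps) (simp add: algebra_simps)
    qed (use s in auto)
    moreover have "w (s\<^sup>2) \<le> ?P \<rho> - ?P s"
    proof -
      have sq: "(t\<^sup>2) powr (1 - \<kappa>) = t powr (2 - 2 * \<kappa>)" if "0 < t" for t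
      proof -
        have "(t\<^sup>2) powr (1 - \<kappa>) = (t powr 2) powr (1 - \<kappa>)" using that by (simp add: powr_numeral)
        then show ?thesis by (simp add: powr_powr algebra_simps)
      qed
      have "w (s\<^sup>2) \<le> ((s\<^sup>2) powr (1 - \<kappa>) - (\<rho>\<^sup>2) powr (1 - \<kappa>)) / (\<kappa> - 1)"
        using s s0 by (intro le) (auto intro!: power_mono)
      then show ?thesis by (simp add: sq s0 \<rho> diff_divide_distrib)
    qed
    ultimately have "ennreal (w (s\<^sup>2)) \<le> (\<integral>\<^sup>+\<tau>. ennreal (?k \<tau>) * indicator {s..\<rho>} \<tau> \<partial>lborel)"
      by (simp add: ennreal_leI)
    also have "\<dots> \<le> (\<integral>\<^sup>+\<tau>. K x \<tau> \<partial>lborel)"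
      using s by (intro nn_integral_mono) (auto simp: K_def split: split_indicator)
    finally show ?thesis .
  qed
  have pointwise: "ennreal (w ((norm (x - z))\<^sup>2)) \<le> (\<integral>\<^sup>+\<tau>. K x \<tau> \<partial>lborel)" if x: "x \<in> ball z \<rho>" for x
  proof -
    let ?s = "norm (x - z)"
    have less: "?s < \<rho>" using x by (simp add: dist_norm norm_minus_commute)
    have "isCont w (?s\<^sup>2)" using cont by (simp add: continuous_on_eq_continuous_at)
    then have "((\<lambda>s. w (s\<^sup>2)) \<longlongrightarrow> w (?s\<^sup>2)) (at_right ?s)"
      by (intro isCont_tendsto_compose[of _ w] tendsto_intros)
    then have "((\<lambda>s. ennreal (w (s\<^sup>2))) \<longlongrightarrow> ennreal (w (?s\<^sup>2))) (at_right ?s)"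
      by (rule tendsto_ennrealI)
    moreover have "\<forall>\<^sub>F s in at_right ?s. ennreal (w (s\<^sup>2)) \<le> (\<integral>\<^sup>+\<tau>. K x \<tau> \<partial>lborel)"
      unfolding eventually_at_right[OF less] using above less by blast
    ultimately show ?thesis by (rule tendsto_upperbound) simp
  qed
  \<comment> \<open>Only the ball is known to have finite mass, so \<open>\<nu>\<close> is cut off
    to it to obtain the sigma-finiteness required by Tonelli.\<close>
  define \<nu>' where "\<nu>' = density \<nu> (indicator (ball z \<rho>))"
  have sets' [measurable_cong]: "sets \<nu>' = sets borel" by (simp add: \<nu>'_def sets)
  have ind: "(indicator A :: 'a \<Rightarrow> ennreal) \<in> borel_measurable \<nu>" if "A \<in> sets borel" for A
    using that by (intro borel_measurable_indicator) (simp add: sets)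
  have e': "emeasure \<nu>' A = emeasure \<nu> (A \<inter> ball z \<rho>)" if "A \<in> sets borel" for A
    unfolding \<nu>'_def using that
    by (subst emeasure_density)
      (auto simp: sets ind Int_commute simp flip: indicator_inter_arith)
  have "finite_measure \<nu>'"
  proof (rule finite_measureI)
    have "emeasure \<nu>' (space \<nu>') = emeasure \<nu> (ball z \<rho>)"
      using e'[of UNIV] sets_eq_imp_space_eq[OF sets'] by simp
    then show "emeasure \<nu>' (space \<nu>') \<noteq> \<infinity>" using fin by simp
  qed
  then interpret F: finite_measure \<nu>' .
  interpret P: pair_sigma_finite \<nu>' lborel ..
  have w [measurable]: "w \<in> borel_measurable borel"
    by (rule borel_measurable_continuous_onI[OF cont])
  have zero: "w ((norm (x - z))\<^sup>2) = 0" if "x \<notin> ball z \<rho>" for x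
    using that \<rho> by (intro out power_mono) (auto simp: dist_norm norm_minus_commute)
  have "(\<integral>\<^sup>+x. ennreal (w ((norm (x - z))\<^sup>2)) \<partial>\<nu>)
      = (\<integral>\<^sup>+x. indicator (ball z \<rho>) x * ennreal (w ((norm (x - z))\<^sup>2)) \<partial>\<nu>)"
    using zero by (intro nn_integral_cong) (auto split: split_indicator)
  also have "\<dots> = (\<integral>\<^sup>+x. ennreal (w ((norm (x - z))\<^sup>2)) \<partial>\<nu>')"
    unfolding \<nu>'_def by (intro nn_integral_density[symmetric] ind) auto
  also have "\<dots> \<le> (\<integral>\<^sup>+x. (\<integral>\<^sup>+\<tau>. K x \<tau> \<partial>lborel) \<partial>\<nu>')"
    using pointwise zero by (intro nn_integral_mono) (metis ennreal_0 zero_le)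
  also have "\<dots> = (\<integral>\<^sup>+\<tau>. (\<integral>\<^sup>+x. K x \<tau> \<partial>\<nu>') \<partial>lborel)"
    by (rule P.Fubini'[symmetric]) (simp add: K_def case_prod_unfold)
  also have "\<dots> \<le> (\<integral>\<^sup>+\<tau>. ennreal (?k \<tau>) * emeasure \<nu> (ball z \<tau>) * indicator {0<..\<rho>} \<tau> \<partial>lborel)"
  proof (rule nn_integral_mono)
    fix \<tau>
    have "(\<integral>\<^sup>+x. K x \<tau> \<partial>\<nu>') = (\<integral>\<^sup>+x. (ennreal (?k \<tau>) * indicator {0<..\<rho>} \<tau>) * indicator (ball z \<tau>) x \<partial>\<nu>')"
      by (intro nn_integral_cong)
        (auto simp: K_def dist_norm norm_minus_commute split: split_indicator intro: le_less_trans[OF norm_ge_zero])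
    also have "\<dots> = (ennreal (?k \<tau>) * indicator {0<..\<rho>} \<tau>) * emeasure \<nu>' (ball z \<tau>)"
      by (rule nn_integral_cmult_indicator) (simp add: sets')
    also have "\<dots> \<le> (ennreal (?k \<tau>) * indicator {0<..\<rho>} \<tau>) * emeasure \<nu> (ball z \<tau>)"
      by (intro mult_left_mono) (auto simp: e' sets intro!: emeasure_mono)
    finally show "(\<integral>\<^sup>+x. K x \<tau> \<partial>\<nu>') \<le> ennreal (?k \<tau>) * emeasure \<nu> (ball z \<tau>) * indicator {0<..\<rho>} \<tau>"
      by (simp add: ac_simps)
  qed
  finally show ?thesis .
qed

text \<open>The limit is the lower limit of \<open>W\<close> at 0, written as a supremum of infima.
  It is finite by the case \<open>e = 1\<close>. Near a radius where \<open>W\<close> is close to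
  its infimum, almost monotonicity bounds all smaller radii from above.\<close>

lemma almost_monotone_limit:
  fixes W :: "real \<Rightarrow> real"
  assumes "0 < \<epsilon>" "\<And>r. 0 < r \<Longrightarrow> r < \<epsilon> \<Longrightarrow> 0 \<le> W r"
    and almost: "\<And>e. 0 < e \<Longrightarrow> \<exists>d>0. d \<le> \<epsilon> \<and> (\<forall>r s. 0 < r \<longrightarrow> r < s \<longrightarrow> s < d \<longrightarrow> W r \<le> W s + e)"
  shows "\<exists>l. (W \<longlongrightarrow> l) (at_right 0)"
proof -
  obtain d1 where d1: "0 < d1" "d1 \<le> \<epsilon>" "\<And>r s. 0 < r \<Longrightarrow> r < s \<Longrightarrow> s < d1 \<Longrightarrow> W r \<le> W s + 1"
    using almost[of 1] by auto
  define I where "I = (\<lambda>d. Inf (W ` {0<..<d}))"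
  have bdd: "bdd_below (W ` {0<..<d})" if "d \<le> \<epsilon>" for d
    using assms(2) that by (intro bdd_belowI[of _ 0]) auto
  have ne: "W ` {0<..<d} \<noteq> {}" if "0 < d" for d using that by simp
  have I_le: "I d \<le> W r" if "0 < r" "r < d" "d \<le> \<epsilon>" for r d
    unfolding I_def using that by (intro cInf_lower bdd) auto
  define l where "l = Sup (I ` {0<..d1})"
  have "bdd_above (I ` {0<..d1})"
  proof (rule bdd_aboveI)
    fix y assume "y \<in> I ` {0<..d1}"
    then obtain d where d: "y = I d" "0 < d" "d \<le> d1" by auto
    have "I d \<le> W (d / 3)" using d d1 by (intro I_le) auto
    also have "\<dots> \<le> W (d1 / 2) + 1" using d d1 by (intro d1) auto
    finally show "y \<le> W (d1 / 2) + 1" using d by simp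
  qed
  then have I_l: "I d \<le> l" if "0 < d" "d \<le> d1" for d
    unfolding l_def using that by (intro cSup_upper) auto
  have "(W \<longlongrightarrow> l) (at_right 0)"
  proof (rule order_tendstoI)
    fix a assume "a < l"
    then obtain y where "y \<in> I ` {0<..d1}" "a < y"
      using less_cSupE[of a "I ` {0<..d1}"] d1(1) unfolding l_def by auto
    then obtain d where d: "0 < d" "d \<le> d1" "a < I d" by auto
    then have "a < W r" if "0 < r" "r < d" for r
      using I_le[OF that] d1 by linarith
    then show "\<forall>\<^sub>F r in at_right 0. a < W r"
      unfolding eventually_at_right[OF d(1)] using d(1) by blast
  next
    fix a assume a: "l < a"
    obtain d where d: "0 < d" "d \<le> \<epsilon>" "\<And>r s. 0 < r \<Longrightarrow> r < s \<Longrightarrow> s < d \<Longrightarrow> W r \<le> W s + (a - l) / 2"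
      using almost[of "(a - l) / 2"] a by auto
    let ?d = "min d d1"
    have "I ?d < l + (a - l) / 2" using I_l[of ?d] d d1 a by (simp add: less_add_same_cancel1 le_less_trans)
    then obtain s where s: "0 < s" "s < ?d" "W s < l + (a - l) / 2"
      using cInf_less_iff[OF ne bdd, of ?d "l + (a - l) / 2"] d d1 unfolding I_def by auto
    have "W r < a" if "0 < r" "r < s" for r
      using d(3)[of r s] s that by (simp add: field_simps)
    then show "\<forall>\<^sub>F r in at_right 0. W r < a"
      unfolding eventually_at_right[OF s(1)] using s(1) by blast
  qed
  then show ?thesis by blast
qed

text \<open>The real-analysis half of the proof, with the current eliminated: \<open>int\<close> and
  \<open>basic\<close> are all that T contributes, and they concern radial functions only.\<close>

lemma limit_of_basic_inequality:
  fixes \<mu> \<nu> :: "'a::euclidean_space measure" and z :: 'a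
  assumes sets: "sets \<mu> = sets borel" "sets \<nu> = sets borel" and \<kappa>: "1 < \<kappa>" and \<epsilon>: "0 < \<epsilon>"
    and fin: "\<And>r. r < \<epsilon> \<Longrightarrow> emeasure \<mu> (ball z r) < \<infinity>" "\<And>r. r < \<epsilon> \<Longrightarrow> emeasure \<nu> (ball z r) < \<infinity>"
    and int: "\<And>R (u :: real \<Rightarrow> real). 0 < R \<Longrightarrow> R < \<epsilon> \<Longrightarrow> smooth_on UNIV u \<Longrightarrow> (\<And>t. R\<^sup>2 \<le> t \<Longrightarrow> u t = 0) \<Longrightarrow>
      integrable \<mu> (\<lambda>x. u ((norm (x - z))\<^sup>2))"
    and basic: "\<And>R (g :: real \<Rightarrow> real) g' h d. 0 < R \<Longrightarrow> R < \<epsilon> \<Longrightarrow>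
      smooth_on UNIV g \<Longrightarrow> smooth_on UNIV g' \<Longrightarrow> smooth_on UNIV h \<Longrightarrow>
      (\<And>t. (g has_real_derivative g' t) (at t)) \<Longrightarrow> (\<And>t. (g' has_real_derivative h t) (at t)) \<Longrightarrow>
      (\<And>t. R\<^sup>2 \<le> t \<Longrightarrow> g t = 0) \<Longrightarrow> (\<And>t. R\<^sup>2 \<le> t \<Longrightarrow> g' t = 0) \<Longrightarrow> (\<And>t. R\<^sup>2 \<le> t \<Longrightarrow> h t = 0) \<Longrightarrow>
      (\<And>t. 0 \<le> h t) \<Longrightarrow> 0 < d \<Longrightarrow> (\<And>t. t \<le> d \<Longrightarrow> h t = 0) \<Longrightarrow>
      0 \<le> \<kappa> * (\<integral>x. g ((norm (x - z))\<^sup>2) \<partial>\<nu>)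
        + (\<integral>x. \<kappa> * g' ((norm (x - z))\<^sup>2) + (norm (x - z))\<^sup>2 * h ((norm (x - z))\<^sup>2) \<partial>\<mu>)"
    and integrable: "set_integrable lborel {0<..<\<epsilon>} (\<lambda>t. t powr (1 - 2 * \<kappa>) * measure \<nu> (ball z t))"
  shows "\<exists>l. ((\<lambda>r. measure \<mu> (ball z r) * r powr (- 2 * \<kappa>)) \<longlongrightarrow> l) (at_right 0)"
proof -
  let ?W = "\<lambda>r. measure \<mu> (ball z r) * r powr (- 2 * \<kappa>)"
  let ?\<psi> = "\<lambda>t. t powr (1 - 2 * \<kappa>) * measure \<nu> (ball z t)"
  \<comment> \<open>This bounds the \<nu>-term for outer radius \<open>s\<close> uniformly in the
    inner radius and in the transition width, which is what makes the error small as soon as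
    \<open>s\<close> is.\<close>
  define \<Psi> where "\<Psi> = (\<lambda>r. 2 * (LINT t:{0<..r}|lborel. ?\<psi> t))"
  have integrable': "set_integrable lborel {0<..r} ?\<psi>" if "r < \<epsilon>" for r
    by (rule set_integrable_subset[OF integrable]) (use that in auto)
  have \<Psi>_mono: "\<Psi> r \<le> \<Psi> s" if "r \<le> s" "s < \<epsilon>" for r s
  proof -
    have "(LINT t:{0<..r}|lborel. ?\<psi> t) \<le> (LINT t:{0<..s}|lborel. ?\<psi> t)"
      unfolding set_lebesgue_integral_def
      using integrable'[of r] integrable'[of s] that
      by (intro integral_mono) (auto simp: set_integrable_def split: split_indicator)
    then show ?thesis by (simp add: \<Psi>_def)
  qed
  have \<Psi>_small: "\<exists>r>0. r < \<epsilon> \<and> \<Psi> r < e" if "0 < e" for e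
  proof -
    let ?r = "\<lambda>j::nat. \<epsilon> / (real j + 2)"
    have r: "0 < ?r j" "?r j < \<epsilon>" for j using \<epsilon> by (auto simp: divide_less_eq)
    have "(\<lambda>j. \<integral>t. indicator {0<..?r j} t *\<^sub>R ?\<psi> t \<partial>lborel) \<longlonglongrightarrow> (\<integral>t. 0 \<partial>(lborel :: real measure))"
    proof (rule integral_dominated_convergence[where w = "\<lambda>t. indicator {0<..<\<epsilon>} t *\<^sub>R ?\<psi> t"])
      show "integrable lborel (\<lambda>t. indicator {0<..<\<epsilon>} t *\<^sub>R ?\<psi> t)"
        using integrable by (simp add: set_integrable_def)
      show "(\<lambda>t. indicator {0<..?r j} t *\<^sub>R ?\<psi> t) \<in> borel_measurable lborel" for j
        using integrable'[OF r(2)] unfolding set_integrable_def by (rule borel_measurable_integrable)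
      show "AE t in lborel. norm (indicator {0<..?r j} t *\<^sub>R ?\<psi> t) \<le> indicator {0<..<\<epsilon>} t *\<^sub>R ?\<psi> t" for j
        using r(2)[of j] by (intro always_eventually) (auto split: split_indicator)
      show "AE t in lborel. (\<lambda>j. indicator {0<..?r j} t *\<^sub>R ?\<psi> t) \<longlonglongrightarrow> 0"
      proof (intro always_eventually allI)
        fix t
        show "(\<lambda>j. indicator {0<..?r j} t *\<^sub>R ?\<psi> t) \<longlonglongrightarrow> 0"
        proof (cases "0 < t")
          case True
          obtain J :: nat where J: "\<epsilon> / t < real J" using reals_Archimedean2 by blast
          have "indicator {0<..?r j} t *\<^sub>R ?\<psi> t = 0" if "J \<le> j" for j
          proof -
            have "\<epsilon> < real J * t" using J True by (simp add: field_simps)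
            also have "\<dots> \<le> (real j + 2) * t" using that True by (intro mult_right_mono) auto
            finally have "?r j < t" by (simp add: field_simps)
            then show ?thesis by simp
          qed
          then have "\<forall>\<^sub>F j in sequentially. indicator {0<..?r j} t *\<^sub>R ?\<psi> t = 0"
            using eventually_sequentially by blast
          then show ?thesis by (rule tendsto_eventually)
        qed simp
      qed
    qed simp
    then have "(\<lambda>j. \<Psi> (?r j)) \<longlonglongrightarrow> 2 * 0"
      unfolding \<Psi>_def set_lebesgue_integral_def by (intro tendsto_mult_left) simp
    then have "\<forall>\<^sub>F j in sequentially. \<Psi> (?r j) < e"
      using \<open>0 < e\<close> by (intro order_tendstoD(2)[where y = "2 * 0"]) auto
    then obtain j where "\<Psi> (?r j) < e" by (auto simp: eventually_sequentially)
    then show ?thesis using r[of j] by blast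
  qed
  have main: "?W r \<le> ?W s + \<Psi> s" if rs: "0 < r" "r < s" "s < \<epsilon>" for r s
  proof -
    \<comment> \<open>What the basic inequality yields for the profile with inner radius
      \<open>r\<close>, outer radius \<open>s\<close> and transition width \<open>d\<close> in the
      squared variable. At \<open>d = 0\<close> it reads
      \<open>\<Psi> s + ?W s - ?W r\<close>.\<close>
    let ?E = "\<lambda>d. \<Psi> s + ((s\<^sup>2 - d) powr - \<kappa> + ((r\<^sup>2) powr - \<kappa> - (r\<^sup>2 + d) powr - \<kappa>)) * measure \<mu> (ball z s)
      - (r\<^sup>2 + d) powr - \<kappa> * measure \<mu> (ball z r)"
    have sq: "r\<^sup>2 < s\<^sup>2" "0 < r\<^sup>2" using rs by (auto intro: power_strict_mono)
    have E: "0 \<le> ?E d" if d: "0 < d" "d < (s\<^sup>2 - r\<^sup>2) / 2" for d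
    proof -
      have gap: "r\<^sup>2 + d < s\<^sup>2 - d" using d by simp
      obtain g g' h where P: "smooth_on UNIV g \<and> smooth_on UNIV g' \<and> smooth_on UNIV h \<and>
        (\<forall>t. (g has_real_derivative g' t) (at t)) \<and> (\<forall>t. (g' has_real_derivative h t) (at t)) \<and>
        (\<forall>t\<ge>s\<^sup>2. g t = 0 \<and> g' t = 0 \<and> h t = 0) \<and> (\<forall>t. 0 \<le> h t \<and> 0 \<le> g t) \<and> (\<forall>t\<le>r\<^sup>2. h t = 0) \<and>
        (\<forall>t<r\<^sup>2. \<kappa> * g' t + t * h t \<le> (s\<^sup>2 - d) powr - \<kappa> - (r\<^sup>2 + d) powr - \<kappa>) \<and>
        (\<forall>t. r\<^sup>2 \<le> t \<and> t < s\<^sup>2 \<longrightarrow>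
          \<kappa> * g' t + t * h t \<le> (s\<^sup>2 - d) powr - \<kappa> + ((r\<^sup>2) powr - \<kappa> - (r\<^sup>2 + d) powr - \<kappa>)) \<and>
        (\<forall>t. 0 < t \<and> t \<le> s\<^sup>2 \<longrightarrow> \<kappa> * g t \<le> (t powr (1 - \<kappa>) - (s\<^sup>2) powr (1 - \<kappa>)) / (\<kappa> - 1))"
        using smooth_profile[OF \<kappa> sq(2) d(1) gap] by (elim exE)
      let ?\<phi> = "\<lambda>x. (norm (x - z))\<^sup>2"
      let ?F = "\<lambda>x. \<kappa> * g' (?\<phi> x) + ?\<phi> x * h (?\<phi> x)"
      have ball_iff: "x \<in> ball z t \<longleftrightarrow> ?\<phi> x < t\<^sup>2" if "0 < t" for x t
      proof -
        have "dist z x = norm (x - z)" by (simp add: dist_norm norm_minus_commute)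
        then show ?thesis using that power_mono_iff[of t "norm (x - z)" 2] by (simp add: not_le[symmetric])
      qed
      have sm: "smooth_on UNIV g'" "smooth_on UNIV h" using P by simp_all
      have ineq: "0 \<le> \<kappa> * (\<integral>x. g (?\<phi> x) \<partial>\<nu>) + (\<integral>x. ?F x \<partial>\<mu>)"
        using P rs by (intro basic[of s g g' h "r\<^sup>2"]) auto
      have "(\<integral>\<^sup>+x. ennreal (\<kappa> * g (?\<phi> x)) \<partial>\<nu>) \<le> (\<integral>\<^sup>+t. ennreal (2 * t powr (1 - 2 * \<kappa>)) *
          emeasure \<nu> (ball z t) * indicator {0<..s} t \<partial>lborel)"
        using P rs \<kappa> sets fin smooth_on_continuous[of UNIV g]
        by (intro radial_nn_integral_le) (auto intro!: continuous_intros)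
      also have "\<dots> = (\<integral>\<^sup>+t. ennreal (2 * (indicator {0<..s} t *\<^sub>R ?\<psi> t)) \<partial>lborel)"
      proof (intro nn_integral_cong)
        fix t :: real
        show "ennreal (2 * t powr (1 - 2 * \<kappa>)) * emeasure \<nu> (ball z t) * indicator {0<..s} t
          = ennreal (2 * (indicator {0<..s} t *\<^sub>R ?\<psi> t))"
        proof (cases "t \<in> {0<..s}")
          case True
          then have "emeasure \<nu> (ball z t) = ennreal (measure \<nu> (ball z t))"
            using fin(2)[of t] rs by (intro emeasure_eq_ennreal_measure) auto
          then show ?thesis using True by (simp add: ennreal_mult[symmetric] mult.assoc)
        qed simp
      qed
      also have "\<dots> = ennreal (\<Psi> s)"
        using integrable'[OF rs(3)] unfolding \<Psi>_def set_lebesgue_integral_def set_integrable_def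
        by (subst nn_integral_eq_integral) (auto simp: integral_mult_right_zero split: split_indicator)
      finally have nn: "(\<integral>\<^sup>+x. ennreal (\<kappa> * g (?\<phi> x)) \<partial>\<nu>) \<le> ennreal (\<Psi> s)" .
      have \<Psi>0: "0 \<le> \<Psi> s"
        unfolding \<Psi>_def set_lebesgue_integral_def by (auto intro!: integral_nonneg_AE split: split_indicator)
      have "\<kappa> * (\<integral>x. g (?\<phi> x) \<partial>\<nu>) = (\<integral>x. \<kappa> * g (?\<phi> x) \<partial>\<nu>)" by simp
      also have "\<dots> \<le> \<Psi> s"
        using nn \<Psi>0 P \<kappa> by (intro integral_real_bounded) auto
      finally have \<nu>_le: "\<kappa> * (\<integral>x. g (?\<phi> x) \<partial>\<nu>) \<le> \<Psi> s" .
      let ?c = "(s\<^sup>2 - d) powr - \<kappa> + ((r\<^sup>2) powr - \<kappa> - (r\<^sup>2 + d) powr - \<kappa>)" and ?a = "(r\<^sup>2 + d) powr - \<kappa>"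
      \<comment> \<open>The correction inside \<open>?c\<close> is therefore nonnegative, so the
        sharper bound on the inner ball can be relaxed to \<open>?c - ?a\<close>, and one
        combination of two indicators majorizes \<open>?F\<close> everywhere.\<close>
      have eta: "?a \<le> (r\<^sup>2) powr - \<kappa>" using sq d \<kappa> by (intro powr_mono2') auto
      have ib: "integrable \<mu> (indicator (ball z t) :: 'a \<Rightarrow> real)" if "t < \<epsilon>" for t
        using fin(1)[OF that] sets by (intro integrable_real_indicator) auto
      have "(\<integral>x. ?F x \<partial>\<mu>) \<le> (\<integral>x. ?c * indicator (ball z s) x - ?a * indicator (ball z r) x \<partial>\<mu>)"
      proof (rule integral_mono)
        have "smooth_on UNIV (\<lambda>t. \<kappa> * g' t + t * h t)"
          by (intro smooth_on_add smooth_on_mult smooth_on_const sm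
              smooth_on_bounded_linear[OF open_UNIV bounded_linear_ident] open_UNIV)
        then show "integrable \<mu> ?F" using int[of s "\<lambda>t. \<kappa> * g' t + t * h t"] P rs by simp
        show "integrable \<mu> (\<lambda>x. ?c * indicator (ball z s) x - ?a * indicator (ball z r) x)"
          using ib rs by (intro Bochner_Integration.integrable_diff integrable_mult_right) auto
        fix x
        have mem: "x \<in> ball z r \<longleftrightarrow> ?\<phi> x < r\<^sup>2" "x \<in> ball z s \<longleftrightarrow> ?\<phi> x < s\<^sup>2"
          using rs by (intro ball_iff; simp)+
        consider "?\<phi> x < r\<^sup>2" | "r\<^sup>2 \<le> ?\<phi> x" "?\<phi> x < s\<^sup>2" | "s\<^sup>2 \<le> ?\<phi> x" by linarith
        then show "?F x \<le> ?c * indicator (ball z s) x - ?a * indicator (ball z r) x"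
        proof cases
          case 1
          then have "x \<in> ball z r" "x \<in> ball z s" unfolding mem using sq by linarith+
          moreover have "?F x \<le> (s\<^sup>2 - d) powr - \<kappa> - ?a" using P 1 by blast
          ultimately show ?thesis using eta by simp
        next
          case 2
          then have "x \<notin> ball z r" "x \<in> ball z s" unfolding mem by linarith+
          moreover have "?F x \<le> ?c" using P 2 by blast
          ultimately show ?thesis by simp
        next
          case 3
          then have "x \<notin> ball z r" "x \<notin> ball z s" unfolding mem using sq by linarith+
          moreover have "?F x = 0" using P 3 by simp
          ultimately show ?thesis by simp
        qed
      qed
      also have "\<dots> = ?c * measure \<mu> (ball z s) - ?a * measure \<mu> (ball z r)"
        using ib[of s] ib[of r] rs sets_eq_imp_space_eq[OF sets(1)] by simp
      finally show ?thesis using ineq \<nu>_le by linarith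
    qed
    have "(?E \<longlongrightarrow> \<Psi> s + ((s\<^sup>2 - 0) powr - \<kappa> + ((r\<^sup>2) powr - \<kappa> - (r\<^sup>2 + 0) powr - \<kappa>)) * measure \<mu> (ball z s)
      - (r\<^sup>2 + 0) powr - \<kappa> * measure \<mu> (ball z r)) (at_right 0)"
      using sq rs by (intro tendsto_intros) auto
    moreover have "\<forall>\<^sub>F d in at_right 0. 0 \<le> ?E d"
      using E sq by (subst eventually_at_right[of 0 "(s\<^sup>2 - r\<^sup>2) / 2"]) (auto intro!: exI[of _ "(s\<^sup>2 - r\<^sup>2) / 2"])
    ultimately have "0 \<le> \<Psi> s + ((s\<^sup>2 - 0) powr - \<kappa> + ((r\<^sup>2) powr - \<kappa> - (r\<^sup>2 + 0) powr - \<kappa>)) * measure \<mu> (ball z s)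
      - (r\<^sup>2 + 0) powr - \<kappa> * measure \<mu> (ball z r)"
      by (rule tendsto_lowerbound) simp
    moreover have "(t\<^sup>2) powr - \<kappa> = t powr (- 2 * \<kappa>)" if "0 < t" for t :: real
    proof -
      have "(t\<^sup>2) powr - \<kappa> = (t powr 2) powr - \<kappa>" using that by (simp add: powr_numeral)
      then show ?thesis by (simp add: powr_powr)
    qed
    ultimately show ?thesis using rs by (simp add: algebra_simps)
  qed
  show ?thesis
  proof (rule almost_monotone_limit[OF \<epsilon>])
    show "0 \<le> ?W r" for r by simp
    fix e :: real assume "0 < e"
    then obtain d where d: "0 < d" "d < \<epsilon>" "\<Psi> d < e" using \<Psi>_small by blast
    have "?W r \<le> ?W s + e" if "0 < r" "r < s" "s < d" for r s
      using main[OF that(1,2)] \<Psi>_mono[of s d] that d by simp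
    then show "\<exists>d>0. d \<le> \<epsilon> \<and> (\<forall>r s. 0 < r \<longrightarrow> r < s \<longrightarrow> s < d \<longrightarrow> ?W r \<le> ?W s + e)"
      using d by (intro exI[of _ d]) auto
  qed
qed

theorem theorem2:
  fixes \<Omega> :: "'n::{finite,linorder} cspace set"
    and T :: "'n current"
    and m p :: nat
    and z\<^sub>0 :: "'n cspace"
  assumes "1 \<le> m" and "m < CARD('n)"
    and "open \<Omega>"
    and "p \<le> CARD('n)" and "CARD('n) + 1 \<le> m + p"
    and "is_current \<Omega> p T"
    and "m_negative_current \<Omega> m p T"
    and "m_subharmonic_current \<Omega> m p T"
    and "z\<^sub>0 \<in> \<Omega>"
    and "\<exists>\<epsilon>>0. ball z\<^sub>0 \<epsilon> \<subseteq> \<Omega> \<and>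
           set_integrable lborel {0<..<\<epsilon>}
             (\<lambda>t. t powr (- (2 * real CARD('n) / real m) + 1)
                    * lelong_ratio \<Omega> m (p - 1) (current_ddc T) z\<^sub>0 t)"
  shows "\<exists>l. ((\<lambda>r. lelong_ratio \<Omega> m p T z\<^sub>0 r) \<longlongrightarrow> l) (at_right 0)"
proof -
  interpret m_negative_m_subharmonic \<Omega> T m p
    by unfold_locales (use assms in auto)
  obtain \<epsilon> where \<epsilon>: "0 < \<epsilon>" "ball z\<^sub>0 \<epsilon> \<subseteq> \<Omega>"
    "set_integrable lborel {0<..<\<epsilon>} (\<lambda>t. t powr (- (2 * real CARD('n) / real m) + 1)
       * lelong_ratio \<Omega> m (p - 1) (current_ddc T) z\<^sub>0 t)"
    using assms(10) by blast
  have cball: "cball z\<^sub>0 r \<subseteq> \<Omega>" if "r < \<epsilon>" for r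
    using that \<epsilon>(2) by (force simp: subset_iff)
  define \<kappa> where "\<kappa> = real CARD('n) * real (m + p - CARD('n)) / real m"
  have k: "real (m + p - CARD('n)) = real m + real p - real CARD('n)"
    using assms(5) by (simp add: of_nat_diff)
  have "real (CARD('n) + 1) \<le> real (m + p)" using assms(5) by (rule of_nat_mono)
  \<comment> \<open>Strict because m < n and m + p - n is at least 1; the exponent
    \<open>1 - \<kappa>\<close> of the bound on \<open>g\<close> is thus negative and the division
    by \<open>\<kappa> - 1\<close> is legitimate.\<close>
  then have "real m * 1 < real CARD('n) * (real m + real p - real CARD('n))"
    using assms(2) by (intro mult_less_le_imp_less) auto
  then have \<kappa>: "1 < \<kappa>" using assms(1) by (simp add: \<kappa>_def k)
  \<comment> \<open>Lowering the bidimension by one lowers the exponent of the normalization by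
    2n/m. The factor t^(-2n/m+1) in the hypothesis compensates exactly this and leaves
    t^(1-2\<kappa>) times the mass of the ball.\<close>
  have exponents: "2 * real CARD('n) / real m * (real m + real p - real CARD('n)) = 2 * \<kappa>"
    "2 * real CARD('n) / real m * (real m + real (p - 1) - real CARD('n)) = 2 * \<kappa> - 2 * real CARD('n) / real m"
    using assms(1,2,4,5) by (simp_all add: \<kappa>_def k of_nat_diff field_simps)
  show ?thesis
  proof (rule trace_measure_exists, rule ddc_trace_measure_exists)
    fix \<mu> \<nu> :: "'n cspace measure"
    assume \<mu>: "radon_on \<Omega> \<mu>" "\<And>f. test_fun \<Omega> f \<Longrightarrow> integrable \<mu> f"
      "\<And>f. test_fun \<Omega> f \<Longrightarrow> T (smul (\<lambda>x. of_real (f x)) (B p)) = - of_real (integral\<^sup>L \<mu> f)"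
      "\<And>a r. cball a r \<subseteq> \<Omega> \<Longrightarrow>
        current_integral \<Omega> (current_wedge T (wedge_power kaehler p)) (ball a r) = - measure \<mu> (ball a r)"
    assume \<nu>: "radon_on \<Omega> \<nu>" "\<And>f. test_fun \<Omega> f \<Longrightarrow> integrable \<nu> f"
      "\<And>f. test_fun \<Omega> f \<Longrightarrow>
        T (wedge (B (p - 1)) (ddc (form0 (\<lambda>x. of_real (f x))))) = of_real (integral\<^sup>L \<nu> f)"
      "\<And>a r. cball a r \<subseteq> \<Omega> \<Longrightarrow>
        current_integral \<Omega> (current_wedge (current_ddc T) (wedge_power kaehler (p - 1))) (ball a r)
          = measure \<nu> (ball a r)"
    have fin: "emeasure \<rho> (ball z\<^sub>0 r) < \<infinity>" if "radon_on \<Omega> \<rho>" "r < \<epsilon>" for \<rho> r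
    proof -
      have "emeasure \<rho> (ball z\<^sub>0 r) \<le> emeasure \<rho> (cball z\<^sub>0 r)"
        using that by (intro emeasure_mono) (auto simp: radon_on_def)
      also have "\<dots> < \<infinity>" using that cball by (simp add: radon_on_def)
      finally show ?thesis .
    qed
    have ratio: "t powr (- (2 * real CARD('n) / real m) + 1) * lelong_ratio \<Omega> m (p - 1) (current_ddc T) z\<^sub>0 t
        = t powr (1 - 2 * \<kappa>) * measure \<nu> (ball z\<^sub>0 t)" if "t \<in> {0<..<\<epsilon>}" for t
    proof -
      have "t powr (- (2 * real CARD('n) / real m) + 1) / t powr (2 * \<kappa> - 2 * real CARD('n) / real m)
          = t powr (1 - 2 * \<kappa>)"
        using that by (simp add: powr_diff[symmetric])
      moreover have "lelong_ratio \<Omega> m (p - 1) (current_ddc T) z\<^sub>0 t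
          = measure \<nu> (ball z\<^sub>0 t) / t powr (2 * \<kappa> - 2 * real CARD('n) / real m)"
        using that by (simp only: lelong_ratio_def exponents \<nu>(4)[OF cball] greaterThanLessThan_iff)
      ultimately show ?thesis by (metis times_divide_eq_left times_divide_eq_right)
    qed
    have "\<exists>l. ((\<lambda>r. measure \<mu> (ball z\<^sub>0 r) * r powr (- 2 * \<kappa>)) \<longlongrightarrow> l) (at_right 0)"
    proof (rule limit_of_basic_inequality)
      show "sets \<mu> = sets borel" "sets \<nu> = sets borel"
        using \<mu>(1) \<nu>(1) by (simp_all add: radon_on_def)
      show "emeasure \<mu> (ball z\<^sub>0 r) < \<infinity>" "emeasure \<nu> (ball z\<^sub>0 r) < \<infinity>" if "r < \<epsilon>" for r
        using fin that \<mu>(1) \<nu>(1) by auto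
      show "integrable \<mu> (\<lambda>x. u ((norm (x - z\<^sub>0))\<^sup>2))"
        if "0 < R" "R < \<epsilon>" "smooth_on UNIV u" "\<And>t. R\<^sup>2 \<le> t \<Longrightarrow> u t = 0"
        for R and u :: "real \<Rightarrow> real"
        by (intro \<mu>(2) test_fun_radial[OF that(3,4,1) cball[OF that(2)]])
      show "set_integrable lborel {0<..<\<epsilon>} (\<lambda>t. t powr (1 - 2 * \<kappa>) * measure \<nu> (ball z\<^sub>0 t))"
        using \<epsilon>(3) ratio by (subst (asm) set_integrable_cong[OF refl refl]) auto
      fix R d :: real and g g' h :: "real \<Rightarrow> real"
      assume R: "0 < R" "R < \<epsilon>"
        and gh: "smooth_on UNIV g" "smooth_on UNIV g'" "smooth_on UNIV h"
          "\<And>t. (g has_real_derivative g' t) (at t)" "\<And>t. (g' has_real_derivative h t) (at t)"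
          "\<And>t. R\<^sup>2 \<le> t \<Longrightarrow> g t = 0" "\<And>t. R\<^sup>2 \<le> t \<Longrightarrow> g' t = 0" "\<And>t. R\<^sup>2 \<le> t \<Longrightarrow> h t = 0"
          "\<And>t. 0 \<le> h t" "0 < d" "\<And>t. t \<le> d \<Longrightarrow> h t = 0"
      show "0 \<le> \<kappa> * (\<integral>x. g ((norm (x - z\<^sub>0))\<^sup>2) \<partial>\<nu>)
          + (\<integral>x. \<kappa> * g' ((norm (x - z\<^sub>0))\<^sup>2) + (norm (x - z\<^sub>0))\<^sup>2 * h ((norm (x - z\<^sub>0))\<^sup>2) \<partial>\<mu>)"
        unfolding \<kappa>_def by (rule basic_inequality[OF \<mu>(2,3) \<nu>(3) cball[OF R(2)] R(1) gh])
    qed (use \<kappa> \<epsilon> in auto)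
    then obtain l where l: "((\<lambda>r. measure \<mu> (ball z\<^sub>0 r) * r powr (- 2 * \<kappa>)) \<longlongrightarrow> l) (at_right 0)"
      by blast
    \<comment> \<open>The sign returns here: the Lelong ratio of the negative current is minus the
      normalized mass of \<open>\<mu>\<close>.\<close>
    have "- (measure \<mu> (ball z\<^sub>0 r) * r powr (- 2 * \<kappa>)) = lelong_ratio \<Omega> m p T z\<^sub>0 r"
      if "0 < r" "r < \<epsilon>" for r
      unfolding lelong_ratio_def exponents \<mu>(4)[OF cball[OF that(2)]]
      by (simp add: powr_minus_divide)
    then have "\<forall>\<^sub>F r in at_right 0. - (measure \<mu> (ball z\<^sub>0 r) * r powr (- 2 * \<kappa>)) = lelong_ratio \<Omega> m p T z\<^sub>0 r"
      unfolding eventually_at_right[OF \<epsilon>(1)] using \<epsilon>(1) by blast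
    then show ?thesis
      using Lim_transform_eventually[OF tendsto_minus[OF l]] by blast
  qed
qed

end
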